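(* Let $X^{\mathcal F}$ be a projective toric variety with fan $\mathcal F$ and $X^{\mathcal F}_{\mathbb Q}$ its proalgebraic completion. The fiber of the moment map $M:X^{\mathcal F}_{\mathbb Q}\to\mathrm{Delzant}(\mathcal F)$ over a point lying in (the relative interior of) an $m$-dimensional face of the Delzant polytope is isomorphic to the $m$-dimensional solenoidal torus $(S^1_{\mathbb Q})^m$. In particular, the proper codimension one faces of the polytope correspond to the singular divisors, and there are as many cusps as vertices of the polytope.
   Context: $S^1_{\mathbb Q}$, $\mathbb C^*_{\mathbb Q}$ and $\mathbb C_{\mathbb Q}$ are the inverse limits of copies of $S^1$, $\mathbb C^*$, $\mathbb C$ respectively, indexed by positive integers ordered by divisibility, with bonding maps $z\mapsto z^{m/k}$ for $k\mid m$. $\mathbb C_{\mathbb Q}$ is a topological multiplicative semigroup (with unit) and the quotient map $\mathbb C_{\mathbb Q}\to\mathbb C_{\mathbb Q}/S^1_{\mathbb Q}\cong\mathbb C/S^1\cong[0,+\infty)$ is a semigroup morphism whose fiber over $0$ is a point and whose other fibers are copies of $S^1_{\mathbb Q}$. For a cone $\sigma\subset\mathbb R^n$ let $S^\sigma=\sigma^\vee\cap\mathbb Z^n$ be the dual semigroup, and $\mathrm{Hom}_{sg}$ the space of (unit-preserving) semigroup morphisms. For a fan $\mathcal F$ the toric functor on topological semigroups is $F^{\mathcal F}=\varinjlim_{\sigma\in\mathcal F}\mathrm{Hom}_{sg}(S^\sigma,-)$. Then $X^{\mathcal F}=F^{\mathcal F}(\mathbb C)$ is the toric variety of the fan, $X^{\mathcal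 F}_{\mathbb Q}=F^{\mathcal F}(\mathbb C_{\mathbb Q})$ is its proalgebraic completion (the inverse limit of $X^{\mathcal F}$ under the maps induced by $z\mapsto z^{m/k}$), $\mathrm{Delzant}(\mathcal F)=F^{\mathcal F}([0,+\infty))$ is homeomorphic to the Delzant polytope, and the moment map $M$ is the map obtained by applying $F^{\mathcal F}$ to $\mathbb C_{\mathbb Q}\to[0,+\infty)$. The singular divisors are the preimages in $X^{\mathcal F}_{\mathbb Q}$, under the projection $X^{\mathcal F}_{\mathbb Q}\to X^{\mathcal F}$, of the invariant divisors specified by the rays of the fan. A cusp (solenoidal cusp) is a singular point of $X^{\mathcal F}_{\mathbb Q}$ of the type of a cone over a solenoidal torus $S^1_{\mathbb Q}\times\cdots\times S^1_{\mathbb Q}$, i.e. lying over the special point of an affine toric chart. *)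

theory Defs
  imports "HOL-Analysis.Analysis" "HOL-Algebra.Group"
begin

section \<open>Topological monoids and the solenoids\<close>

record 'a topmonoid = "'a monoid" +
  topo :: "'a topology"

definition mult_on :: "'a::{monoid_mult, topological_space} set \<Rightarrow> 'a topmonoid" where
  "mult_on S = \<lparr>carrier = S, monoid.mult = (*), one = 1, topo = top_of_set S\<rparr>"

abbreviation CC :: "complex topmonoid" where "CC \<equiv> mult_on UNIV"
abbreviation CC_star :: "complex topmonoid" where "CC_star \<equiv> mult_on (- {0})"
abbreviation SS1 :: "complex topmonoid" where "SS1 \<equiv> mult_on (sphere 0 1)"
abbreviation RR_nonneg :: "real topmonoid" where "RR_nonneg \<equiv> mult_on {0..}"

text \<open>The inverse limit of copies of \<open>A\<close> indexed by the positive integers ordered by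
  divisibility, with bonding maps \<open>z \<mapsto> z\<^bsup>m/k\<^esup>\<close> for \<open>k\<close> dividing \<open>m\<close>.\<close>

definition powlim_carrier :: "'a topmonoid \<Rightarrow> (nat \<Rightarrow> 'a) set" where
  "powlim_carrier A = {z \<in> {1..} \<rightarrow>\<^sub>E carrier A.
     \<forall>k\<ge>1. \<forall>m\<ge>1. k dvd m \<longrightarrow> z k = z m [^]\<^bsub>A\<^esub> (m div k)}"

definition powlim :: "'a topmonoid \<Rightarrow> (nat \<Rightarrow> 'a) topmonoid" where
  "powlim A =
     \<lparr>carrier = powlim_carrier A,
      monoid.mult = (\<lambda>z w. \<lambda>k\<in>{1..}. z k \<otimes>\<^bsub>A\<^esub> w k),
      one = (\<lambda>k\<in>{1..}. \<one>\<^bsub>A\<^esub>),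
      topo = subtopology (product_topology (\<lambda>_. topo A) {1..}) (powlim_carrier A)\<rparr>"

abbreviation CC_Q :: "(nat \<Rightarrow> complex) topmonoid" where "CC_Q \<equiv> powlim CC"
abbreviation SS1_Q :: "(nat \<Rightarrow> complex) topmonoid" where "SS1_Q \<equiv> powlim SS1"

definition top_power :: "'a topmonoid \<Rightarrow> nat \<Rightarrow> (nat \<Rightarrow> 'a) topmonoid" where
  "top_power A m =
     \<lparr>carrier = {..<m} \<rightarrow>\<^sub>E carrier A,
      monoid.mult = (\<lambda>x y. \<lambda>i\<in>{..<m}. x i \<otimes>\<^bsub>A\<^esub> y i),
      one = (\<lambda>i\<in>{..<m}. \<one>\<^bsub>A\<^esub>),
      topo = product_topology (\<lambda>_. topo A) {..<m}\<rparr>"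

text \<open>The quotient morphism of \<open>CC_Q\<close> by \<open>SS1_Q\<close>, read through the identification of the
  quotient with \<open>\<complex>/S\<^sup>1\<close> given by the projection to the first copy of \<open>\<complex>\<close>,
  and of \<open>\<complex>/S\<^sup>1\<close> with \<open>[0,\<infinity>)\<close> given by the modulus.
  Lemma \<open>modulus_Q_eq_iff\<close> below says that its fibres are exactly the \<open>SS1_Q\<close>-orbits.\<close>

definition proj1 :: "(nat \<Rightarrow> complex) \<Rightarrow> complex" where
  "proj1 z = z 1"

definition modulus_Q :: "(nat \<Rightarrow> complex) \<Rightarrow> real" where
  "modulus_Q z = cmod (proj1 z)"


section \<open>Lattices, cones and fans\<close>

definition int_vecs :: "(real^'n) set" where
  "int_vecs = {u. \<forall>i. u $ i \<in> \<int>}"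

definition rational_cone :: "(real^'n) set \<Rightarrow> bool" where
  "rational_cone \<sigma> \<longleftrightarrow> (\<exists>V. finite V \<and> V \<subseteq> int_vecs \<and> \<sigma> = convex_cone hull V)"

definition fan :: "(real^'n) set set \<Rightarrow> bool" where
  "fan F \<longleftrightarrow>
     finite F \<and>
     (\<forall>\<sigma>\<in>F. rational_cone \<sigma> \<and> \<sigma> \<inter> uminus ` \<sigma> = {0}) \<and>
     (\<forall>\<sigma>\<in>F. \<forall>\<tau>. \<tau> face_of \<sigma> \<and> \<tau> \<noteq> {} \<longrightarrow> \<tau> \<in> F) \<and>
     (\<forall>\<sigma>\<in>F. \<forall>\<tau>\<in>F. \<sigma> \<inter> \<tau> face_of \<sigma> \<and> \<sigma> \<inter> \<tau> face_of \<tau>)"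

definition dual_sg :: "(real^'n) set \<Rightarrow> (real^'n) set" where
  "dual_sg \<sigma> = {u \<in> int_vecs. \<forall>v\<in>\<sigma>. 0 \<le> u \<bullet> v}"

definition lattice_polytope :: "(real^'n) set \<Rightarrow> bool" where
  "lattice_polytope P \<longleftrightarrow> (\<exists>V. finite V \<and> V \<subseteq> int_vecs \<and> P = convex hull V)"

text \<open>Inner normals, so that the dual semigroup of the cone of a vertex \<open>a\<close> consists of the
  lattice points of the cone generated by \<open>P - a\<close>.\<close>

definition normal_cone :: "(real^'n) set \<Rightarrow> (real^'n) set \<Rightarrow> (real^'n) set" where
  "normal_cone P Q = {v. \<forall>a\<in>Q. \<forall>u\<in>P. a \<bullet> v \<le> u \<bullet> v}"

definition normal_fan :: "(real^'n) set \<Rightarrow> (real^'n) set set" where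
  "normal_fan P = {normal_cone P Q | Q. Q face_of P \<and> Q \<noteq> {}}"


section \<open>The toric functor of a fan\<close>

definition hom_sg_carrier :: "'u::monoid_add set \<Rightarrow> 'a topmonoid \<Rightarrow> ('u \<Rightarrow> 'a) set" where
  "hom_sg_carrier S A = {f \<in> S \<rightarrow>\<^sub>E carrier A.
     f 0 = \<one>\<^bsub>A\<^esub> \<and> (\<forall>u\<in>S. \<forall>v\<in>S. f (u + v) = f u \<otimes>\<^bsub>A\<^esub> f v)}"

definition hom_sg :: "'u::monoid_add set \<Rightarrow> 'a topmonoid \<Rightarrow> ('u \<Rightarrow> 'a) topmonoid" where
  "hom_sg S A =
     \<lparr>carrier = hom_sg_carrier S A,
      monoid.mult = (\<lambda>f g. \<lambda>u\<in>S. f u \<otimes>\<^bsub>A\<^esub> g u),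
      one = (\<lambda>u\<in>S. \<one>\<^bsub>A\<^esub>),
      topo = subtopology (product_topology (\<lambda>_. topo A) S) (hom_sg_carrier S A)\<rparr>"

type_synonym ('n, 'a) chart_point = "(real^'n) set \<times> (real^'n \<Rightarrow> 'a)"

definition toric_charts :: "(real^'n) set set \<Rightarrow> 'a topmonoid \<Rightarrow> ('n, 'a) chart_point topology" where
  "toric_charts F A = sum_topology (\<lambda>\<sigma>. topo (hom_sg (dual_sg \<sigma>) A)) F"

text \<open>A face \<open>\<tau>\<close> of \<open>\<sigma>\<close> has the larger dual semigroup, and the transition map of the direct
  system restricts morphisms from \<open>dual_sg \<tau>\<close> to \<open>dual_sg \<sigma>\<close>. The direct limit is the disjoint
  union of the charts modulo the equivalence relation generated by these maps.\<close>

definition toric_step ::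
    "(real^'n) set set \<Rightarrow> 'a topmonoid \<Rightarrow> (('n, 'a) chart_point \<times> ('n, 'a) chart_point) set" where
  "toric_step F A =
     {((\<tau>, f), (\<sigma>, restrict f (dual_sg \<sigma>))) | \<tau> \<sigma> f.
        \<tau> \<in> F \<and> \<sigma> \<in> F \<and> \<tau> face_of \<sigma> \<and> f \<in> carrier (hom_sg (dual_sg \<tau>) A)}"

definition toric_equiv ::
    "(real^'n) set set \<Rightarrow> 'a topmonoid \<Rightarrow> (('n, 'a) chart_point \<times> ('n, 'a) chart_point) set" where
  "toric_equiv F A = (toric_step F A \<union> (toric_step F A)\<inverse>)\<^sup>*"

definition toric_class ::
    "(real^'n) set set \<Rightarrow> 'a topmonoid \<Rightarrow> ('n, 'a) chart_point \<Rightarrow> ('n, 'a) chart_point set" where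
  "toric_class F A r = toric_equiv F A `` {r}"

definition quotient_topology :: "'a topology \<Rightarrow> ('a \<Rightarrow> 'b) \<Rightarrow> 'b topology" where
  "quotient_topology X q =
     topology (\<lambda>U. U \<subseteq> q ` topspace X \<and> openin X {x \<in> topspace X. q x \<in> U})"

definition toric_space ::
    "(real^'n) set set \<Rightarrow> 'a topmonoid \<Rightarrow> ('n, 'a) chart_point set topology" where
  "toric_space F A = quotient_topology (toric_charts F A) (toric_class F A)"

text \<open>The maps below are defined on classes as the union of the classes of the images of all
  representatives, which are all equal whenever the map respects the gluing.\<close>

definition toric_map ::
    "(real^'n) set set \<Rightarrow> 'b topmonoid \<Rightarrow> ('a \<Rightarrow> 'b)
      \<Rightarrow> ('n, 'a) chart_point set \<Rightarrow> ('n, 'b) chart_point set" where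
  "toric_map F B \<phi> c = (\<Union>(\<sigma>, f)\<in>c. toric_class F B (\<sigma>, \<lambda>u\<in>dual_sg \<sigma>. \<phi> (f u)))"

definition torus_action ::
    "(real^'n) set set \<Rightarrow> 'a topmonoid \<Rightarrow> (real^'n \<Rightarrow> 'a)
      \<Rightarrow> ('n, 'a) chart_point set \<Rightarrow> ('n, 'a) chart_point set" where
  "torus_action F A t c = (\<Union>(\<sigma>, f)\<in>c. toric_class F A (\<sigma>, \<lambda>u\<in>dual_sg \<sigma>. t u \<otimes>\<^bsub>A\<^esub> f u))"

abbreviation toric_variety :: "(real^'n) set set \<Rightarrow> ('n, complex) chart_point set topology" where
  "toric_variety F \<equiv> toric_space F CC"

abbreviation toric_variety_Q ::
    "(real^'n) set set \<Rightarrow> ('n, nat \<Rightarrow> complex) chart_point set topology" where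
  "toric_variety_Q F \<equiv> toric_space F CC_Q"

abbreviation Delzant :: "(real^'n) set set \<Rightarrow> ('n, real) chart_point set topology" where
  "Delzant F \<equiv> toric_space F RR_nonneg"

definition toric_proj ::
    "(real^'n) set set \<Rightarrow> ('n, nat \<Rightarrow> complex) chart_point set \<Rightarrow> ('n, complex) chart_point set" where
  "toric_proj F = toric_map F CC proj1"

definition moment_map ::
    "(real^'n) set set \<Rightarrow> ('n, nat \<Rightarrow> complex) chart_point set \<Rightarrow> ('n, real) chart_point set" where
  "moment_map F = toric_map F RR_nonneg modulus_Q"

text \<open>The standard identification of \<open>Delzant F\<close> with the polytope \<open>P\<close>, for \<open>F = normal_fan P\<close>:
  the point with values \<open>\<chi>\<^sup>u\<close> of the characters is sent to the barycentre of the lattice points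
  \<open>u\<close> of \<open>P\<close> with weights \<open>\<chi>\<^sup>u\<close>. On the chart of \<open>\<sigma>\<close> the characters are normalised by dividing by
  \<open>\<chi>\<^sup>a\<close>, where \<open>a\<close> is a lattice point of the face of \<open>P\<close> dual to \<open>\<sigma>\<close>; the result does not depend
  on the choice of \<open>a\<close>, nor on the representative.\<close>

definition polytope_coord :: "(real^'n) set \<Rightarrow> ('n, real) chart_point \<Rightarrow> real^'n" where
  "polytope_coord P = (\<lambda>(\<sigma>, f).
     let a = (SOME a. a \<in> P \<inter> int_vecs \<and> (\<forall>v\<in>\<sigma>. \<forall>u\<in>P. a \<bullet> v \<le> u \<bullet> v))
     in (\<Sum>u\<in>P \<inter> int_vecs. f (u - a) *\<^sub>R u) /\<^sub>R (\<Sum>u\<in>P \<inter> int_vecs. f (u - a)))"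

definition Delzant_to_polytope :: "(real^'n) set \<Rightarrow> ('n, real) chart_point set \<Rightarrow> real^'n" where
  "Delzant_to_polytope P c = the_elem (polytope_coord P ` c)"


section \<open>Invariant divisors, singular divisors and cusps\<close>

definition special_point :: "(real^'n) set set \<Rightarrow> (real^'n) set \<Rightarrow> ('n, complex) chart_point set" where
  "special_point F \<sigma> =
     toric_class F CC (\<sigma>, \<lambda>u\<in>dual_sg \<sigma>. if \<forall>v\<in>\<sigma>. u \<bullet> v = 0 then 1 else 0)"

definition torus_orbit :: "(real^'n) set set \<Rightarrow> (real^'n) set \<Rightarrow> ('n, complex) chart_point set set" where
  "torus_orbit F \<sigma> =
     (\<lambda>t. torus_action F CC t (special_point F \<sigma>)) ` carrier (hom_sg int_vecs CC_star)"

definition rays :: "(real^'n) set set \<Rightarrow> (real^'n) set set" where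
  "rays F = {\<rho> \<in> F. dim \<rho> = 1}"

definition invariant_divisor ::
    "(real^'n) set set \<Rightarrow> (real^'n) set \<Rightarrow> ('n, complex) chart_point set set" where
  "invariant_divisor F \<rho> = Abstract_Topology.closure_of (toric_variety F) (torus_orbit F \<rho>)"

definition singular_divisors ::
    "(real^'n) set set \<Rightarrow> ('n, nat \<Rightarrow> complex) chart_point set set set" where
  "singular_divisors F =
     (\<lambda>\<rho>. {x \<in> topspace (toric_variety_Q F). toric_proj F x \<in> invariant_divisor F \<rho>}) ` rays F"

text \<open>Only the charts of full-dimensional cones have a torus-fixed special point.\<close>

definition cusps :: "(real^'n) set set \<Rightarrow> ('n, nat \<Rightarrow> complex) chart_point set set" where
  "cusps F = {x \<in> topspace (toric_variety_Q F).
     \<exists>\<sigma>\<in>F. dim \<sigma> = CARD('n) \<and> toric_proj F x = special_point F \<sigma>}"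


section \<open>Consistency of the definitions\<close>

lemma istopology_quotient:
  "istopology (\<lambda>U. U \<subseteq> q ` topspace X \<and> openin X {x \<in> topspace X. q x \<in> U})"
  unfolding istopology_def
proof (intro conjI allI impI)
  fix S T
  assume S: "S \<subseteq> q ` topspace X \<and> openin X {x \<in> topspace X. q x \<in> S}"
    and T: "T \<subseteq> q ` topspace X \<and> openin X {x \<in> topspace X. q x \<in> T}"
  show "S \<inter> T \<subseteq> q ` topspace X"
    using S by blast
  have eq: "{x \<in> topspace X. q x \<in> S \<inter> T} =
      {x \<in> topspace X. q x \<in> S} \<inter> {x \<in> topspace X. q x \<in> T}"
    by blast
  show "openin X {x \<in> topspace X. q x \<in> S \<inter> T}"
    unfolding eq using openin_Int[OF conjunct2[OF S] conjunct2[OF T]] .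
next
  fix \<K>
  assume K: "\<forall>U\<in>\<K>. U \<subseteq> q ` topspace X \<and> openin X {x \<in> topspace X. q x \<in> U}"
  show "\<Union>\<K> \<subseteq> q ` topspace X"
    using K by blast
  have eq: "{x \<in> topspace X. q x \<in> \<Union>\<K>} = \<Union>((\<lambda>U. {x \<in> topspace X. q x \<in> U}) ` \<K>)"
    by blast
  show "openin X {x \<in> topspace X. q x \<in> \<Union>\<K>}"
    unfolding eq by (rule openin_Union) (use K in blast)
qed

lemma openin_quotient_topology:
  "openin (quotient_topology X q) U \<longleftrightarrow>
     U \<subseteq> q ` topspace X \<and> openin X {x \<in> topspace X. q x \<in> U}"
  unfolding quotient_topology_def topology_inverse'[OF istopology_quotient] ..

lemma topspace_quotient_topology: "topspace (quotient_topology X q) = q ` topspace X"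
proof
  show "topspace (quotient_topology X q) \<subseteq> q ` topspace X"
    using openin_topspace[of "quotient_topology X q"] unfolding openin_quotient_topology by (rule conjunct1)
  have "{x \<in> topspace X. q x \<in> q ` topspace X} = topspace X"
    by blast
  then have "openin (quotient_topology X q) (q ` topspace X)"
    unfolding openin_quotient_topology by simp
  then show "q ` topspace X \<subseteq> topspace (quotient_topology X q)"
    by (rule openin_subset)
qed

lemma quotient_map_quotient_topology: "quotient_map X (quotient_topology X q) q"
  by (simp add: quotient_map_def topspace_quotient_topology openin_quotient_topology)

lemma mult_on_pow: "x [^]\<^bsub>mult_on S\<^esub> (n::nat) = x ^ n"
  by (induct n) (simp_all add: nat_pow_def mult_on_def power_commutes)

lemma carrier_powlim_mult_on:
  "z \<in> carrier (powlim (mult_on S)) \<longleftrightarrow>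
     z \<in> {1..} \<rightarrow>\<^sub>E S \<and> (\<forall>k\<ge>1. \<forall>m\<ge>1. k dvd m \<longrightarrow> z k = z m ^ (m div k))"
proof -
  have "carrier (mult_on S) = S"
    by (simp add: mult_on_def)
  then show ?thesis
    unfolding powlim_def powlim_carrier_def mult_on_pow by simp
qed

lemma mult_powlim_mult_on:
  "z \<otimes>\<^bsub>powlim (mult_on S)\<^esub> w = (\<lambda>k\<in>{1..}. z k * w k)"
  by (simp add: powlim_def mult_on_def)

lemma modulus_Q_eq_iff:
  assumes z: "z \<in> carrier CC_Q" and w: "w \<in> carrier CC_Q"
  shows "modulus_Q z = modulus_Q w \<longleftrightarrow> (\<exists>s\<in>carrier SS1_Q. w = s \<otimes>\<^bsub>CC_Q\<^esub> z)"
proof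
  assume eq: "modulus_Q z = modulus_Q w"
  have root: "x 1 = x k ^ k" if "x \<in> carrier CC_Q" "k \<ge> 1" for x and k :: nat
  proof -
    have "1 \<le> k \<longrightarrow> 1 dvd k \<longrightarrow> x 1 = x k ^ (k div 1)"
      using that(1) unfolding carrier_powlim_mult_on by blast
    then show ?thesis
      using that(2) by simp
  qed
  have norm_eq: "cmod (w k) = cmod (z k)" if "k \<ge> 1" for k
  proof -
    have "cmod (w k) ^ k = cmod (z k) ^ k"
      using eq root[OF z that] root[OF w that]
      by (simp add: modulus_Q_def proj1_def norm_power)
    then show ?thesis
      by (rule power_eq_imp_eq_base) (use that in auto)
  qed
  have zero_iff: "z k = 0 \<longleftrightarrow> z 1 = 0" if "k \<ge> 1" for k
    using root[OF z that] that by simp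
  define s where "s = (\<lambda>k\<in>{1::nat..}. if z 1 = 0 then 1 else w k / z k)"
  have s_apply: "s k = (if z 1 = 0 then 1 else w k / z k)" if "k \<ge> 1" for k
    using that by (simp add: s_def)
  have "s k \<in> sphere 0 1" if "k \<ge> 1" for k
    unfolding s_apply[OF that] using norm_eq[OF that] zero_iff[OF that]
    by (simp add: norm_divide)
  then have "s \<in> {1..} \<rightarrow>\<^sub>E sphere 0 1"
    by (intro PiE_I) (simp_all add: s_def)
  moreover have "s k = s m ^ (m div k)" if k: "k \<ge> 1" and m: "m \<ge> 1" and "k dvd m" for k m
  proof -
    have "z k = z m ^ (m div k)" "w k = w m ^ (m div k)"
      using z w that unfolding carrier_powlim_mult_on by blast+
    then show ?thesis
      unfolding s_apply[OF k] s_apply[OF m] by (simp add: power_divide)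
  qed
  ultimately have "s \<in> carrier SS1_Q"
    unfolding carrier_powlim_mult_on by blast
  moreover have "w = s \<otimes>\<^bsub>CC_Q\<^esub> z"
    unfolding mult_powlim_mult_on
  proof
    fix k
    show "w k = (\<lambda>k\<in>{1..}. s k * z k) k"
    proof (cases "k \<ge> 1")
      case True
      show ?thesis
      proof (cases "z k = 0")
        case z0: True
        then have "w k = 0"
          using norm_eq[OF True] by simp
        then show ?thesis
          using True z0 by simp
      next
        case False
        then show ?thesis
          using True zero_iff[OF True] by (simp add: s_apply[OF True])
      qed
    next
      case False
      have "w \<in> extensional {1..}"
        using w unfolding carrier_powlim_mult_on by (simp add: PiE_def)
      then show ?thesis
        using False by (simp add: extensional_def)
    qed
  qed
  ultimately show "\<exists>s\<in>carrier SS1_Q. w = s \<otimes>\<^bsub>CC_Q\<^esub> z"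
    by blast
next
  assume "\<exists>s\<in>carrier SS1_Q. w = s \<otimes>\<^bsub>CC_Q\<^esub> z"
  then obtain s where s: "s \<in> carrier SS1_Q" and ws: "w = s \<otimes>\<^bsub>CC_Q\<^esub> z" by blast
  have "s \<in> {1..} \<rightarrow>\<^sub>E sphere 0 1"
    using s unfolding carrier_powlim_mult_on by blast
  then have "s 1 \<in> sphere 0 1"
    by (rule PiE_mem) simp
  then show "modulus_Q z = modulus_Q w"
    by (simp add: ws mult_powlim_mult_on modulus_Q_def proj1_def norm_mult)
qed

end

theory Submission
  imports Defs "HOL-Real_Asymp.Real_Asymp"
begin

text \<open>A toric point is a semigroup morphism on some chart, up to gluing. The coefficient monoids
\<open>\<complex>\<close>, \<open>CC_Q\<close> and \<open>[0,\<infinity>)\<close> have one property in common that governs everything: each nonzero element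
is invertible. So for a morphism \<open>f\<close> on \<open>dual_sg \<sigma>\<close> a sum \<open>u + v\<close> has nonzero value exactly when both
\<open>u\<close> and \<open>v\<close> have, and this forces the nonzero set to be \<open>dual_sg \<sigma> \<inter> \<tau>\<^sup>\<bottom>\<close> for one face \<open>\<tau>\<close> of \<open>\<sigma>\<close>
(\<open>support_is_face\<close>). Inverting the values there extends \<open>f\<close> to the larger semigroup of \<open>\<tau>\<close>
(\<open>extension_to_face\<close>), and the pair of \<open>\<tau>\<close> and the extension is unique (\<open>reduction_unique\<close>).
Each class of chart points therefore has exactly one reduced representative \<open>(\<tau>, g)\<close>, where \<open>g\<close>
is nonzero precisely on \<open>\<tau>\<^sup>\<bottom>\<close>, and it consists of the restrictions of \<open>g\<close> to the cones containing
\<open>\<tau>\<close> (\<open>toric_class_reduced\<close>). Geometrically \<open>\<tau>\<close> names the torus orbit, and \<open>g\<close> the point in it.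

The projection, the moment map and the torus action all work on the values of \<open>g\<close> and leave \<open>\<tau>\<close>
alone. Hence the fibre of the moment map over \<open>(\<tau>, p)\<close> is the set of \<open>(\<tau>, g)\<close> with \<open>\<bar>g\<bar> = p\<close>. Taking
positive roots of \<open>p\<close> gives one point of it, and any other differs from that one by a morphism from
\<open>\<tau>\<^sup>\<bottom> \<inter> \<int>\<^sup>n\<close> to \<open>SS1_Q\<close>. The solenoid is uniquely divisible, so such a morphism amounts to its
values at linearly independent lattice vectors \<open>e\<^sub>0, \<dots>, e\<^sub>m\<^sub>-\<^sub>1\<close> that span \<open>\<tau>\<^sup>\<bottom>\<close>; these values are
the coordinates in the \<open>m\<close>-th power of \<open>SS1_Q\<close>. They depend continuously on the point because the
chart of \<open>\<tau>\<close> is open in the toric space and evaluation is continuous on it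
(\<open>continuous_map_chart_eval\<close>). This gives \<open>moment_fibre_solenoidal_torus\<close>.

For the normal fan of \<open>P\<close> the cones correspond to the nonempty faces \<open>Q\<close>, with inclusions reversed,
and \<open>(normal_cone P Q)\<^sup>\<bottom>\<close> is the linear span of the differences of points of \<open>Q\<close>. So \<open>m\<close> is the
dimension of \<open>Q\<close>, and rays belong to facets, full-dimensional cones to vertices. At a reduced point of
\<open>normal_cone P Q\<close> the barycentric weights vanish exactly off \<open>Q\<close>, which places its image in the
relative interior of \<open>Q\<close> (\<open>Delzant_coord\<close>). Finally, the closure of the orbit of \<open>\<rho>\<close> is the union
of the orbits of the cones containing \<open>\<rho>\<close> (\<open>invariant_divisor_eq\<close>). Hence the singular divisor of the ray of a
facet \<open>Q\<close> is the preimage of \<open>Q\<close>. Over the cone of a vertex the annihilator is \<open>0\<close>, which leaves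
a single reduced point: the cusp.\<close>

section \<open>Lattice vectors and annihilators\<close>

lemma int_vecs_0 [simp]: "0 \<in> int_vecs"
  by (simp add: int_vecs_def)

lemma int_vecs_add: "u \<in> int_vecs \<Longrightarrow> v \<in> int_vecs \<Longrightarrow> u + v \<in> int_vecs"
  by (simp add: int_vecs_def)

lemma int_vecs_uminus: "u \<in> int_vecs \<Longrightarrow> - u \<in> int_vecs"
  by (simp add: int_vecs_def)

lemma int_vecs_diff: "u \<in> int_vecs \<Longrightarrow> v \<in> int_vecs \<Longrightarrow> u - v \<in> int_vecs"
  by (simp add: int_vecs_def)

lemma int_vecs_scale: "u \<in> int_vecs \<Longrightarrow> c \<in> \<int> \<Longrightarrow> c *\<^sub>R u \<in> int_vecs"
  by (simp add: int_vecs_def)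

lemma int_vecs_sum: "(\<And>i. i \<in> I \<Longrightarrow> f i \<in> int_vecs) \<Longrightarrow> sum f I \<in> int_vecs"
  by (simp add: int_vecs_def Ints_sum)

lemma int_vecs_inner: "u \<in> int_vecs \<Longrightarrow> v \<in> int_vecs \<Longrightarrow> u \<bullet> v \<in> \<int>"
  by (simp add: int_vecs_def inner_vec_def Ints_sum Ints_mult)

lemma dual_sg_0 [simp]: "0 \<in> dual_sg \<sigma>"
  by (simp add: dual_sg_def)

lemma dual_sg_add: "u \<in> dual_sg \<sigma> \<Longrightarrow> v \<in> dual_sg \<sigma> \<Longrightarrow> u + v \<in> dual_sg \<sigma>"
  by (simp add: dual_sg_def int_vecs_add inner_add_left)

lemma dual_sg_scale: "u \<in> dual_sg \<sigma> \<Longrightarrow> real M *\<^sub>R u \<in> dual_sg \<sigma>"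
  by (simp add: dual_sg_def int_vecs_scale)

lemma dual_sg_antimono: "\<tau> \<subseteq> \<sigma> \<Longrightarrow> dual_sg \<sigma> \<subseteq> dual_sg \<tau>"
  by (auto simp: dual_sg_def)

definition perp :: "(real^'n) set \<Rightarrow> (real^'n) set" where
  "perp \<tau> = {u. \<forall>v\<in>\<tau>. u \<bullet> v = 0}"

lemma perp_0 [simp]: "0 \<in> perp \<tau>"
  by (simp add: perp_def)

lemma subspace_perp: "subspace (perp \<tau>)"
  by (auto simp: subspace_def perp_def inner_add_left)

lemma perp_antimono: "\<tau> \<subseteq> \<sigma> \<Longrightarrow> perp \<sigma> \<subseteq> perp \<tau>"
  by (auto simp: perp_def)

lemma perp_dual_sg: "u \<in> int_vecs \<Longrightarrow> u \<in> perp \<tau> \<Longrightarrow> u \<in> dual_sg \<tau>"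
  by (simp add: dual_sg_def perp_def)

text \<open>Both summands are nonnegative on the cone, so a vanishing sum makes each of them vanish.\<close>

lemma perp_add_iff:
  assumes "u \<in> dual_sg \<tau>" "v \<in> dual_sg \<tau>"
  shows "u + v \<in> perp \<tau> \<longleftrightarrow> u \<in> perp \<tau> \<and> v \<in> perp \<tau>"
proof
  assume *: "u + v \<in> perp \<tau>"
  have "u \<bullet> x = 0 \<and> v \<bullet> x = 0" if "x \<in> \<tau>" for x
  proof -
    have "u \<bullet> x + v \<bullet> x = 0" "0 \<le> u \<bullet> x" "0 \<le> v \<bullet> x"
      using * assms that by (auto simp: perp_def dual_sg_def inner_add_left)
    then show ?thesis by linarith
  qed
  then show "u \<in> perp \<tau> \<and> v \<in> perp \<tau>" by (simp add: perp_def)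
qed (simp add: perp_def inner_add_left)


text \<open>The vector \<open>n\<close> lies in the relative interior of the face of the dual cone that \<open>\<tau>\<close> cuts out;
inverting it turns \<open>dual_sg \<sigma>\<close> into \<open>dual_sg \<tau>\<close>.\<close>

definition integrally_exposed :: "(real^'n) set \<Rightarrow> (real^'n) set \<Rightarrow> (real^'n) \<Rightarrow> bool" where
  "integrally_exposed \<tau> \<sigma> n \<longleftrightarrow> n \<in> dual_sg \<sigma> \<and> \<tau> = {v \<in> \<sigma>. n \<bullet> v = 0}"

lemma integrally_exposed_perp: "integrally_exposed \<tau> \<sigma> n \<Longrightarrow> n \<in> perp \<tau>"
  by (auto simp: integrally_exposed_def perp_def)

text \<open>A large multiple of \<open>n\<close> outweighs \<open>u\<close> wherever \<open>n\<close> is positive, and finitely many \<open>y\<close> have to be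
outweighed. The lemma serves three times: to localise dual semigroups, to find the support of a
morphism, and to compute the span of a normal cone.\<close>

lemma nonneg_shift:
  fixes n u :: "'b::real_inner"
  assumes "finite Y" and n: "\<And>y. y \<in> Y \<Longrightarrow> 0 \<le> n \<bullet> y"
    and u: "\<And>y. y \<in> Y \<Longrightarrow> n \<bullet> y = 0 \<Longrightarrow> 0 \<le> u \<bullet> y"
  shows "\<exists>M::nat. \<forall>y\<in>Y. 0 \<le> (u + real M *\<^sub>R n) \<bullet> y"
proof -
  define M where "M = (\<Sum>y\<in>Y. nat \<lceil>\<bar>u \<bullet> y\<bar> / (n \<bullet> y)\<rceil>)"
  have "0 \<le> (u + real M *\<^sub>R n) \<bullet> y" if y: "y \<in> Y" for y
  proof (cases "n \<bullet> y = 0")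
    case True
    then show ?thesis using u[OF y] by (simp add: inner_add_left)
  next
    case False
    then have pos: "n \<bullet> y > 0" using n[OF y] by simp
    have "nat \<lceil>\<bar>u \<bullet> y\<bar> / (n \<bullet> y)\<rceil> \<le> M"
      unfolding M_def using assms(1) y by (intro member_le_sum) auto
    then have "\<bar>u \<bullet> y\<bar> / (n \<bullet> y) \<le> real M" by linarith
    then have "\<bar>u \<bullet> y\<bar> \<le> real M * (n \<bullet> y)" using pos by (simp add: divide_le_eq)
    then show ?thesis by (simp add: inner_add_left)
  qed
  then show ?thesis by blast
qed

section \<open>Fans with integrally exposed faces\<close>

text \<open>The second assumption says that faces of rational cones are cut out by lattice points of the dual
cone. For a normal fan these lattice points are sums of differences of lattice points of the polytope.\<close>

locale exposed_fan =
  fixes F :: "(real^'n) set set"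
  assumes fan: "fan F"
    and exposed: "\<tau> \<in> F \<Longrightarrow> \<sigma> \<in> F \<Longrightarrow> \<tau> \<subseteq> \<sigma> \<Longrightarrow> \<exists>n. integrally_exposed \<tau> \<sigma> n"
begin

lemma cone_generators:
  assumes "\<sigma> \<in> F"
  obtains Y where "finite Y" "Y \<subseteq> \<sigma>" "\<And>u. \<forall>y\<in>Y. 0 \<le> u \<bullet> y \<Longrightarrow> \<forall>v\<in>\<sigma>. 0 \<le> u \<bullet> v"
proof -
  obtain Y where Y: "finite Y" "\<sigma> = convex_cone hull Y"
    using fan assms unfolding fan_def rational_cone_def by meson
  show ?thesis
  proof
    show "finite Y" "Y \<subseteq> \<sigma>" using Y by (simp_all add: hull_subset)
    fix u assume "\<forall>y\<in>Y. 0 \<le> u \<bullet> y"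
    then have "convex_cone hull Y \<subseteq> {x. u \<bullet> x \<ge> 0}"
      by (intro hull_minimal convex_cone_halfspace_ge) auto
    then show "\<forall>v\<in>\<sigma>. 0 \<le> u \<bullet> v" using Y by auto
  qed
qed

lemma zero_in_cone: "\<sigma> \<in> F \<Longrightarrow> 0 \<in> \<sigma>"
  using fan unfolding fan_def by blast

lemma convex_fan_cone: "\<sigma> \<in> F \<Longrightarrow> convex \<sigma>"
  using fan unfolding fan_def rational_cone_def
  by (metis convex_cone_convex_cone_hull convex_cone_def)

lemma face_iff_subset:
  assumes "\<tau> \<in> F" "\<sigma> \<in> F"
  shows "\<tau> face_of \<sigma> \<longleftrightarrow> \<tau> \<subseteq> \<sigma>"
proof
  assume "\<tau> \<subseteq> \<sigma>"
  then have "\<sigma> \<inter> \<tau> = \<tau>" by blast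
  then show "\<tau> face_of \<sigma>" using fan assms unfolding fan_def by metis
qed (rule face_of_imp_subset)

lemma Int_in_fan:
  assumes "\<tau> \<in> F" "\<sigma> \<in> F"
  shows "\<sigma> \<inter> \<tau> \<in> F"
proof -
  have "\<sigma> \<inter> \<tau> face_of \<sigma>" using fan assms unfolding fan_def by blast
  moreover have "\<sigma> \<inter> \<tau> \<noteq> {}" using zero_in_cone assms by blast
  ultimately show ?thesis using fan assms unfolding fan_def by blast
qed

lemma zero_set_in_fan:
  assumes "\<sigma> \<in> F" "n \<in> dual_sg \<sigma>"
  shows "{v \<in> \<sigma>. n \<bullet> v = 0} \<in> F"
proof -
  have "(\<sigma> \<inter> {v. n \<bullet> v = 0}) face_of \<sigma>"
    using assms by (intro face_of_Int_supporting_hyperplane_ge convex_fan_cone) (auto simp: dual_sg_def)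
  moreover have "\<sigma> \<inter> {v. n \<bullet> v = 0} \<noteq> {}" using zero_in_cone assms by force
  ultimately have "\<sigma> \<inter> {v. n \<bullet> v = 0} \<in> F" using fan assms unfolding fan_def by blast
  then show ?thesis by (simp add: Int_def)
qed

text \<open>The semigroup of a face arises from that of the cone by adjoining \<open>- n\<close>.\<close>

lemma dual_sg_localization:
  assumes "\<sigma> \<in> F" and n: "integrally_exposed \<tau> \<sigma> n" and u: "u \<in> dual_sg \<tau>"
  shows "\<exists>M::nat. u + real M *\<^sub>R n \<in> dual_sg \<sigma>"
proof -
  obtain Y where Y: "finite Y" "Y \<subseteq> \<sigma>" "\<And>u. \<forall>y\<in>Y. 0 \<le> u \<bullet> y \<Longrightarrow> \<forall>v\<in>\<sigma>. 0 \<le> u \<bullet> v"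
    using cone_generators[OF assms(1)] by metis
  have nS: "n \<in> dual_sg \<sigma>" and \<tau>: "\<tau> = {v \<in> \<sigma>. n \<bullet> v = 0}"
    using n by (simp_all add: integrally_exposed_def)
  have "\<exists>M::nat. \<forall>y\<in>Y. 0 \<le> (u + real M *\<^sub>R n) \<bullet> y"
    using Y(2) nS u unfolding \<tau> dual_sg_def by (intro nonneg_shift[OF Y(1)]) auto
  then obtain M :: nat where "\<forall>y\<in>Y. 0 \<le> (u + real M *\<^sub>R n) \<bullet> y" by blast
  then have "\<forall>v\<in>\<sigma>. 0 \<le> (u + real M *\<^sub>R n) \<bullet> v" using Y(3) by blast
  moreover have "u + real M *\<^sub>R n \<in> int_vecs"
    using u n by (simp add: dual_sg_def integrally_exposed_def int_vecs_add int_vecs_scale)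
  ultimately show ?thesis unfolding dual_sg_def by blast
qed

end

section \<open>Groups with zero as coefficients\<close>

text \<open>The condition that \<open>carrier A - {z}\<close> be open makes the affine charts open in the toric space.\<close>

locale group_with_zero =
  fixes A :: "'a topmonoid" (structure) and z :: 'a
  assumes comm_monoid: "comm_monoid A"
    and zero_closed: "z \<in> carrier A"
    and zero_mult: "x \<in> carrier A \<Longrightarrow> z \<otimes> x = z"
    and one_not_zero: "\<one> \<noteq> z"
    and nonzero_Units: "x \<in> carrier A \<Longrightarrow> x \<noteq> z \<Longrightarrow> x \<in> Units A"
    and topspace_topo: "topspace (topo A) = carrier A"
    and openin_nonzero: "openin (topo A) (carrier A - {z})"

sublocale group_with_zero \<subseteq> comm_monoid A by (rule comm_monoid)

context group_with_zero begin

lemma mult_zero: "x \<in> carrier A \<Longrightarrow> x \<otimes> z = z"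
  using zero_mult m_comm zero_closed by metis

lemma unit_not_zero: "x \<in> Units A \<Longrightarrow> x \<noteq> z"
  by (metis Units_r_inv Units_inv_closed zero_mult one_not_zero)

lemma mult_nonzero_iff:
  assumes "x \<in> carrier A" "y \<in> carrier A"
  shows "x \<otimes> y \<noteq> z \<longleftrightarrow> x \<noteq> z \<and> y \<noteq> z"
  using assms by (metis Units_m_closed mult_zero zero_mult nonzero_Units unit_not_zero)

lemma pow_nonzero: "x \<in> carrier A \<Longrightarrow> x \<noteq> z \<Longrightarrow> x [^] (k::nat) \<noteq> z"
  by (induction k) (auto simp: one_not_zero mult_nonzero_iff)

lemma nonzero_cancel:
  assumes "x \<in> carrier A" "y \<in> carrier A" "a \<in> carrier A" "a \<noteq> z" "x \<otimes> a = y \<otimes> a"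
  shows "x = y"
  using assms nonzero_Units Units_l_cancel m_comm by metis

lemma hom_scale:
  assumes "f \<in> hom_sg_carrier (dual_sg \<sigma>) A" "n \<in> dual_sg \<sigma>"
  shows "f (real M *\<^sub>R n) = f n [^] M"
proof (induction M)
  case 0 then show ?case using assms by (simp add: hom_sg_carrier_def)
next
  case (Suc M)
  have "f (real M *\<^sub>R n + n) = f (real M *\<^sub>R n) \<otimes> f n"
    using assms dual_sg_scale by (fastforce simp: hom_sg_carrier_def)
  then show ?case using Suc by (simp add: scaleR_left_distrib add.commute)
qed

end

lemma carrier_hom_sg [simp]: "carrier (hom_sg S A) = hom_sg_carrier S A"
  and mult_hom_sg: "f \<otimes>\<^bsub>hom_sg S A\<^esub> g = (\<lambda>u\<in>S. f u \<otimes>\<^bsub>A\<^esub> g u)"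
  by (simp_all add: hom_sg_def)

lemma hom_sg_closed: "f \<in> hom_sg_carrier S A \<Longrightarrow> u \<in> S \<Longrightarrow> f u \<in> carrier A"
  by (auto simp: hom_sg_carrier_def)

lemma hom_sg_add: "f \<in> hom_sg_carrier S A \<Longrightarrow> u \<in> S \<Longrightarrow> v \<in> S \<Longrightarrow> f (u + v) = f u \<otimes>\<^bsub>A\<^esub> f v"
  by (auto simp: hom_sg_carrier_def)

lemma hom_sg_0: "f \<in> hom_sg_carrier S A \<Longrightarrow> f 0 = \<one>\<^bsub>A\<^esub>"
  by (auto simp: hom_sg_carrier_def)

lemma hom_sg_ext: "f \<in> hom_sg_carrier S A \<Longrightarrow> f = restrict f S"
  by (auto simp: hom_sg_carrier_def PiE_def extensional_restrict)

lemma hom_sg_restrict: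
  "f \<in> hom_sg_carrier S A \<Longrightarrow> T \<subseteq> S \<Longrightarrow> 0 \<in> T \<Longrightarrow> (\<And>u v. u \<in> T \<Longrightarrow> v \<in> T \<Longrightarrow> u + v \<in> T) \<Longrightarrow>
   restrict f T \<in> hom_sg_carrier T A"
  by (auto simp: hom_sg_carrier_def PiE_def Pi_iff subset_iff)

text \<open>The canonical form of a toric point: \<open>\<tau>\<close> is the smallest cone whose chart contains it. A reduced
morphism is a character of the lattice \<open>\<tau>\<^sup>\<bottom> \<inter> \<int>\<^sup>n\<close> extended by zero.\<close>

definition reduced :: "'a topmonoid \<Rightarrow> 'a \<Rightarrow> (real^'n) set \<Rightarrow> (real^'n \<Rightarrow> 'a) \<Rightarrow> bool" where
  "reduced A z \<tau> g \<longleftrightarrow> g \<in> hom_sg_carrier (dual_sg \<tau>) A \<and> (\<forall>u\<in>dual_sg \<tau>. g u \<noteq> z \<longleftrightarrow> u \<in> perp \<tau>)"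

section \<open>Canonical representatives of toric points\<close>

locale toric = exposed_fan F + group_with_zero A z
  for F :: "(real^'n) set set" and A :: "'a topmonoid" (structure) and z
begin

text \<open>Among the vectors with nonzero value take \<open>n\<close> with the fewest zeros on the generators of \<open>\<sigma>\<close>. Adding
another such vector cannot remove zeros, so every vector with nonzero value vanishes where \<open>n\<close>
does. Conversely, a vector \<open>u\<close> vanishing there satisfies \<open>u + w = M n\<close> for some \<open>w\<close> in the semigroup,
and the value at \<open>M n\<close> is nonzero, hence so is the value at \<open>u\<close>. The argument stays inside the semigroup.\<close>

lemma support_is_face:
  assumes \<sigma>: "\<sigma> \<in> F" and f: "f \<in> hom_sg_carrier (dual_sg \<sigma>) A"
  obtains \<tau> n where "\<tau> \<in> F" "integrally_exposed \<tau> \<sigma> n"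
    "\<And>u. u \<in> dual_sg \<sigma> \<Longrightarrow> f u \<noteq> z \<longleftrightarrow> u \<in> perp \<tau>"
proof -
  obtain Y where Y: "finite Y" "Y \<subseteq> \<sigma>" "\<And>u. \<forall>y\<in>Y. 0 \<le> u \<bullet> y \<Longrightarrow> \<forall>v\<in>\<sigma>. 0 \<le> u \<bullet> v"
    using cone_generators[OF \<sigma>] by metis
  \<comment> \<open>\<open>N\<close> is a face of the semigroup \<open>dual_sg \<sigma>\<close>.\<close>
  define N where "N = {u \<in> dual_sg \<sigma>. f u \<noteq> z}"
  define Z where "Z u = {y \<in> Y. u \<bullet> y = 0}" for u
  have N_add: "u + v \<in> N \<longleftrightarrow> u \<in> N \<and> v \<in> N" if "u \<in> dual_sg \<sigma>" "v \<in> dual_sg \<sigma>" for u v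
    using that f by (simp add: N_def dual_sg_add hom_sg_add mult_nonzero_iff hom_sg_closed)
  have "0 \<in> N" using f one_not_zero by (simp add: N_def hom_sg_0)
  then obtain n where n: "n \<in> N" "\<And>u. u \<in> N \<Longrightarrow> card (Z n) \<le> card (Z u)"
    using ex_has_least_nat[of "\<lambda>u. u \<in> N" 0 "\<lambda>u. card (Z u)"] by blast
  have nS: "n \<in> dual_sg \<sigma>" using n by (simp add: N_def)
  have Zn: "Z n \<subseteq> Z u" if "u \<in> N" for u
  proof -
    have uS: "u \<in> dual_sg \<sigma>" using that by (simp add: N_def)
    have sub: "Z (n + u) \<subseteq> Z n \<inter> Z u"
    proof
      fix y assume y: "y \<in> Z (n + u)"
      then have "n \<bullet> y \<ge> 0" "u \<bullet> y \<ge> 0" "n \<bullet> y + u \<bullet> y = 0"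
        using nS uS Y(2) by (auto simp: Z_def dual_sg_def inner_add_left)
      then show "y \<in> Z n \<inter> Z u" using y by (auto simp: Z_def)
    qed
    have fin: "finite (Z n)" using Y by (simp add: Z_def)
    have "card (Z n) \<le> card (Z (n + u))" using n that N_add nS uS by blast
    then have "Z (n + u) = Z n" using sub fin by (meson card_seteq le_inf_iff)
    then show ?thesis using sub by blast
  qed
  define \<tau> where "\<tau> = {v \<in> \<sigma>. n \<bullet> v = 0}"
  have ex: "integrally_exposed \<tau> \<sigma> n" using nS by (simp add: integrally_exposed_def \<tau>_def)
  have \<tau>F: "\<tau> \<in> F" unfolding \<tau>_def by (rule zero_set_in_fan[OF \<sigma> nS])
  show ?thesis
  proof (rule that[OF \<tau>F ex])
    fix u assume u: "u \<in> dual_sg \<sigma>"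
    show "f u \<noteq> z \<longleftrightarrow> u \<in> perp \<tau>"
    proof
      assume "f u \<noteq> z"
      then have "Z n \<subseteq> Z u" using u by (intro Zn) (simp add: N_def)
      obtain M :: nat where M: "- u + real M *\<^sub>R n \<in> dual_sg \<sigma>"
      proof -
        have "\<exists>M::nat. \<forall>y\<in>Y. 0 \<le> (- u + real M *\<^sub>R n) \<bullet> y"
          using Y(2) nS \<open>Z n \<subseteq> Z u\<close> unfolding dual_sg_def Z_def by (intro nonneg_shift[OF Y(1)]) auto
        then obtain M :: nat where "\<forall>y\<in>Y. 0 \<le> (- u + real M *\<^sub>R n) \<bullet> y" by blast
        then have "\<forall>v\<in>\<sigma>. 0 \<le> (- u + real M *\<^sub>R n) \<bullet> v" using Y(3) by blast
        moreover have "- u + real M *\<^sub>R n \<in> int_vecs"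
          using u nS by (intro int_vecs_add int_vecs_uminus int_vecs_scale) (auto simp: dual_sg_def)
        ultimately show ?thesis using that unfolding dual_sg_def by blast
      qed
      show "u \<in> perp \<tau>"
        unfolding perp_def
      proof safe
        fix v assume "v \<in> \<tau>"
        then have "v \<in> \<sigma>" "n \<bullet> v = 0" by (auto simp: \<tau>_def)
        then have "0 \<le> u \<bullet> v" "0 \<le> (- u + real M *\<^sub>R n) \<bullet> v" using u M unfolding dual_sg_def by blast+
        then show "u \<bullet> v = 0" using \<open>n \<bullet> v = 0\<close> by (simp add: inner_add_left inner_diff_left)
      qed
    next
      assume "u \<in> perp \<tau>"
      then have "- u \<in> dual_sg \<tau>"
        using u by (simp add: perp_def dual_sg_def int_vecs_uminus)
      then obtain M :: nat where M: "- u + real M *\<^sub>R n \<in> dual_sg \<sigma>"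
        using dual_sg_localization[OF \<sigma> ex] by blast
      have "f (real M *\<^sub>R n) \<noteq> z"
        using n nS f by (simp add: hom_scale pow_nonzero hom_sg_closed N_def)
      then have "u + (- u + real M *\<^sub>R n) \<in> N" using nS by (simp add: N_def dual_sg_scale)
      then show "f u \<noteq> z" using N_add[OF u M] by (simp add: N_def)
    qed
  qed
qed

end

lemma reduced_hom: "reduced A z \<tau> g \<Longrightarrow> g \<in> hom_sg_carrier (dual_sg \<tau>) A"
  by (simp add: reduced_def)

lemma reduced_nonzero_iff: "reduced A z \<tau> g \<Longrightarrow> u \<in> dual_sg \<tau> \<Longrightarrow> g u \<noteq> z \<longleftrightarrow> u \<in> perp \<tau>"
  by (simp add: reduced_def)

lemma hom_dual_sg_restrict:
  "f \<in> hom_sg_carrier (dual_sg \<tau>) A \<Longrightarrow> \<tau> \<subseteq> \<sigma> \<Longrightarrow> restrict f (dual_sg \<sigma>) \<in> hom_sg_carrier (dual_sg \<sigma>) A"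
  by (rule hom_sg_restrict[OF _ dual_sg_antimono]) (auto simp: dual_sg_add)

lemma restrict_restrict_subset: "T \<subseteq> S \<Longrightarrow> restrict (restrict f S) T = restrict f T"
  by (auto simp: restrict_def fun_eq_iff)

lemma perp_scale_add_iff:
  assumes "n \<in> dual_sg \<tau>" "n \<in> perp \<tau>" "u \<in> dual_sg \<tau>"
  shows "u + real M *\<^sub>R n \<in> perp \<tau> \<longleftrightarrow> u \<in> perp \<tau>"
  using perp_add_iff[OF assms(3) dual_sg_scale[OF assms(1)]] subspace_scale[OF subspace_perp assms(2)]
  by blast

context toric begin

text \<open>The value of the extension at \<open>u\<close> must be \<open>f (u + M n) / f n ^ M\<close>, for any \<open>M\<close> that brings \<open>u + M n\<close>
into \<open>dual_sg \<sigma>\<close>. Cancelling the unit \<open>f n\<close> shows that all such \<open>M\<close> give the same value.\<close>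

lemma extension_to_face:
  assumes \<sigma>: "\<sigma> \<in> F" and ex: "integrally_exposed \<tau> \<sigma> n"
    and f: "f \<in> hom_sg_carrier (dual_sg \<sigma>) A"
    and supp: "\<And>u. u \<in> dual_sg \<sigma> \<Longrightarrow> f u \<noteq> z \<longleftrightarrow> u \<in> perp \<tau>"
  obtains g where "reduced A z \<tau> g" "f = restrict g (dual_sg \<sigma>)"
proof -
  have nS: "n \<in> dual_sg \<sigma>" and sub: "\<tau> \<subseteq> \<sigma>" and np: "n \<in> perp \<tau>"
    using ex integrally_exposed_perp by (auto simp: integrally_exposed_def)
  have n\<tau>: "n \<in> dual_sg \<tau>" using nS sub dual_sg_antimono by blast
  have fn: "f n \<in> carrier A" "f n \<noteq> z" using f nS np supp hom_sg_closed by blast+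
  have fnM: "f n [^] (M::nat) \<in> carrier A" "f n [^] M \<noteq> z" for M
    using fn pow_nonzero by auto
  have shift: "f (u + real (M + M') *\<^sub>R n) = f (u + real M *\<^sub>R n) \<otimes> f n [^] M'"
    if "u + real M *\<^sub>R n \<in> dual_sg \<sigma>" for u and M M' :: nat
  proof -
    have "f ((u + real M *\<^sub>R n) + real M' *\<^sub>R n) = f (u + real M *\<^sub>R n) \<otimes> f n [^] M'"
      using that f nS by (simp add: hom_sg_add dual_sg_scale hom_scale)
    then show ?thesis by (simp add: scaleR_left_distrib add.assoc)
  qed
  \<comment> \<open>The graph of the extension, written without division.\<close>
  define G where "G u x \<longleftrightarrow> x \<in> carrier A \<and>
    (\<exists>M::nat. u + real M *\<^sub>R n \<in> dual_sg \<sigma> \<and> x \<otimes> f n [^] M = f (u + real M *\<^sub>R n))" for u x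
  have G_ex: "\<exists>x. G u x" if u: "u \<in> dual_sg \<tau>" for u
  proof -
    obtain M :: nat where M: "u + real M *\<^sub>R n \<in> dual_sg \<sigma>" using dual_sg_localization[OF \<sigma> ex u] by blast
    define y where "y = f (u + real M *\<^sub>R n)"
    have y: "y \<in> carrier A" using f M hom_sg_closed unfolding y_def by blast
    have U: "f n [^] M \<in> Units A" using fnM nonzero_Units by blast
    have "(y \<otimes> inv (f n [^] M)) \<otimes> f n [^] M = y"
      using y U by (simp add: m_assoc fnM)
    then show ?thesis unfolding G_def using M y U y_def by (metis Units_inv_closed m_closed)
  qed
  have G_unique: "x = x'" if x: "G u x" and x': "G u x'" for u x x'
  proof -
    obtain M :: nat where M: "u + real M *\<^sub>R n \<in> dual_sg \<sigma>" "x \<otimes> f n [^] M = f (u + real M *\<^sub>R n)"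
      using x by (auto simp: G_def)
    obtain M' :: nat where M': "u + real M' *\<^sub>R n \<in> dual_sg \<sigma>" "x' \<otimes> f n [^] M' = f (u + real M' *\<^sub>R n)"
      using x' by (auto simp: G_def)
    have xc: "x \<in> carrier A" "x' \<in> carrier A" using x x' by (auto simp: G_def)
    have "x \<otimes> f n [^] (M + M') = f (u + real (M + M') *\<^sub>R n)"
      using shift[OF M(1)] M(2) xc fn by (simp add: nat_pow_mult[symmetric] m_assoc[symmetric])
    also have "\<dots> = x' \<otimes> f n [^] (M + M')"
      using shift[OF M'(1), of M] M'(2) xc fn
      by (simp add: nat_pow_mult[symmetric] m_assoc[symmetric] add.commute[of M M'])
    finally show ?thesis using nonzero_cancel xc fnM by blast
  qed
  have G_add: "G (u + v) (x \<otimes> y)" if x: "G u x" and y: "G v y" for u v x y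
  proof -
    obtain M :: nat where M: "u + real M *\<^sub>R n \<in> dual_sg \<sigma>" "x \<otimes> f n [^] M = f (u + real M *\<^sub>R n)"
      using x by (auto simp: G_def)
    obtain M' :: nat where M': "v + real M' *\<^sub>R n \<in> dual_sg \<sigma>" "y \<otimes> f n [^] M' = f (v + real M' *\<^sub>R n)"
      using y by (auto simp: G_def)
    have c: "x \<in> carrier A" "y \<in> carrier A" using x y by (auto simp: G_def)
    have eq: "(u + v) + real (M + M') *\<^sub>R n = (u + real M *\<^sub>R n) + (v + real M' *\<^sub>R n)"
      by (simp add: scaleR_left_distrib)
    have "(x \<otimes> y) \<otimes> f n [^] (M + M') = (x \<otimes> f n [^] M) \<otimes> (y \<otimes> f n [^] M')"
      using c fnM fn by (simp add: nat_pow_mult[symmetric] m_ac)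
    also have "\<dots> = f ((u + v) + real (M + M') *\<^sub>R n)"
      unfolding eq M(2) M'(2) using hom_sg_add[OF f M(1) M'(1)] by simp
    moreover have "(u + v) + real (M + M') *\<^sub>R n \<in> dual_sg \<sigma>"
      unfolding eq using M M' dual_sg_add by blast
    ultimately show ?thesis unfolding G_def using c by (metis m_closed)
  qed
  have G_f: "G u (f u)" if "u \<in> dual_sg \<sigma>" for u
    unfolding G_def using that f by (auto intro!: exI[of _ 0] simp: hom_sg_closed)
  define g where "g = (\<lambda>u\<in>dual_sg \<tau>. THE x. G u x)"
  have gG: "G u (g u)" if "u \<in> dual_sg \<tau>" for u
  proof -
    have "\<exists>!x. G u x" using G_ex[OF that] G_unique by blast
    then show ?thesis using that theI'[of "G u"] by (simp add: g_def)
  qed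
  have geq: "g u = x" if "u \<in> dual_sg \<tau>" "G u x" for u x
    using gG G_unique that by blast
  have g0: "g 0 = \<one>" using geq[OF _ G_f[of 0]] hom_sg_0[OF f] by simp
  have gadd: "g (u + v) = g u \<otimes> g v" if "u \<in> dual_sg \<tau>" "v \<in> dual_sg \<tau>" for u v
    using geq[OF _ G_add[OF gG gG]] that dual_sg_add by blast
  have gc: "g u \<in> carrier A" if "u \<in> dual_sg \<tau>" for u
    using gG[OF that] by (simp add: G_def)
  have "g \<in> hom_sg_carrier (dual_sg \<tau>) A"
    using g0 gadd gc by (simp add: hom_sg_carrier_def) (simp add: g_def)
  moreover have "g u \<noteq> z \<longleftrightarrow> u \<in> perp \<tau>" if u: "u \<in> dual_sg \<tau>" for u
  proof -
    obtain M :: nat where M: "u + real M *\<^sub>R n \<in> dual_sg \<sigma>" "g u \<otimes> f n [^] M = f (u + real M *\<^sub>R n)"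
      using gG[OF u] by (auto simp: G_def)
    have "g u \<noteq> z \<longleftrightarrow> f (u + real M *\<^sub>R n) \<noteq> z"
      using mult_nonzero_iff[OF gc[OF u] fnM(1)] M(2) fnM(2) by metis
    then show ?thesis using supp[OF M(1)] perp_scale_add_iff[OF n\<tau> np u] by blast
  qed
  ultimately have red: "reduced A z \<tau> g" by (simp add: reduced_def)
  have "f = restrict g (dual_sg \<sigma>)"
  proof
    fix u show "f u = restrict g (dual_sg \<sigma>) u"
    proof (cases "u \<in> dual_sg \<sigma>")
      case True
      then show ?thesis using geq[OF _ G_f[OF True]] dual_sg_antimono[OF sub] by auto
    next
      case False
      then show ?thesis using fun_cong[OF hom_sg_ext[OF f], of u] by simp
    qed
  qed
  then show ?thesis using that red by blast
qed

lemma reduction_exists: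
  assumes "\<sigma> \<in> F" "f \<in> hom_sg_carrier (dual_sg \<sigma>) A"
  obtains \<tau> g where "\<tau> \<in> F" "\<tau> \<subseteq> \<sigma>" "reduced A z \<tau> g" "f = restrict g (dual_sg \<sigma>)"
proof -
  obtain \<tau> n where *: "\<tau> \<in> F" "integrally_exposed \<tau> \<sigma> n"
    "\<And>u. u \<in> dual_sg \<sigma> \<Longrightarrow> f u \<noteq> z \<longleftrightarrow> u \<in> perp \<tau>"
    using support_is_face[OF assms] by metis
  moreover have "\<tau> \<subseteq> \<sigma>" using *(2) by (auto simp: integrally_exposed_def)
  ultimately show ?thesis using extension_to_face[OF assms(1) *(2) assms(2)] that by metis
qed

text \<open>The support of the common restriction determines the face, since the vector exposing \<open>\<tau>\<close> in \<open>\<sigma>\<close>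
lies in the support of a reduced morphism exactly when its cone is contained in \<open>\<tau>\<close>. On the face itself the values are
recovered by cancelling powers of the value at the exposing vector.\<close>

lemma reduction_unique:
  assumes "\<sigma> \<in> F" "\<tau> \<in> F" "\<tau>' \<in> F" "\<tau> \<subseteq> \<sigma>" "\<tau>' \<subseteq> \<sigma>"
    and g: "reduced A z \<tau> g" and g': "reduced A z \<tau>' g'"
    and eq: "restrict g (dual_sg \<sigma>) = restrict g' (dual_sg \<sigma>)"
  shows "\<tau> = \<tau>' \<and> g = g'"
proof -
  have agree: "g u = g' u" if "u \<in> dual_sg \<sigma>" for u
    using fun_cong[OF eq, of u] that by simp
  have sub: "\<tau>2 \<subseteq> \<tau>1" if T: "\<tau>1 \<in> F" "\<tau>1 \<subseteq> \<sigma>" "\<tau>2 \<subseteq> \<sigma>" "reduced A z \<tau>1 g1" "reduced A z \<tau>2 g2"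
    "\<And>u. u \<in> dual_sg \<sigma> \<Longrightarrow> g1 u = g2 u" for \<tau>1 \<tau>2 g1 g2
  proof -
    obtain n where n: "integrally_exposed \<tau>1 \<sigma> n"
      using exposed[OF T(1) assms(1) T(2)] by blast
    then have nS: "n \<in> dual_sg \<sigma>" by (simp add: integrally_exposed_def)
    have "g1 n \<noteq> z"
      using reduced_nonzero_iff[OF T(4)] integrally_exposed_perp[OF n] nS dual_sg_antimono[OF T(2)] by blast
    then have "g2 n \<noteq> z" using T(6)[OF nS] by simp
    then have "n \<in> perp \<tau>2" using reduced_nonzero_iff[OF T(5)] nS dual_sg_antimono[OF T(3)] by blast
    then show ?thesis using n T(3) by (auto simp: integrally_exposed_def perp_def)
  qed
  have \<tau>: "\<tau> = \<tau>'"
    using sub[of \<tau> \<tau>' g g'] sub[of \<tau>' \<tau> g' g] assms agree by auto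
  obtain n where n: "integrally_exposed \<tau> \<sigma> n" using exposed assms by blast
  have nS: "n \<in> dual_sg \<sigma>" using n by (simp add: integrally_exposed_def)
  have n\<tau>: "n \<in> dual_sg \<tau>" using nS dual_sg_antimono[OF \<open>\<tau> \<subseteq> \<sigma>\<close>] by blast
  have "g u = g' u" if u: "u \<in> dual_sg \<tau>" for u
  proof -
    obtain M :: nat where M: "u + real M *\<^sub>R n \<in> dual_sg \<sigma>" using dual_sg_localization[OF assms(1) n u] by blast
    note hg = reduced_hom[OF g] and hg' = reduced_hom[OF g', folded \<tau>]
    have "g u \<otimes> g (real M *\<^sub>R n) = g' u \<otimes> g' (real M *\<^sub>R n)"
      using agree[OF M] hom_sg_add[OF hg u dual_sg_scale[OF n\<tau>]] hom_sg_add[OF hg' u dual_sg_scale[OF n\<tau>]]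
      by simp
    also have "g' (real M *\<^sub>R n) = g (real M *\<^sub>R n)" using agree dual_sg_scale[OF nS] by simp
    finally have "g u \<otimes> g (real M *\<^sub>R n) = g' u \<otimes> g (real M *\<^sub>R n)" .
    moreover have "g (real M *\<^sub>R n) \<noteq> z"
      using reduced_nonzero_iff[OF g dual_sg_scale[OF n\<tau>]] integrally_exposed_perp[OF n]
        subspace_scale[OF subspace_perp] by blast
    ultimately show ?thesis
      using nonzero_cancel hom_sg_closed[OF hg] hom_sg_closed[OF hg'] u dual_sg_scale[OF n\<tau>] by blast
  qed
  then have "restrict g (dual_sg \<tau>) = restrict g' (dual_sg \<tau>)" by (auto simp: restrict_def)
  then have "g = g'" using hom_sg_ext reduced_hom g g' \<tau> by metis
  then show ?thesis using \<tau> by blast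
qed

text \<open>The right-hand side contains \<open>(\<tau>, g)\<close> and is closed under gluing steps in both directions. Enlarging
the cone just restricts further; passing to a smaller cone is where uniqueness of the reduction
is used, as the new point has to come from the same \<open>g\<close>.\<close>

lemma toric_class_reduced:
  assumes \<tau>: "\<tau> \<in> F" and g: "reduced A z \<tau> g"
  shows "toric_class F A (\<tau>, g) = {(\<sigma>, restrict g (dual_sg \<sigma>)) | \<sigma>. \<sigma> \<in> F \<and> \<tau> \<subseteq> \<sigma>}"
proof (intro equalityI subsetI)
  fix r assume "r \<in> {(\<sigma>, restrict g (dual_sg \<sigma>)) | \<sigma>. \<sigma> \<in> F \<and> \<tau> \<subseteq> \<sigma>}"
  then obtain \<sigma> where "r = (\<sigma>, restrict g (dual_sg \<sigma>))" "\<sigma> \<in> F" "\<tau> \<subseteq> \<sigma>" by blast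
  then have "((\<tau>, g), r) \<in> toric_step F A"
    using \<tau> reduced_hom[OF g] face_iff_subset unfolding toric_step_def by auto
  then show "r \<in> toric_class F A (\<tau>, g)" unfolding toric_class_def toric_equiv_def by blast
next
  fix r assume "r \<in> toric_class F A (\<tau>, g)"
  then have "((\<tau>, g), r) \<in> (toric_step F A \<union> (toric_step F A)\<inverse>)\<^sup>*"
    by (simp add: toric_class_def toric_equiv_def)
  then show "r \<in> {(\<sigma>, restrict g (dual_sg \<sigma>)) | \<sigma>. \<sigma> \<in> F \<and> \<tau> \<subseteq> \<sigma>}"
  proof (induction rule: rtrancl_induct)
    case base
    have "g = restrict g (dual_sg \<tau>)" using hom_sg_ext reduced_hom[OF g] by blast
    then show ?case using \<tau> by blast
  next
    case (step r s)
    from step(2) show ?case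
    proof
      assume "(r, s) \<in> toric_step F A"
      then obtain \<tau>1 \<sigma>1 f where *: "r = (\<tau>1, f)" "s = (\<sigma>1, restrict f (dual_sg \<sigma>1))"
        "\<tau>1 \<in> F" "\<sigma>1 \<in> F" "\<tau>1 \<subseteq> \<sigma>1"
        unfolding toric_step_def using face_of_imp_subset by blast
      then have "f = restrict g (dual_sg \<tau>1)" "\<tau> \<subseteq> \<tau>1" using step.IH by auto
      then have "s = (\<sigma>1, restrict g (dual_sg \<sigma>1))"
        using *(2) restrict_restrict_subset[OF dual_sg_antimono[OF *(5)], of g] by simp
      then show ?case using * \<open>\<tau> \<subseteq> \<tau>1\<close> by blast
    next
      assume "(r, s) \<in> (toric_step F A)\<inverse>"
      then obtain \<tau>1 \<sigma>1 f where *: "s = (\<tau>1, f)" "r = (\<sigma>1, restrict f (dual_sg \<sigma>1))"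
        "\<tau>1 \<in> F" "\<sigma>1 \<in> F" "\<tau>1 \<subseteq> \<sigma>1" "f \<in> hom_sg_carrier (dual_sg \<tau>1) A"
        unfolding toric_step_def by (auto dest: face_of_imp_subset)
      have IH: "restrict f (dual_sg \<sigma>1) = restrict g (dual_sg \<sigma>1)" "\<tau> \<subseteq> \<sigma>1"
        using step.IH * by auto
      obtain \<tau>2 g2 where g2: "\<tau>2 \<in> F" "\<tau>2 \<subseteq> \<tau>1" "reduced A z \<tau>2 g2" "f = restrict g2 (dual_sg \<tau>1)"
        using reduction_exists[OF *(3) *(6)] by metis
      have "restrict g2 (dual_sg \<sigma>1) = restrict g (dual_sg \<sigma>1)"
        using IH(1) g2(4) restrict_restrict_subset[OF dual_sg_antimono[OF *(5)]] by metis
      then have "\<tau>2 = \<tau> \<and> g2 = g"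
        using reduction_unique[OF *(4) g2(1) \<tau> _ IH(2) g2(3) g] g2(2) *(5) by blast
      then show ?case using g2 * by blast
    qed
  qed
qed

lemma toric_class_self: "r \<in> toric_class F A r"
  by (simp add: toric_class_def toric_equiv_def)

lemma sym_toric_equiv: "sym (toric_equiv F A)"
  unfolding toric_equiv_def by (intro sym_rtrancl sym_Un_converse)

lemma toric_class_eq:
  assumes "r \<in> toric_class F A s"
  shows "toric_class F A r = toric_class F A s"
proof -
  have sr: "(s, r) \<in> toric_equiv F A" using assms by (simp add: toric_class_def)
  then have rs: "(r, s) \<in> toric_equiv F A" using sym_toric_equiv by (meson symD)
  have tr: "trans (toric_equiv F A)" by (simp add: toric_equiv_def trans_rtrancl)
  show ?thesis unfolding toric_class_def using sr rs tr by (auto elim: transE)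
qed

lemma toric_class_restrict:
  assumes "\<tau> \<in> F" "\<sigma> \<in> F" "\<tau> \<subseteq> \<sigma>" "reduced A z \<tau> g"
  shows "toric_class F A (\<sigma>, restrict g (dual_sg \<sigma>)) = toric_class F A (\<tau>, g)"
  using assms by (intro toric_class_eq) (auto simp: toric_class_reduced)

lemma topspace_hom_sg: "topspace (topo (hom_sg S A)) = hom_sg_carrier S A"
  by (auto simp: hom_sg_def topspace_topo hom_sg_carrier_def)

lemma topspace_toric_charts:
  "topspace (toric_charts F A) = (SIGMA \<sigma>:F. hom_sg_carrier (dual_sg \<sigma>) A)"
  by (simp add: toric_charts_def topspace_hom_sg comp_def)

lemma topspace_toric_space:
  "topspace (toric_space F A) = {toric_class F A (\<tau>, g) | \<tau> g. \<tau> \<in> F \<and> reduced A z \<tau> g}"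
proof (intro equalityI subsetI)
  fix c assume "c \<in> topspace (toric_space F A)"
  then obtain \<sigma> f where *: "\<sigma> \<in> F" "f \<in> hom_sg_carrier (dual_sg \<sigma>) A" "c = toric_class F A (\<sigma>, f)"
    by (auto simp: toric_space_def topspace_quotient_topology topspace_toric_charts)
  obtain \<tau> g where "\<tau> \<in> F" "\<tau> \<subseteq> \<sigma>" "reduced A z \<tau> g" "f = restrict g (dual_sg \<sigma>)"
    using reduction_exists[OF *(1,2)] by metis
  then show "c \<in> {toric_class F A (\<tau>, g) | \<tau> g. \<tau> \<in> F \<and> reduced A z \<tau> g}"
    using * toric_class_restrict by blast
qed (auto simp: toric_space_def topspace_quotient_topology topspace_toric_charts dest: reduced_hom)

lemma toric_class_inj:
  assumes "\<tau> \<in> F" "reduced A z \<tau> g" "\<tau>' \<in> F" "reduced A z \<tau>' g'"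
    and eq: "toric_class F A (\<tau>, g) = toric_class F A (\<tau>', g')"
  shows "\<tau> = \<tau>' \<and> g = g'"
proof -
  have "(\<tau>, g) \<in> toric_class F A (\<tau>', g')" "(\<tau>', g') \<in> toric_class F A (\<tau>, g)"
    using eq toric_class_self by metis+
  then have "\<tau> = \<tau>'" and *: "g = restrict g' (dual_sg \<tau>)"
    unfolding toric_class_reduced[OF assms(1,2)] toric_class_reduced[OF assms(3,4)] by auto
  then show ?thesis using hom_sg_ext reduced_hom assms(4) by metis
qed

lemma reduced_mult:
  assumes g: "reduced A z \<tau> g" and t: "t \<in> hom_sg_carrier int_vecs A"
  shows "reduced A z \<tau> (\<lambda>u\<in>dual_sg \<tau>. t u \<otimes> g u)"
proof -
  have sub: "dual_sg \<tau> \<subseteq> int_vecs" by (auto simp: dual_sg_def)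
  have tc: "t u \<in> carrier A" if "u \<in> dual_sg \<tau>" for u using t that sub hom_sg_closed by blast
  have tnz: "t u \<noteq> z" if "u \<in> dual_sg \<tau>" for u
  proof -
    have u: "u \<in> int_vecs" "- u \<in> int_vecs" using that sub int_vecs_uminus by blast+
    then have "t (u + - u) = t u \<otimes> t (- u)" using hom_sg_add[OF t] by blast
    then have "t u \<otimes> t (- u) = \<one>" using hom_sg_0[OF t] by simp
    then show ?thesis using zero_mult hom_sg_closed[OF t] u one_not_zero by metis
  qed
  note hg = reduced_hom[OF g]
  have "t (u + v) \<otimes> g (u + v) = (t u \<otimes> g u) \<otimes> (t v \<otimes> g v)" if "u \<in> dual_sg \<tau>" "v \<in> dual_sg \<tau>" for u v
  proof -
    have "t (u + v) = t u \<otimes> t v" using that sub hom_sg_add[OF t] by blast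
    then show ?thesis using that hom_sg_add[OF hg] tc hom_sg_closed[OF hg] by (simp add: m_ac)
  qed
  then have "(\<lambda>u\<in>dual_sg \<tau>. t u \<otimes> g u) \<in> hom_sg_carrier (dual_sg \<tau>) A"
    using hom_sg_0[OF t] hom_sg_0[OF hg] tc hom_sg_closed[OF hg]
    by (auto simp: hom_sg_carrier_def dual_sg_add)
  then show ?thesis
    using mult_nonzero_iff tc tnz hom_sg_closed[OF hg] reduced_nonzero_iff[OF g] by (simp add: reduced_def)
qed

lemma torus_action_reduced:
  assumes \<tau>: "\<tau> \<in> F" and g: "reduced A z \<tau> g" and t: "t \<in> hom_sg_carrier int_vecs A"
  shows "torus_action F A t (toric_class F A (\<tau>, g)) = toric_class F A (\<tau>, \<lambda>u\<in>dual_sg \<tau>. t u \<otimes> g u)"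
proof -
  let ?g = "\<lambda>u\<in>dual_sg \<tau>. t u \<otimes> g u"
  have "toric_class F A (\<sigma>, \<lambda>u\<in>dual_sg \<sigma>. t u \<otimes> restrict g (dual_sg \<sigma>) u) = toric_class F A (\<tau>, ?g)"
    if "\<sigma> \<in> F" "\<tau> \<subseteq> \<sigma>" for \<sigma>
  proof -
    have "(\<lambda>u\<in>dual_sg \<sigma>. t u \<otimes> restrict g (dual_sg \<sigma>) u) = restrict ?g (dual_sg \<sigma>)"
      using dual_sg_antimono[OF that(2)] by (auto simp: restrict_def fun_eq_iff)
    then show ?thesis using toric_class_restrict[OF \<tau> that reduced_mult[OF g t]] by simp
  qed
  then show ?thesis
    unfolding torus_action_def toric_class_reduced[OF \<tau> g] using \<tau> by auto
qed

end

text \<open>A monoid morphism that vanishes only at zero preserves supports, so it maps reduced representatives to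
reduced representatives on the same cone. This covers both the projection to \<open>\<complex>\<close> and the modulus.\<close>

lemma toric_map_reduced:
  assumes "toric F A z" "toric F B w" and \<tau>: "\<tau> \<in> F" and g: "reduced A z \<tau> g"
    and closed: "\<And>x. x \<in> carrier A \<Longrightarrow> \<phi> x \<in> carrier B"
    and mult: "\<And>x y. x \<in> carrier A \<Longrightarrow> y \<in> carrier A \<Longrightarrow> \<phi> (x \<otimes>\<^bsub>A\<^esub> y) = \<phi> x \<otimes>\<^bsub>B\<^esub> \<phi> y"
    and one: "\<phi> \<one>\<^bsub>A\<^esub> = \<one>\<^bsub>B\<^esub>"
    and zero: "\<And>x. x \<in> carrier A \<Longrightarrow> \<phi> x = w \<longleftrightarrow> x = z"
  shows "reduced B w \<tau> (\<lambda>u\<in>dual_sg \<tau>. \<phi> (g u))"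
    and "toric_map F B \<phi> (toric_class F A (\<tau>, g)) = toric_class F B (\<tau>, \<lambda>u\<in>dual_sg \<tau>. \<phi> (g u))"
proof -
  interpret A: toric F A z by fact
  interpret B: toric F B w by fact
  let ?g = "\<lambda>u\<in>dual_sg \<tau>. \<phi> (g u)"
  note hg = reduced_hom[OF g]
  have "?g \<in> hom_sg_carrier (dual_sg \<tau>) B"
    using hom_sg_closed[OF hg] closed hom_sg_0[OF hg] one hom_sg_add[OF hg] mult
    by (auto simp: hom_sg_carrier_def dual_sg_add)
  then show red: "reduced B w \<tau> ?g"
    using reduced_nonzero_iff[OF g] zero hom_sg_closed[OF hg] by (simp add: reduced_def)
  have "toric_class F B (\<sigma>, \<lambda>u\<in>dual_sg \<sigma>. \<phi> (restrict g (dual_sg \<sigma>) u)) = toric_class F B (\<tau>, ?g)"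
    if "\<sigma> \<in> F" "\<tau> \<subseteq> \<sigma>" for \<sigma>
  proof -
    have "(\<lambda>u\<in>dual_sg \<sigma>. \<phi> (restrict g (dual_sg \<sigma>) u)) = restrict ?g (dual_sg \<sigma>)"
      using dual_sg_antimono[OF that(2)] by (auto simp: restrict_def fun_eq_iff)
    then show ?thesis using B.toric_class_restrict[OF \<tau> that red] by simp
  qed
  then show "toric_map F B \<phi> (toric_class F A (\<tau>, g)) = toric_class F B (\<tau>, ?g)"
    unfolding toric_map_def A.toric_class_reduced[OF \<tau> g] using \<tau> by auto
qed

section \<open>Affine charts\<close>

lemma continuous_hom_eval:
  "u \<in> S \<Longrightarrow> continuous_map (topo (hom_sg S A)) (topo A) (\<lambda>f. f u)"
  unfolding hom_sg_def
  by (auto intro!: continuous_map_from_subtopology continuous_map_product_projection)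

text \<open>The image in the toric space of the affine chart of \<open>\<tau>\<close>, described by canonical representatives.\<close>

definition chart_nbhd :: "(real^'n) set set \<Rightarrow> 'a topmonoid \<Rightarrow> 'a \<Rightarrow> (real^'n) set \<Rightarrow> ('n, 'a) chart_point set set" where
  "chart_nbhd F A z \<tau> = {toric_class F A (\<rho>, g) | \<rho> g. \<rho> \<in> F \<and> \<rho> \<subseteq> \<tau> \<and> reduced A z \<rho> g}"

text \<open>The value at \<open>u\<close> of the representative on the chart of \<open>\<tau>\<close>; it is meaningful on the classes in the
chart neighbourhood of \<open>\<tau>\<close>, where that representative exists and is unique.\<close>

definition chart_eval :: "(real^'n) set \<Rightarrow> real^'n \<Rightarrow> ('n, 'a) chart_point set \<Rightarrow> 'a" where
  "chart_eval \<tau> u c = (THE f. (\<tau>, f) \<in> c) u"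

context toric begin

lemma openin_toric_space:
  "openin (toric_space F A) U \<longleftrightarrow> U \<subseteq> topspace (toric_space F A) \<and>
     (\<forall>\<sigma>\<in>F. openin (topo (hom_sg (dual_sg \<sigma>) A))
        {f \<in> hom_sg_carrier (dual_sg \<sigma>) A. toric_class F A (\<sigma>, f) \<in> U})"
proof -
  have "openin (toric_charts F A) {x \<in> topspace (toric_charts F A). toric_class F A x \<in> U} \<longleftrightarrow>
     (\<forall>\<sigma>\<in>F. openin (topo (hom_sg (dual_sg \<sigma>) A))
        {f \<in> hom_sg_carrier (dual_sg \<sigma>) A. toric_class F A (\<sigma>, f) \<in> U})"
    unfolding toric_charts_def openin_sum_topology
    by (intro iffI ballI conjI) (auto simp: topspace_hom_sg cong: conj_cong)
  then show ?thesis
    by (simp add: toric_space_def openin_quotient_topology topspace_quotient_topology)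
qed

text \<open>A point of the chart of \<open>\<sigma>\<close> belongs to the chart of \<open>\<tau>\<close> when its canonical cone lies in \<open>\<sigma> \<inter> \<tau>\<close>. The
exposing vector of that face detects this by a nonzero value, which is an open condition.\<close>

lemma class_in_chart_iff:
  assumes "\<sigma> \<in> F" "\<tau> \<in> F" "integrally_exposed (\<sigma> \<inter> \<tau>) \<sigma> n" "f \<in> hom_sg_carrier (dual_sg \<sigma>) A"
  shows "toric_class F A (\<sigma>, f) \<in> chart_nbhd F A z \<tau> \<longleftrightarrow> f n \<noteq> z"
proof -
  obtain \<rho> g where g: "\<rho> \<in> F" "\<rho> \<subseteq> \<sigma>" "reduced A z \<rho> g" "f = restrict g (dual_sg \<sigma>)"
    using reduction_exists[OF assms(1,4)] by metis
  have n: "n \<in> dual_sg \<sigma>" "n \<in> dual_sg \<rho>"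
    using assms(3) dual_sg_antimono[OF g(2)] by (auto simp: integrally_exposed_def)
  have cl: "toric_class F A (\<sigma>, f) = toric_class F A (\<rho>, g)"
    unfolding g(4) using toric_class_restrict g assms by blast
  have "toric_class F A (\<sigma>, f) \<in> chart_nbhd F A z \<tau> \<longleftrightarrow> \<rho> \<subseteq> \<tau>"
    unfolding cl chart_nbhd_def using g toric_class_inj by blast
  also have "\<dots> \<longleftrightarrow> n \<in> perp \<rho>"
    using assms(3) g(2) by (auto simp: integrally_exposed_def perp_def)
  also have "\<dots> \<longleftrightarrow> f n \<noteq> z"
    using reduced_nonzero_iff[OF g(3) n(2)] g(4) n by simp
  finally show ?thesis .
qed

lemma openin_hom_nonzero:
  assumes "n \<in> S"
  shows "openin (topo (hom_sg S A)) {f \<in> hom_sg_carrier S A. f n \<noteq> z}"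
proof -
  have "{f \<in> hom_sg_carrier S A. f n \<noteq> z} =
      {f \<in> topspace (topo (hom_sg S A)). f n \<in> carrier A - {z}}"
    using assms by (auto simp: topspace_hom_sg hom_sg_closed)
  then show ?thesis
    using openin_continuous_map_preimage[OF continuous_hom_eval[OF assms] openin_nonzero] by simp
qed

lemma chart_exposed:
  assumes "\<sigma> \<in> F" "\<tau> \<in> F"
  obtains n where "integrally_exposed (\<sigma> \<inter> \<tau>) \<sigma> n" "n \<in> dual_sg \<sigma>"
  using exposed[of "\<sigma> \<inter> \<tau>" \<sigma>] Int_in_fan[of \<tau> \<sigma>] assms that
  by (auto simp: integrally_exposed_def)

lemma chart_nbhd_subset: "chart_nbhd F A z \<tau> \<subseteq> topspace (toric_space F A)"
  unfolding chart_nbhd_def topspace_toric_space by blast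

lemma openin_chart_nbhd:
  assumes "\<tau> \<in> F"
  shows "openin (toric_space F A) (chart_nbhd F A z \<tau>)"
  unfolding openin_toric_space
proof (intro conjI ballI chart_nbhd_subset)
  fix \<sigma> assume \<sigma>: "\<sigma> \<in> F"
  obtain n where n: "integrally_exposed (\<sigma> \<inter> \<tau>) \<sigma> n" "n \<in> dual_sg \<sigma>"
    using chart_exposed[OF \<sigma> assms] by blast
  have "{f \<in> hom_sg_carrier (dual_sg \<sigma>) A. toric_class F A (\<sigma>, f) \<in> chart_nbhd F A z \<tau>} =
        {f \<in> hom_sg_carrier (dual_sg \<sigma>) A. f n \<noteq> z}"
    using class_in_chart_iff[OF \<sigma> assms n(1)] by blast
  then show "openin (topo (hom_sg (dual_sg \<sigma>) A))
      {f \<in> hom_sg_carrier (dual_sg \<sigma>) A. toric_class F A (\<sigma>, f) \<in> chart_nbhd F A z \<tau>}"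
    using openin_hom_nonzero[OF n(2)] by simp
qed

lemma chart_eval_reduced:
  assumes "\<rho> \<in> F" "reduced A z \<rho> g" "\<tau> \<in> F" "\<rho> \<subseteq> \<tau>" "u \<in> dual_sg \<tau>"
  shows "chart_eval \<tau> u (toric_class F A (\<rho>, g)) = g u"
proof -
  have "(THE f. (\<tau>, f) \<in> toric_class F A (\<rho>, g)) = restrict g (dual_sg \<tau>)"
    unfolding toric_class_reduced[OF assms(1,2)] using assms by (intro the_equality) auto
  then show ?thesis using assms by (simp add: chart_eval_def)
qed

lemma chart_eval_class:
  assumes "\<sigma> \<in> F" "\<tau> \<in> F" "integrally_exposed (\<sigma> \<inter> \<tau>) \<sigma> n"
    "f \<in> hom_sg_carrier (dual_sg \<sigma>) A" "f n \<noteq> z" "u \<in> dual_sg \<tau>" "u + real M *\<^sub>R n \<in> dual_sg \<sigma>"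
  shows "chart_eval \<tau> u (toric_class F A (\<sigma>, f)) \<in> carrier A"
    and "f (u + real M *\<^sub>R n) = chart_eval \<tau> u (toric_class F A (\<sigma>, f)) \<otimes> f n [^] M"
proof -
  obtain \<rho> g where g: "\<rho> \<in> F" "\<rho> \<subseteq> \<sigma>" "reduced A z \<rho> g" "f = restrict g (dual_sg \<sigma>)"
    using reduction_exists[OF assms(1,4)] by metis
  have n: "n \<in> dual_sg \<sigma>" "n \<in> dual_sg \<rho>"
    using assms(3) dual_sg_antimono[OF g(2)] by (auto simp: integrally_exposed_def)
  have cl: "toric_class F A (\<sigma>, f) = toric_class F A (\<rho>, g)"
    unfolding g(4) using toric_class_restrict g assms by blast
  have "n \<in> perp \<rho>" using reduced_nonzero_iff[OF g(3) n(2)] g(4) n assms by simp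
  then have "\<rho> \<subseteq> \<tau>" using assms(3) g(2) by (auto simp: integrally_exposed_def perp_def)
  then have ev: "chart_eval \<tau> u (toric_class F A (\<sigma>, f)) = g u"
    unfolding cl using chart_eval_reduced g assms by blast
  have u: "u \<in> dual_sg \<rho>" using assms(6) dual_sg_antimono[OF \<open>\<rho> \<subseteq> \<tau>\<close>] by blast
  note hg = reduced_hom[OF g(3)]
  show "chart_eval \<tau> u (toric_class F A (\<sigma>, f)) \<in> carrier A"
    unfolding ev using hg u hom_sg_closed by blast
  have "g (u + real M *\<^sub>R n) = g u \<otimes> g n [^] M"
    using hom_sg_add[OF hg u dual_sg_scale[OF n(2)]] hom_scale[OF hg n(2)] by simp
  then show "f (u + real M *\<^sub>R n) = chart_eval \<tau> u (toric_class F A (\<sigma>, f)) \<otimes> f n [^] M"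
    unfolding ev using g(4) n assms by simp
qed

end


section \<open>The coefficient monoids\<close>

lemma carrier_mult_on [simp]: "carrier (mult_on S) = S"
  and mult_mult_on: "x \<otimes>\<^bsub>mult_on S\<^esub> y = x * y"
  and one_mult_on: "\<one>\<^bsub>mult_on S\<^esub> = 1"
  by (simp_all add: mult_on_def)

lemma comm_monoid_mult_on:
  fixes S :: "'a::{comm_monoid_mult, topological_space} set"
  assumes "1 \<in> S" "\<And>x y. x \<in> S \<Longrightarrow> y \<in> S \<Longrightarrow> x * y \<in> S"
  shows "comm_monoid (mult_on S)"
  using assms by unfold_locales (auto simp: mult_on_def mult_ac)

lemma group_with_zero_mult_on:
  fixes S :: "'a::{field, t1_space} set"
  assumes "1 \<in> S" "0 \<in> S" "\<And>x y. x \<in> S \<Longrightarrow> y \<in> S \<Longrightarrow> x * y \<in> S" "\<And>x. x \<in> S \<Longrightarrow> inverse x \<in> S"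
  shows "group_with_zero (mult_on S) 0"
proof -
  interpret comm_monoid "mult_on S" using comm_monoid_mult_on assms by blast
  show ?thesis
  proof
    fix x assume x: "x \<in> carrier (mult_on S)" "x \<noteq> 0"
    then have "inverse x \<in> carrier (mult_on S)" using assms by (simp add: mult_on_def)
    then show "x \<in> Units (mult_on S)" using x
      unfolding Units_def by (auto simp: mult_on_def intro!: bexI[of _ "inverse x"])
  next
    show "openin (topo (mult_on S)) (carrier (mult_on S) - {0})"
      by (auto simp: mult_on_def openin_open intro!: exI[of _ "- {0}"])
  qed (auto simp: mult_on_def assms)
qed

lemma group_with_zero_CC: "group_with_zero CC 0"
  by (rule group_with_zero_mult_on) auto

lemma group_with_zero_RR_nonneg: "group_with_zero RR_nonneg 0"
  by (rule group_with_zero_mult_on) auto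

definition zero_Q :: "nat \<Rightarrow> complex" where "zero_Q = (\<lambda>k\<in>{1..}. 0)"

lemma one_powlim_mult_on: "\<one>\<^bsub>powlim (mult_on S)\<^esub> = (\<lambda>k\<in>{1..}. 1)"
  by (simp add: powlim_def mult_on_def)

lemma powlim_apply: "x \<in> carrier (powlim (mult_on S)) \<Longrightarrow> k \<ge> 1 \<Longrightarrow> x k \<in> S"
  unfolding carrier_powlim_mult_on by (blast intro: PiE_mem)

lemma powlim_extensional: "x \<in> carrier (powlim (mult_on S)) \<Longrightarrow> x \<in> extensional {1..}"
  unfolding carrier_powlim_mult_on PiE_def by blast

lemma powlim_root:
  "x \<in> carrier (powlim (mult_on S)) \<Longrightarrow> k \<ge> 1 \<Longrightarrow> m \<ge> 1 \<Longrightarrow> x m = x (k * m) ^ k"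
  unfolding carrier_powlim_mult_on by (elim conjE allE[of _ m] impE allE[of _ "k * m"]) auto

lemma powlim_eqI:
  "x \<in> carrier (powlim (mult_on S)) \<Longrightarrow> y \<in> carrier (powlim (mult_on S)) \<Longrightarrow>
   (\<And>k. k \<ge> 1 \<Longrightarrow> x k = y k) \<Longrightarrow> x = y"
  by (rule extensionalityI[OF powlim_extensional powlim_extensional]) auto

lemma powlimI:
  assumes "x \<in> extensional {1..}" "\<And>k. k \<ge> 1 \<Longrightarrow> x k \<in> S" "\<And>k m. k \<ge> 1 \<Longrightarrow> m \<ge> 1 \<Longrightarrow> x m = x (k * m) ^ k"
  shows "x \<in> carrier (powlim (mult_on S))"
  unfolding carrier_powlim_mult_on
proof (intro conjI allI impI)
  show "x \<in> {1..} \<rightarrow>\<^sub>E S" using assms(1,2) unfolding PiE_def Pi_def by blast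
  fix k m :: nat assume "1 \<le> k" "1 \<le> m" "k dvd m"
  then obtain j where "m = k * j" by auto
  with \<open>1 \<le> m\<close> assms(3)[of j k] \<open>1 \<le> k\<close> show "x k = x m ^ (m div k)" by (simp add: mult.commute)
qed

lemma comm_monoid_powlim:
  fixes S :: "'a::{comm_monoid_mult, topological_space} set"
  assumes "1 \<in> S" "\<And>x y. x \<in> S \<Longrightarrow> y \<in> S \<Longrightarrow> x * y \<in> S"
  shows "comm_monoid (powlim (mult_on S))"
proof
  fix x y assume x: "x \<in> carrier (powlim (mult_on S))" and y: "y \<in> carrier (powlim (mult_on S))"
  show "x \<otimes>\<^bsub>powlim (mult_on S)\<^esub> y \<in> carrier (powlim (mult_on S))"
    unfolding mult_powlim_mult_on
  proof (rule powlimI)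
    fix k m :: nat assume km: "k \<ge> 1" "m \<ge> 1"
    then have "k * m \<ge> 1" by (metis mult_le_mono nat_mult_1)
    then show "(\<lambda>k\<in>{1..}. x k * y k) m = (\<lambda>k\<in>{1..}. x k * y k) (k * m) ^ k"
      using powlim_root[OF x km] powlim_root[OF y km] km by (simp add: power_mult_distrib)
  qed (use assms powlim_apply[OF x] powlim_apply[OF y] in auto)
  show "x \<otimes>\<^bsub>powlim (mult_on S)\<^esub> y = y \<otimes>\<^bsub>powlim (mult_on S)\<^esub> x"
    by (simp add: mult_powlim_mult_on mult.commute)
next
  show "\<one>\<^bsub>powlim (mult_on S)\<^esub> \<in> carrier (powlim (mult_on S))"
    unfolding one_powlim_mult_on using assms by (intro powlimI) auto
next
  fix x assume x: "x \<in> carrier (powlim (mult_on S))"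
  then have "x \<in> extensional {1..}" by (rule powlim_extensional)
  then show "\<one>\<^bsub>powlim (mult_on S)\<^esub> \<otimes>\<^bsub>powlim (mult_on S)\<^esub> x = x"
    and "x \<otimes>\<^bsub>powlim (mult_on S)\<^esub> \<one>\<^bsub>powlim (mult_on S)\<^esub> = x"
    by (auto simp: mult_powlim_mult_on one_powlim_mult_on fun_eq_iff extensional_def)
qed (auto simp: mult_powlim_mult_on mult.assoc restrict_def)

lemma topo_powlim:
  "topo (powlim (mult_on S)) =
     subtopology (product_topology (\<lambda>_. top_of_set S) {1..}) (carrier (powlim (mult_on S)))"
  by (simp add: powlim_def mult_on_def)

lemma topspace_powlim: "topspace (topo (powlim (mult_on S))) = carrier (powlim (mult_on S))"
proof -
  have "carrier (powlim (mult_on S)) \<subseteq> {1..} \<rightarrow>\<^sub>E S"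
    using carrier_powlim_mult_on by blast
  then show ?thesis unfolding topo_powlim by (simp add: Int_absorb1)
qed

lemma continuous_map_powlim:
  "continuous_map X (topo (powlim (mult_on S))) h \<longleftrightarrow>
     h ` topspace X \<subseteq> carrier (powlim (mult_on S)) \<and>
     (\<forall>k\<ge>1. continuous_map X euclidean (\<lambda>x. h x k))"
proof -
  have "continuous_map X (product_topology (\<lambda>_. top_of_set S) {1..}) h \<longleftrightarrow>
        (\<forall>k\<ge>1. continuous_map X euclidean (\<lambda>x. h x k))"
    if "h ` topspace X \<subseteq> carrier (powlim (mult_on S))"
  proof -
    have "h x \<in> extensional {1..}" "\<And>k. k \<ge> 1 \<Longrightarrow> h x k \<in> S" if "x \<in> topspace X" for x
      using that \<open>h ` topspace X \<subseteq> _\<close> powlim_apply powlim_extensional by blast+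
    then show ?thesis
      unfolding continuous_map_componentwise continuous_map_in_subtopology
      by (auto simp: Pi_iff image_subset_iff)
  qed
  then show ?thesis
    unfolding topo_powlim continuous_map_in_subtopology by (auto simp: image_subset_iff Pi_iff)
qed

text \<open>Each coordinate is a root of the first one, so the coordinates vanish together.\<close>

lemma CC_Q_nonzero:
  assumes "x \<in> carrier CC_Q" "x \<noteq> zero_Q" "k \<ge> 1"
  shows "x k \<noteq> 0"
proof
  assume "x k = 0"
  then have "x 1 = 0" using powlim_root[OF assms(1,3), of 1] assms(3) by simp
  then have "x m = 0" if "m \<ge> 1" for m
    using powlim_root[OF assms(1) that, of 1] that by simp
  then have "x = zero_Q"
    unfolding zero_Q_def by (intro extensionalityI[OF powlim_extensional[OF assms(1)]]) auto
  with assms show False by simp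
qed

lemma group_with_zero_CC_Q: "group_with_zero CC_Q zero_Q"
proof -
  interpret comm_monoid CC_Q by (rule comm_monoid_powlim) auto
  show ?thesis
  proof
    show z: "zero_Q \<in> carrier CC_Q" by (rule powlimI) (auto simp: zero_Q_def)
    show "zero_Q \<otimes>\<^bsub>CC_Q\<^esub> x = zero_Q" for x
      by (auto simp: mult_powlim_mult_on zero_Q_def)
    show "\<one>\<^bsub>CC_Q\<^esub> \<noteq> zero_Q"
      by (auto simp: one_powlim_mult_on zero_Q_def fun_eq_iff)
    show "topspace (topo CC_Q) = carrier CC_Q" by (rule topspace_powlim)
    fix x assume x: "x \<in> carrier CC_Q" "x \<noteq> zero_Q"
    define y where "y = (\<lambda>k\<in>{1..}. inverse (x k))"
    have y: "y \<in> carrier CC_Q"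
    proof (rule powlimI)
      fix k m :: nat assume km: "k \<ge> 1" "m \<ge> 1"
      then have "k * m \<ge> 1" by (metis mult_le_mono nat_mult_1)
      then show "y m = y (k * m) ^ k"
        using powlim_root[OF x(1) km] km by (simp add: y_def power_inverse)
    qed (auto simp: y_def)
    have "x \<otimes>\<^bsub>CC_Q\<^esub> y = \<one>\<^bsub>CC_Q\<^esub>"
      using CC_Q_nonzero[OF x] by (auto simp: mult_powlim_mult_on one_powlim_mult_on y_def fun_eq_iff)
    moreover from this have "y \<otimes>\<^bsub>CC_Q\<^esub> x = \<one>\<^bsub>CC_Q\<^esub>" using m_comm[OF x(1) y] by simp
    ultimately show "x \<in> Units CC_Q" using x y unfolding Units_def by blast
  next
    have "carrier CC_Q - {zero_Q} = {x \<in> topspace (topo CC_Q). x 1 \<in> - {0}}"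
      using CC_Q_nonzero by (auto simp: topspace_powlim zero_Q_def)
    moreover have "continuous_map (topo CC_Q) euclidean (\<lambda>x. x 1)"
      using continuous_map_powlim[of "topo CC_Q" UNIV "\<lambda>x. x"] by auto
    ultimately show "openin (topo CC_Q) (carrier CC_Q - {zero_Q})"
      using openin_continuous_map_preimage[of "topo CC_Q" euclidean "\<lambda>x. x 1" "- {0}"] by auto
  qed
qed

lemma mult_CC_Q_apply: "k \<ge> 1 \<Longrightarrow> (x \<otimes>\<^bsub>CC_Q\<^esub> y) k = x k * y k"
  by (simp add: mult_powlim_mult_on)

lemma pow_CC_Q_apply: "k \<ge> 1 \<Longrightarrow> (x [^]\<^bsub>CC_Q\<^esub> (M::nat)) k = x k ^ M"
proof (induction M)
  case 0
  then show ?case by (simp add: nat_pow_def one_powlim_mult_on)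
next
  case (Suc M)
  have "x [^]\<^bsub>CC_Q\<^esub> Suc M = x [^]\<^bsub>CC_Q\<^esub> M \<otimes>\<^bsub>CC_Q\<^esub> x" by (simp add: nat_pow_def)
  then show ?case using Suc by (simp add: mult_CC_Q_apply mult.commute)
qed

text \<open>On another chart \<open>\<sigma>\<close>, where \<open>n\<close> exposes \<open>\<sigma> \<inter> \<tau>\<close>, the evaluation at \<open>u\<close> reads
\<open>f (u + M n) / f n ^ M\<close> on the open set where \<open>f n\<close> is nonzero. Continuity on every chart gives
continuity on the quotient because the chart neighbourhood is open.\<close>

lemma continuous_map_chart_eval:
  assumes "exposed_fan F" and \<tau>: "\<tau> \<in> F" and u: "u \<in> dual_sg \<tau>" and k: "k \<ge> 1"
  shows "continuous_map (subtopology (toric_variety_Q F) (chart_nbhd F CC_Q zero_Q \<tau>)) euclidean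
           (\<lambda>c. chart_eval \<tau> u c k)"
proof -
  interpret toric F CC_Q zero_Q
    using assms(1) group_with_zero_CC_Q by (simp add: toric_def)
  let ?N = "chart_nbhd F CC_Q zero_Q \<tau>"
  have "openin (toric_variety_Q F) {c \<in> ?N. chart_eval \<tau> u c k \<in> V}" if V: "open V" for V
    unfolding openin_toric_space
  proof (intro conjI ballI)
    show "{c \<in> ?N. chart_eval \<tau> u c k \<in> V} \<subseteq> topspace (toric_variety_Q F)"
      using chart_nbhd_subset by blast
    fix \<sigma> assume \<sigma>: "\<sigma> \<in> F"
    let ?H = "topo (hom_sg (dual_sg \<sigma>) CC_Q)"
    obtain n where n: "integrally_exposed (\<sigma> \<inter> \<tau>) \<sigma> n" "n \<in> dual_sg \<sigma>"
      using chart_exposed[OF \<sigma> \<tau>] by blast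
    have "u \<in> dual_sg (\<sigma> \<inter> \<tau>)" using u dual_sg_antimono[of "\<sigma> \<inter> \<tau>" \<tau>] by blast
    then obtain M :: nat where M: "u + real M *\<^sub>R n \<in> dual_sg \<sigma>"
      using dual_sg_localization[OF \<sigma> n(1)] by blast
    define U where "U = {f \<in> hom_sg_carrier (dual_sg \<sigma>) CC_Q. f n \<noteq> zero_Q}"
    have U: "openin ?H U" unfolding U_def by (rule openin_hom_nonzero[OF n(2)])
    have top: "topspace (subtopology ?H U) = U"
      using openin_subset[OF U] by auto
    have nz: "f n k \<noteq> 0" if "f \<in> U" for f
      using that n(2) k by (intro CC_Q_nonzero) (auto simp: U_def hom_sg_closed)
    have ev: "chart_eval \<tau> u (toric_class F CC_Q (\<sigma>, f)) k = f (u + real M *\<^sub>R n) k / f n k ^ M" if "f \<in> U" for f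
    proof -
      have f: "f \<in> hom_sg_carrier (dual_sg \<sigma>) CC_Q" "f n \<noteq> zero_Q" using that by (auto simp: U_def)
      have "f (u + real M *\<^sub>R n) k = chart_eval \<tau> u (toric_class F CC_Q (\<sigma>, f)) k * f n k ^ M"
        unfolding chart_eval_class(2)[OF \<sigma> \<tau> n(1) f u M] using k
        by (simp add: mult_CC_Q_apply pow_CC_Q_apply)
      then show ?thesis using nz[OF that] by simp
    qed
    have coord: "continuous_map (subtopology ?H U) euclidean (\<lambda>f. f w k)" if "w \<in> dual_sg \<sigma>" for w
      using continuous_hom_eval[OF that, of CC_Q] k unfolding continuous_map_powlim
      by (auto intro: continuous_map_from_subtopology)
    have "continuous_map (subtopology ?H U) euclidean (\<lambda>f. f (u + real M *\<^sub>R n) k / f n k ^ M)"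
      using nz coord[OF M] coord[OF n(2)]
      unfolding continuous_map_atin by (auto intro!: tendsto_intros simp: U_def)
    from openin_continuous_map_preimage[OF this, of V]
    have "openin (subtopology ?H U) {f \<in> U. f (u + real M *\<^sub>R n) k / f n k ^ M \<in> V}"
      using V by (simp only: top open_openin)
    then have op: "openin ?H {f \<in> U. f (u + real M *\<^sub>R n) k / f n k ^ M \<in> V}"
      using U openin_trans_full by blast
    have "{f \<in> hom_sg_carrier (dual_sg \<sigma>) CC_Q. toric_class F CC_Q (\<sigma>, f) \<in> {c \<in> ?N. chart_eval \<tau> u c k \<in> V}}
      = {f \<in> U. f (u + real M *\<^sub>R n) k / f n k ^ M \<in> V}"
      using class_in_chart_iff[OF \<sigma> \<tau> n(1)] ev by (auto simp: U_def)
    then show "openin ?H {f \<in> hom_sg_carrier (dual_sg \<sigma>) CC_Q.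
        toric_class F CC_Q (\<sigma>, f) \<in> {c \<in> ?N. chart_eval \<tau> u c k \<in> V}}"
      using op by simp
  qed
  then have "openin (subtopology (toric_variety_Q F) ?N) {c \<in> ?N. chart_eval \<tau> u c k \<in> V}" if "open V" for V
    using that openin_chart_nbhd[OF \<tau>] by (simp add: openin_open_subtopology)
  moreover have "topspace (subtopology (toric_variety_Q F) ?N) = ?N"
    using chart_nbhd_subset by auto
  ultimately show ?thesis unfolding continuous_map_def by simp
qed


section \<open>Extending characters of lattices\<close>

definition subgroup_character :: "'b::real_vector set \<Rightarrow> ('b \<Rightarrow> complex) \<Rightarrow> bool" where
  "subgroup_character M \<xi> \<longleftrightarrow> 0 \<in> M \<and> (\<forall>u\<in>M. \<forall>v\<in>M. u + v \<in> M) \<and> (\<forall>u\<in>M. - u \<in> M) \<and>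
     (\<forall>u\<in>M. \<forall>v\<in>M. \<xi> (u + v) = \<xi> u * \<xi> v) \<and> (\<forall>u\<in>M. \<xi> u \<noteq> 0)"

lemma subgroup_character_scale:
  assumes "subgroup_character M \<xi>" "u \<in> M"
  shows "of_int j *\<^sub>R u \<in> M \<and> \<xi> (of_int j *\<^sub>R u) = \<xi> u powi j"
proof -
  note M = assms(1)[unfolded subgroup_character_def]
  have "\<xi> (0 + 0) = \<xi> 0 * \<xi> 0" "\<xi> 0 \<noteq> 0" using M by blast+
  then have \<xi>0: "\<xi> 0 = 1" by simp
  have nat: "real k *\<^sub>R u \<in> M \<and> \<xi> (real k *\<^sub>R u) = \<xi> u ^ k" for k
  proof (induction k)
    case (Suc k)
    have "real (Suc k) *\<^sub>R u = u + real k *\<^sub>R u" by (simp add: scaleR_left_distrib)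
    then show ?case using Suc M assms(2) by simp
  qed (use M \<xi>0 in simp)
  show ?thesis
  proof (cases "j \<ge> 0")
    case True
    then show ?thesis using nat[of "nat j"] by (simp add: power_int_def)
  next
    case False
    define w where "w = real (nat (- j)) *\<^sub>R u"
    have w: "w \<in> M" "\<xi> w = \<xi> u ^ nat (- j)" unfolding w_def using nat by blast+
    have j: "of_int j *\<^sub>R u = - w" using False by (simp add: w_def)
    have "\<xi> (w + - w) = \<xi> w * \<xi> (- w)" using M w by blast
    then have "\<xi> w * \<xi> (- w) = 1" using \<xi>0 by simp
    then have "\<xi> (- w) = inverse (\<xi> w)" using inverse_unique by metis
    then show ?thesis using w M False unfolding j by (simp add: power_int_def power_inverse)
  qed
qed

text \<open>The multiples of \<open>e\<close> that lie in \<open>M\<close> are the multiples of some \<open>n e\<close>. Sending \<open>e\<close> to an \<open>n\<close>-th root \<open>w\<close> of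
the value at \<open>n e\<close>, or to \<open>1\<close> if no positive multiple lies in \<open>M\<close>, is consistent with the given
character.\<close>

lemma character_extend_one:
  assumes "subgroup_character M \<xi>"
  obtains N \<xi>' where "subgroup_character N \<xi>'" "M \<subseteq> N" "e \<in> N" "\<And>u. u \<in> M \<Longrightarrow> \<xi>' u = \<xi> u"
proof -
  note M = assms[unfolded subgroup_character_def]
  note sc = subgroup_character_scale[OF assms]
  have "\<xi> (0 + 0) = \<xi> 0 * \<xi> 0" "\<xi> 0 \<noteq> 0" using M by blast+
  then have \<xi>0: "\<xi> 0 = 1" by simp
  define J where "J = {j::int. of_int j *\<^sub>R e \<in> M}"
  have J_diff: "i - j \<in> J" if "i \<in> J" "j \<in> J" for i j
  proof -
    have "of_int i *\<^sub>R e + - (of_int j *\<^sub>R e) \<in> M" using that M unfolding J_def by blast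
    then show ?thesis by (simp add: J_def scaleR_left_diff_distrib)
  qed
  have J_mult: "q * j \<in> J" if "j \<in> J" for q j
    using sc[of "of_int j *\<^sub>R e" q] that by (simp add: J_def)
  obtain w where w: "w \<noteq> 0" "\<And>j. j \<in> J \<Longrightarrow> \<xi> (of_int j *\<^sub>R e) = w powi j"
  proof (cases "\<exists>d>0. d \<in> J")
    case False
    have "j = 0" if "j \<in> J" for j
      using False J_mult[OF that, of "-1"] that by (metis linorder_neqE_linordered_idom mult_minus1 neg_0_less_iff_less)
    then have "\<xi> (of_int j *\<^sub>R e) = 1 powi j" if "j \<in> J" for j using that \<xi>0 by force
    then show ?thesis using that[of 1] by simp
  next
    case True
    \<comment> \<open>Euclidean division shows that the least positive element generates \<open>J\<close>.\<close>
    define n where "n = (LEAST n::nat. n > 0 \<and> int n \<in> J)"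
    have "\<exists>n::nat. n > 0 \<and> int n \<in> J"
      using True by (metis zero_less_imp_eq_int of_nat_0_less_iff)
    then have n: "n > 0" "int n \<in> J" and least: "\<And>m::nat. m > 0 \<Longrightarrow> int m \<in> J \<Longrightarrow> n \<le> m"
      unfolding n_def using LeastI_ex[of "\<lambda>n. n > 0 \<and> int n \<in> J"] by (auto intro: Least_le)
    have dvd: "int n dvd j" if "j \<in> J" for j
    proof -
      have "j mod int n \<in> J"
        using J_diff[OF that J_mult[OF n(2), of "j div int n"]] by (simp add: minus_div_mult_eq_mod)
      moreover have "0 \<le> j mod int n" "j mod int n < int n" using n by auto
      ultimately have "j mod int n = 0"
        using least[of "nat (j mod int n)"] by (cases "j mod int n = 0") auto
      then show ?thesis by auto
    qed
    define c where "c = \<xi> (of_int (int n) *\<^sub>R e)"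
    have inM: "of_int (int n) *\<^sub>R e \<in> M" using n(2) by (simp add: J_def)
    have "c \<noteq> 0" unfolding c_def using M inM by blast
    obtain w where w: "c = w ^ n" using exists_complex_root[of n c] n(1) by auto
    have w0: "w \<noteq> 0" using w \<open>c \<noteq> 0\<close> n(1) by auto
    show ?thesis
    proof (rule that[OF w0])
      fix j assume "j \<in> J"
      then obtain q where q: "j = int n * q" using dvd by (auto elim: dvdE)
      have "of_int j *\<^sub>R e = of_int q *\<^sub>R (of_int (int n) *\<^sub>R e)" by (simp add: q mult.commute)
      then have "\<xi> (of_int j *\<^sub>R e) = c powi q" using sc[OF inM, of q] unfolding c_def by metis
      also have "\<dots> = w powi j" by (simp add: q w power_int_mult)
      finally show "\<xi> (of_int j *\<^sub>R e) = w powi j" .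
    qed
  qed
  have well: "\<xi> m * w powi j = \<xi> m' * w powi j'"
    if "m \<in> M" "m' \<in> M" "m + of_int j *\<^sub>R e = m' + of_int j' *\<^sub>R e" for m m' j j'
  proof -
    have d: "of_int (j' - j) *\<^sub>R e = m + - m'"
      using that(3) by (simp add: scaleR_left_diff_distrib algebra_simps)
    have "m + - m' \<in> M" using that(1,2) M by blast
    then have "j' - j \<in> J" unfolding J_def d[symmetric] by simp
    then have "\<xi> (of_int (j' - j) *\<^sub>R e) = w powi (j' - j)" by (rule w(2))
    moreover have "\<xi> (m' + of_int (j' - j) *\<^sub>R e) = \<xi> m' * \<xi> (of_int (j' - j) *\<^sub>R e)"
      using M that \<open>j' - j \<in> J\<close> unfolding J_def by blast
    moreover have "m' + of_int (j' - j) *\<^sub>R e = m" unfolding d by simp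
    ultimately have "\<xi> m = \<xi> m' * w powi (j' - j)" by simp
    then show ?thesis using w(1) by (simp add: power_int_diff)
  qed
  define N where "N = {m + of_int j *\<^sub>R e | m j. m \<in> M}"
  define \<xi>' where "\<xi>' x = (SOME y. \<exists>m j. m \<in> M \<and> x = m + of_int j *\<^sub>R e \<and> y = \<xi> m * w powi j)" for x
  have \<xi>': "\<xi>' (m + of_int j *\<^sub>R e) = \<xi> m * w powi j" if "m \<in> M" for m j
  proof -
    have "\<exists>m' j'. m' \<in> M \<and> m + of_int j *\<^sub>R e = m' + of_int j' *\<^sub>R e \<and>
        \<xi>' (m + of_int j *\<^sub>R e) = \<xi> m' * w powi j'"
      unfolding \<xi>'_def by (rule someI_ex) (use that in blast)
    then show ?thesis using well that by metis
  qed
  have comb: "(m + of_int j *\<^sub>R e) + (m' + of_int j' *\<^sub>R e) = (m + m') + of_int (j + j') *\<^sub>R e" for m m' j j'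
    by (simp add: scaleR_left_distrib)
  have N_add: "u + v \<in> N \<and> \<xi>' (u + v) = \<xi>' u * \<xi>' v" if "u \<in> N" "v \<in> N" for u v
  proof -
    note uv = that
    obtain m j m' j' where u: "u = m + of_int j *\<^sub>R e" "m \<in> M" and v: "v = m' + of_int j' *\<^sub>R e" "m' \<in> M"
      using uv unfolding N_def by blast
    have mm: "m + m' \<in> M" "\<xi> (m + m') = \<xi> m * \<xi> m'" using M u v by blast+
    have "u + v \<in> N" unfolding u(1) v(1) comb N_def using mm by blast
    moreover have "\<xi>' (u + v) = \<xi> (m + m') * w powi (j + j')"
      unfolding u(1) v(1) comb by (rule \<xi>'[OF mm(1)])
    ultimately show ?thesis using mm u v \<xi>' w(1) by (simp add: power_int_add)
  qed
  have N_minus: "- u \<in> N" if u: "u \<in> N" for u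
  proof -
    obtain m j where "u = m + of_int j *\<^sub>R e" "m \<in> M" using u by (auto simp: N_def)
    then have "- u = - m + of_int (- j) *\<^sub>R e" "- m \<in> M" using M by auto
    then show ?thesis unfolding N_def by blast
  qed
  have MN: "m \<in> N" "\<xi>' m = \<xi> m" if "m \<in> M" for m
  proof -
    have "m = m + of_int 0 *\<^sub>R e" by simp
    then show "m \<in> N" unfolding N_def using that by blast
    show "\<xi>' m = \<xi> m" using \<xi>'[OF that, of 0] by simp
  qed
  have "\<xi>' u \<noteq> 0" if "u \<in> N" for u
    using that \<xi>' w(1) M by (auto simp: N_def power_int_eq_0_iff)
  then have "subgroup_character N \<xi>'"
    unfolding subgroup_character_def using N_add N_minus MN M by blast
  moreover have "0 + of_int 1 *\<^sub>R e \<in> N" unfolding N_def using M by blast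
  ultimately show ?thesis using that MN by auto
qed

lemma character_extend_finite:
  assumes "finite S" "subgroup_character M \<xi>"
  obtains N \<xi>' where "subgroup_character N \<xi>'" "M \<subseteq> N" "S \<subseteq> N" "\<And>u. u \<in> M \<Longrightarrow> \<xi>' u = \<xi> u"
  using assms(1)
proof (induction S arbitrary: thesis rule: finite_induct)
  case empty
  then show ?case using assms(2) by blast
next
  case (insert e S)
  obtain N \<xi>' where N: "subgroup_character N \<xi>'" "M \<subseteq> N" "S \<subseteq> N" "\<And>u. u \<in> M \<Longrightarrow> \<xi>' u = \<xi> u"
    using insert.IH by metis
  obtain N2 \<xi>2 where "subgroup_character N2 \<xi>2" "N \<subseteq> N2" "e \<in> N2" "\<And>u. u \<in> N \<Longrightarrow> \<xi>2 u = \<xi>' u"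
    using character_extend_one[OF N(1), of e] by metis
  then show ?case using N by (intro insert.prems[of N2 \<xi>2]) auto
qed

text \<open>Adjoining the standard basis vectors one after the other reaches all of \<open>\<int>\<^sup>n\<close>. The torus \<open>CC_star\<close>
acts transitively on its orbits for this reason.\<close>

lemma character_extension:
  fixes M :: "(real^'n) set"
  assumes "subgroup_character M \<xi>"
  obtains t where "t \<in> hom_sg_carrier int_vecs CC_star" "\<And>u. u \<in> M \<Longrightarrow> u \<in> int_vecs \<Longrightarrow> t u = \<xi> u"
proof -
  obtain N \<xi>' where N: "subgroup_character N \<xi>'" "M \<subseteq> N" "range (\<lambda>i. axis i 1 :: real^'n) \<subseteq> N"
      "\<And>u. u \<in> M \<Longrightarrow> \<xi>' u = \<xi> u"
    using character_extend_finite[OF _ assms, of "range (\<lambda>i. axis i 1)"] by auto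
  note S = N(1)[unfolded subgroup_character_def]
  have int: "int_vecs \<subseteq> N"
  proof
    fix u :: "real^'n" assume u: "u \<in> int_vecs"
    have term_in: "u $ i *\<^sub>R axis i 1 \<in> N" for i
    proof -
      obtain j where "u $ i = of_int j" using u by (auto simp: int_vecs_def elim: Ints_cases)
      then show ?thesis using subgroup_character_scale[OF N(1), of "axis i 1" j] N(3) by auto
    qed
    have "(\<Sum>i\<in>I. u $ i *\<^sub>R axis i 1) \<in> N" if "finite I" for I
      using that by (induction I rule: finite_induct) (use S term_in in auto)
    from this[of UNIV] show "u \<in> N"
      using basis_expansion[of u] by (simp add: scalar_mult_eq_scaleR)
  qed
  have "\<xi>' (0 + 0) = \<xi>' 0 * \<xi>' 0" "\<xi>' 0 \<noteq> 0" using S by blast+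
  then have \<xi>0: "\<xi>' 0 = 1" by simp
  have "restrict \<xi>' int_vecs \<in> hom_sg_carrier int_vecs CC_star"
    using \<xi>0 S int by (auto simp: hom_sg_carrier_def mult_on_def int_vecs_add subset_iff)
  then show ?thesis using that N(2,4) by auto
qed


section \<open>Orbits and invariant divisors\<close>

context toric begin

text \<open>The special point of the chart of \<open>\<sigma>\<close>.\<close>

definition indicator_hom :: "(real^'n) set \<Rightarrow> real^'n \<Rightarrow> 'a" where
  "indicator_hom \<sigma> = (\<lambda>u\<in>dual_sg \<sigma>. if u \<in> perp \<sigma> then \<one> else z)"

lemma reduced_indicator_hom: "reduced A z \<sigma> (indicator_hom \<sigma>)"
  unfolding reduced_def hom_sg_carrier_def indicator_hom_def
  by (auto simp: perp_add_iff dual_sg_add zero_closed zero_mult mult_zero one_not_zero)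

end

text \<open>The sum of the generators of the cone is a point of its relative interior, where a
functional that is nonnegative on the cone vanishes only if it vanishes everywhere.\<close>

lemma cone_interior_functional:
  assumes "exposed_fan F" "\<tau> \<in> F"
  obtains y where "\<And>u. u \<in> dual_sg \<tau> \<Longrightarrow> 0 \<le> u \<bullet> y" "\<And>u. u \<in> dual_sg \<tau> \<Longrightarrow> u \<bullet> y = 0 \<Longrightarrow> u \<in> perp \<tau>"
proof -
  interpret exposed_fan F by fact
  obtain Y where Y: "finite Y" "Y \<subseteq> \<tau>" "\<And>u. \<forall>y\<in>Y. 0 \<le> u \<bullet> y \<Longrightarrow> \<forall>v\<in>\<tau>. 0 \<le> u \<bullet> v"
    using cone_generators[OF assms(2)] by metis
  have nonneg: "0 \<le> u \<bullet> y" if "u \<in> dual_sg \<tau>" "y \<in> Y" for u y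
    using that Y by (auto simp: dual_sg_def)
  show ?thesis
  proof (rule that[of "\<Sum>Y"])
    fix u assume u: "u \<in> dual_sg \<tau>"
    show "0 \<le> u \<bullet> \<Sum>Y" using nonneg[OF u] by (simp add: inner_sum_right sum_nonneg)
    assume "u \<bullet> \<Sum>Y = 0"
    then have "\<forall>y\<in>Y. u \<bullet> y = 0"
      using nonneg[OF u] Y(1) by (simp add: inner_sum_right sum_nonneg_eq_0_iff)
    then have "\<forall>v\<in>\<tau>. 0 \<le> (- u) \<bullet> v" by (intro Y(3)) auto
    then show "u \<in> perp \<tau>" using u by (force simp: perp_def dual_sg_def)
  qed
qed

lemma hom_CC_star_subset: "hom_sg_carrier S CC_star \<subseteq> hom_sg_carrier S CC"
  by (auto simp: hom_sg_carrier_def mult_on_def)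

text \<open>A reduced morphism on \<open>\<sigma>\<close> is a character of \<open>\<sigma>\<^sup>\<bottom> \<inter> \<int>\<^sup>n\<close>. Extended to \<open>\<int>\<^sup>n\<close>, it becomes a torus element
that moves the special point to the given one.\<close>

lemma torus_orbit_eq:
  assumes "exposed_fan F" and \<sigma>: "\<sigma> \<in> F"
  shows "torus_orbit F \<sigma> = {toric_class F CC (\<sigma>, g) | g. reduced CC 0 \<sigma> g}"
    and "special_point F \<sigma> = toric_class F CC (\<sigma>, toric.indicator_hom CC 0 \<sigma>)"
    and "reduced CC 0 \<sigma> g \<Longrightarrow> \<exists>t \<in> hom_sg_carrier int_vecs CC_star. g = (\<lambda>u\<in>dual_sg \<sigma>. t u * toric.indicator_hom CC 0 \<sigma> u)"
proof -
  interpret toric F CC 0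
    using assms(1) group_with_zero_CC by (simp add: toric_def)
  let ?i = "indicator_hom \<sigma>"
  show sp: "special_point F \<sigma> = toric_class F CC (\<sigma>, ?i)"
    unfolding special_point_def indicator_hom_def perp_def one_mult_on mem_Collect_eq ..
  have ex: "\<exists>t \<in> hom_sg_carrier int_vecs CC_star. g = (\<lambda>u\<in>dual_sg \<sigma>. t u * ?i u)"
    if g: "reduced CC 0 \<sigma> g" for g
  proof -
    note hg = reduced_hom[OF g]
    have d: "u \<in> dual_sg \<sigma>" if "u \<in> int_vecs \<inter> perp \<sigma>" for u using that perp_dual_sg by blast
    have "subgroup_character (int_vecs \<inter> perp \<sigma>) g"
      unfolding subgroup_character_def
    proof (intro conjI ballI)
      fix u v assume u: "u \<in> int_vecs \<inter> perp \<sigma>" and v: "v \<in> int_vecs \<inter> perp \<sigma>"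
      show "u + v \<in> int_vecs \<inter> perp \<sigma>" using u v subspace_add[OF subspace_perp] int_vecs_add by blast
      show "g (u + v) = g u * g v" using hom_sg_add[OF hg d[OF u] d[OF v]] by (simp add: mult_on_def)
    next
      fix u assume u: "u \<in> int_vecs \<inter> perp \<sigma>"
      show "- u \<in> int_vecs \<inter> perp \<sigma>" using u subspace_neg[OF subspace_perp] int_vecs_uminus by blast
      show "g u \<noteq> 0" using reduced_nonzero_iff[OF g d[OF u]] u by blast
    qed simp
    then obtain t where t: "t \<in> hom_sg_carrier int_vecs CC_star"
        "\<And>u. u \<in> int_vecs \<inter> perp \<sigma> \<Longrightarrow> u \<in> int_vecs \<Longrightarrow> t u = g u"
      using character_extension by metis
    have "g u = (\<lambda>u\<in>dual_sg \<sigma>. t u * ?i u) u" for u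
    proof (cases "u \<in> dual_sg \<sigma>")
      case True
      then have "u \<in> int_vecs" by (simp add: dual_sg_def)
      then show ?thesis using True t(2) reduced_nonzero_iff[OF g True]
        by (auto simp: indicator_hom_def one_mult_on mult_mult_on)
    next
      case False
      then show ?thesis using fun_cong[OF hom_sg_ext[OF hg], of u] by simp
    qed
    then show ?thesis using t(1) by blast
  qed
  then show "reduced CC 0 \<sigma> g \<Longrightarrow> \<exists>t \<in> hom_sg_carrier int_vecs CC_star. g = (\<lambda>u\<in>dual_sg \<sigma>. t u * ?i u)"
    by blast
  have act: "torus_action F CC t (special_point F \<sigma>) = toric_class F CC (\<sigma>, \<lambda>u\<in>dual_sg \<sigma>. t u * ?i u)"
    "reduced CC 0 \<sigma> (\<lambda>u\<in>dual_sg \<sigma>. t u * ?i u)"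
    if "t \<in> hom_sg_carrier int_vecs CC_star" for t
  proof -
    have t: "t \<in> hom_sg_carrier int_vecs CC" using that hom_CC_star_subset by blast
    have m: "(*) = monoid.mult CC" by (simp add: mult_on_def)
    show "torus_action F CC t (special_point F \<sigma>) = toric_class F CC (\<sigma>, \<lambda>u\<in>dual_sg \<sigma>. t u * ?i u)"
      unfolding sp m by (rule torus_action_reduced[OF \<sigma> reduced_indicator_hom t])
    show "reduced CC 0 \<sigma> (\<lambda>u\<in>dual_sg \<sigma>. t u * ?i u)"
      unfolding m by (rule reduced_mult[OF reduced_indicator_hom t])
  qed
  show "torus_orbit F \<sigma> = {toric_class F CC (\<sigma>, g) | g. reduced CC 0 \<sigma> g}"
    unfolding torus_orbit_def hom_sg_def using act ex by fastforce
qed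

text \<open>The orbits of cones that do not contain \<open>\<rho>\<close> fill a union of charts, hence an open set, so the
closure contains nothing else. Conversely let \<open>t\<close> carry the special point of \<open>\<tau>\<close> to the given point and
let \<open>y\<close> be interior to \<open>\<tau>\<close>. The torus elements \<open>u \<mapsto> t u exp (- k (u \<bullet> y))\<close> carry the special point of
\<open>\<rho>\<close> to points that converge to the given one as \<open>k\<close> grows: the factor is \<open>1\<close> on \<open>\<tau>\<^sup>\<bottom>\<close> and tends to \<open>0\<close>
on the rest of \<open>dual_sg \<tau>\<close>.\<close>

lemma invariant_divisor_eq:
  assumes "exposed_fan F" and \<rho>: "\<rho> \<in> F"
  shows "invariant_divisor F \<rho> = {toric_class F CC (\<tau>, g) | \<tau> g. \<tau> \<in> F \<and> \<rho> \<subseteq> \<tau> \<and> reduced CC 0 \<tau> g}"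
    (is "_ = ?D")
proof
  interpret toric F CC 0
    using assms(1) group_with_zero_CC by (simp add: toric_def)
  have orb: "torus_orbit F \<rho> \<subseteq> ?D" using torus_orbit_eq(1)[OF assms] \<rho> by blast
  have "topspace (toric_variety F) - ?D = (\<Union>\<tau>\<in>{\<tau>\<in>F. \<not> \<rho> \<subseteq> \<tau>}. chart_nbhd F CC 0 \<tau>)" (is "_ = ?U")
  proof (intro equalityI subsetI)
    fix c assume "c \<in> topspace (toric_variety F) - ?D"
    then obtain \<tau> g where "c = toric_class F CC (\<tau>, g)" "\<tau> \<in> F" "reduced CC 0 \<tau> g" "\<not> \<rho> \<subseteq> \<tau>"
      unfolding topspace_toric_space by blast
    then show "c \<in> ?U" unfolding chart_nbhd_def by blast
  next
    fix c assume "c \<in> ?U"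
    then obtain \<tau>' \<tau> g where "c = toric_class F CC (\<tau>, g)" "\<tau> \<in> F" "reduced CC 0 \<tau> g" "\<tau> \<subseteq> \<tau>'" "\<not> \<rho> \<subseteq> \<tau>'"
      unfolding chart_nbhd_def by blast
    then show "c \<in> topspace (toric_variety F) - ?D"
      using toric_class_inj unfolding topspace_toric_space by blast
  qed
  moreover have "openin (toric_variety F) ?U"
    by (intro openin_Union) (use openin_chart_nbhd in auto)
  moreover have "?D \<subseteq> topspace (toric_variety F)" unfolding topspace_toric_space by blast
  ultimately have "closedin (toric_variety F) ?D" by (simp add: closedin_def)
  then show "invariant_divisor F \<rho> \<subseteq> ?D"
    unfolding invariant_divisor_def using orb by (rule closure_of_minimal[rotated])
  show "?D \<subseteq> invariant_divisor F \<rho>"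
  proof
    fix c assume "c \<in> ?D"
    then obtain \<tau> g where c: "c = toric_class F CC (\<tau>, g)" and \<tau>: "\<tau> \<in> F" "\<rho> \<subseteq> \<tau>" and g: "reduced CC 0 \<tau> g"
      by blast
    obtain t where t: "t \<in> hom_sg_carrier int_vecs CC_star" "g = (\<lambda>u\<in>dual_sg \<tau>. t u * indicator_hom \<tau> u)"
      using torus_orbit_eq(3)[OF assms(1) \<tau>(1) g] by blast
    obtain y where y: "\<And>u. u \<in> dual_sg \<tau> \<Longrightarrow> 0 \<le> u \<bullet> y" "\<And>u. u \<in> dual_sg \<tau> \<Longrightarrow> u \<bullet> y = 0 \<Longrightarrow> u \<in> perp \<tau>"
      using cone_interior_functional[OF assms(1) \<tau>(1)] by blast
    define s where "s k = (\<lambda>u\<in>int_vecs. t u * of_real (exp (- (real k * (u \<bullet> y)))))" for k :: nat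
    have s: "s k \<in> hom_sg_carrier int_vecs CC" for k
    proof -
      have "complex_of_real (exp (- (real k * ((u + v) \<bullet> y)))) =
          of_real (exp (- (real k * (u \<bullet> y)))) * of_real (exp (- (real k * (v \<bullet> y))))" for u v
        by (simp add: inner_add_left distrib_left flip: of_real_mult exp_add)
      then show ?thesis using t(1) unfolding s_def hom_sg_carrier_def
        by (auto simp: mult_on_def int_vecs_add)
    qed
    define g' where "g' k = (\<lambda>u\<in>dual_sg \<rho>. s k u \<otimes>\<^bsub>CC\<^esub> indicator_hom \<rho> u)" for k
    have g': "reduced CC 0 \<rho> (g' k)" for k
      unfolding g'_def by (rule reduced_mult[OF reduced_indicator_hom s])
    have cl: "toric_class F CC (\<tau>, restrict (g' k) (dual_sg \<tau>)) \<in> torus_orbit F \<rho>" for k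
      unfolding torus_orbit_eq(1)[OF assms] using toric_class_restrict[OF \<rho> \<tau> g'] g' by blast
    let ?H = "topo (hom_sg (dual_sg \<tau>) CC)"
    have H: "?H = subtopology (product_topology (\<lambda>_. euclidean) (dual_sg \<tau>)) (hom_sg_carrier (dual_sg \<tau>) CC)"
      by (simp add: hom_sg_def mult_on_def)
    have lim_u: "((\<lambda>k. restrict (g' k) (dual_sg \<tau>) u) \<longlongrightarrow> g u) sequentially" if u: "u \<in> dual_sg \<tau>" for u
    proof -
      have u': "u \<in> dual_sg \<rho>" "u \<in> int_vecs"
        using u dual_sg_antimono[OF \<tau>(2)] by (auto simp: dual_sg_def)
      have eq: "restrict (g' k) (dual_sg \<tau>) u = t u * of_real (exp (- (real k * (u \<bullet> y)))) * (if u \<in> perp \<rho> then 1 else 0)" for k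
        using u u' by (simp add: g'_def s_def indicator_hom_def one_mult_on mult_mult_on)
      have gu: "g u = t u * (if u \<in> perp \<tau> then 1 else 0)"
        using u t(2) by (simp add: indicator_hom_def one_mult_on mult_mult_on)
      show ?thesis
      proof (cases "u \<in> perp \<tau>")
        case True
        then have "u \<in> perp \<rho>" using perp_antimono[OF \<tau>(2)] by blast
        have "u \<bullet> y = 0"
        proof -
          have "- u \<in> dual_sg \<tau>" using True u by (simp add: perp_def dual_sg_def int_vecs_uminus)
          then show ?thesis using y(1)[OF u] y(1)[of "- u"] by simp
        qed
        then show ?thesis unfolding eq gu using True \<open>u \<in> perp \<rho>\<close> by simp
      next
        case False
        then have "u \<bullet> y > 0" using y(1)[OF u] y(2)[OF u] by fastforce
        then have "(\<lambda>k. exp (- (real k * (u \<bullet> y)))) \<longlonglongrightarrow> 0" by real_asymp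
        then have "(\<lambda>k. t u * of_real (exp (- (real k * (u \<bullet> y)))) * (if u \<in> perp \<rho> then 1 else 0))
            \<longlonglongrightarrow> t u * of_real 0 * (if u \<in> perp \<rho> then 1 else 0)"
          by (intro tendsto_intros)
        then show ?thesis unfolding eq gu using False by simp
      qed
    qed
    have hr: "restrict (g' k) (dual_sg \<tau>) \<in> hom_sg_carrier (dual_sg \<tau>) CC" for k
      by (rule hom_dual_sg_restrict[OF reduced_hom[OF g'] \<tau>(2)])
    have lim: "limitin ?H (\<lambda>k. restrict (g' k) (dual_sg \<tau>)) g sequentially"
      unfolding H limitin_subtopology limitin_componentwise
      using lim_u hr reduced_hom[OF g] by (auto simp: hom_sg_carrier_def PiE_def)
    show "c \<in> invariant_divisor F \<rho>"
      unfolding invariant_divisor_def in_closure_of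
    proof (intro conjI allI impI)
      show "c \<in> topspace (toric_variety F)" using c \<tau> g unfolding topspace_toric_space by blast
      fix T assume T: "c \<in> T \<and> openin (toric_variety F) T"
      then have "openin ?H {f \<in> hom_sg_carrier (dual_sg \<tau>) CC. toric_class F CC (\<tau>, f) \<in> T}"
        using \<tau>(1) unfolding openin_toric_space by blast
      moreover have "g \<in> {f \<in> hom_sg_carrier (dual_sg \<tau>) CC. toric_class F CC (\<tau>, f) \<in> T}"
        using T c reduced_hom[OF g] by blast
      ultimately have "\<forall>\<^sub>F k in sequentially. restrict (g' k) (dual_sg \<tau>) \<in>
          {f \<in> hom_sg_carrier (dual_sg \<tau>) CC. toric_class F CC (\<tau>, f) \<in> T}"
        using lim unfolding limitin_def by blast
      then obtain k where "toric_class F CC (\<tau>, restrict (g' k) (dual_sg \<tau>)) \<in> T"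
        unfolding eventually_sequentially by blast
      then show "\<exists>y. y \<in> torus_orbit F \<rho> \<and> y \<in> T" using cl by blast
    qed
  qed
qed


section \<open>Integral dual bases\<close>

lemma det_Ints: "(\<And>i j. A $ i $ j \<in> \<int>) \<Longrightarrow> det (A :: real^'n^'n) \<in> \<int>"
  unfolding det_def by (intro Ints_sum Ints_mult Ints_prod) (auto simp: sign_def)

lemma Basis_int_vecs: "Basis \<subseteq> (int_vecs :: (real^'n) set)"
  by (auto simp: Basis_vec_def int_vecs_def axis_def)

text \<open>By Cramer's rule the inverse of the integer matrix with rows \<open>B\<close> is an integer matrix divided by the
determinant; its columns, scaled by the determinant, form the dual basis.\<close>

lemma full_integral_dual_basis:
  fixes B :: "(real^'n) set"
  assumes B: "B \<subseteq> int_vecs" "independent B" "card B = CARD('n)"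
  obtains d :: real and y where "d \<in> \<int>" "d \<noteq> 0" "\<And>b. b \<in> B \<Longrightarrow> y b \<in> int_vecs"
    "\<And>b c. b \<in> B \<Longrightarrow> c \<in> B \<Longrightarrow> y b \<bullet> c = (if b = c then d else 0)"
proof -
  have fin: "finite B" using B(2) by (rule independent_imp_finite)
  then obtain e :: "'n \<Rightarrow> real^'n" where e: "bij_betw e UNIV B"
    using B(3) finite_same_card_bij[of "UNIV :: 'n set" B] by auto
  define A :: "real^'n^'n" where "A = (\<chi> i. e i)"
  have "c i = 0" if c: "(\<Sum>i\<in>UNIV. c i *s row i A) = 0" for c i
  proof -
    define c' where "c' b = c (inv_into UNIV e b)" for b
    have c': "c' (e i) = c i" for i
      using e by (simp add: c'_def bij_betw_def inv_into_f_f)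
    have "(\<Sum>b\<in>B. c' b *\<^sub>R b) = (\<Sum>i\<in>UNIV. c' (e i) *\<^sub>R e i)"
      by (rule sum.reindex_bij_betw[OF e, symmetric])
    also have "\<dots> = 0" using c by (simp add: c' A_def row_def scalar_mult_eq_scaleR)
    finally have "(\<Sum>b\<in>B. c' b *\<^sub>R b) = 0" .
    then have "c' b = 0" if "b \<in> B" for b
      using independentD[OF B(2) fin order_refl] that by blast
    then show "c i = 0" using c'[of i] e by (metis bij_betw_apply UNIV_I)
  qed
  then have "\<exists>A'. A ** A' = mat 1"
    unfolding matrix_right_invertible_independent_rows by blast
  then have det: "det A \<noteq> 0" by (metis invertible_def invertible_det_nz matrix_left_right_inverse)
  have Aint: "A $ i $ j \<in> \<int>" for i j
    using B(1) bij_betw_apply[OF e, of i] by (auto simp: A_def int_vecs_def)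
  define x where "x i = (\<chi> k. det (\<chi> a b. if b = k then axis i 1 $ a else A $ a $ b))" for i
  have xint: "x i \<in> int_vecs" for i
    unfolding int_vecs_def x_def using Aint by (auto intro!: det_Ints simp: axis_def)
  have dual: "x i \<bullet> e j = (if i = j then det A else 0)" for i j
  proof -
    have "A *v (\<chi> k. x i $ k / det A) = axis i 1"
      unfolding cramer[OF det] by (simp add: x_def)
    then have "(A *v (\<chi> k. x i $ k / det A)) $ j = axis i 1 $ j" by simp
    then have "(\<Sum>k\<in>UNIV. e j $ k * x i $ k) / det A = (if i = j then 1 else 0)"
      by (simp add: matrix_vector_mult_def A_def axis_def sum_divide_distrib)
    moreover have "x i \<bullet> e j = (\<Sum>k\<in>UNIV. e j $ k * x i $ k)"
      by (simp add: inner_vec_def mult.commute)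
    ultimately show ?thesis using det by (simp add: field_simps split: if_splits)
  qed
  show ?thesis
  proof
    show "det A \<in> \<int>" using Aint by (rule det_Ints)
    show "det A \<noteq> 0" by (rule det)
    show "x (inv_into UNIV e b) \<in> int_vecs" for b by (rule xint)
    fix b c assume "b \<in> B" "c \<in> B"
    then obtain i j where "b = e i" "c = e j" using e unfolding bij_betw_def by blast
    moreover have "inj e" using e by (simp add: bij_betw_def)
    ultimately show "x (inv_into UNIV e b) \<bullet> c = (if b = c then det A else 0)"
      using dual by (simp add: inv_into_f_f inj_eq)
  qed
qed

text \<open>Complete \<open>E\<close> to a basis by standard basis vectors. The sign of the determinant is absorbed into
the dual vectors in order to have a positive \<open>D\<close>.\<close>

lemma integral_dual_basis:
  fixes E :: "(real^'n) set"
  assumes E: "E \<subseteq> int_vecs" "independent E"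
  obtains D :: nat and y where "D \<ge> 1" "\<And>b. b \<in> E \<Longrightarrow> y b \<in> int_vecs"
    "\<And>b c. b \<in> E \<Longrightarrow> c \<in> E \<Longrightarrow> y b \<bullet> c = (if b = c then real D else 0)"
    "\<And>u. u \<in> span E \<Longrightarrow> real D *\<^sub>R u = (\<Sum>b\<in>E. (y b \<bullet> u) *\<^sub>R b)"
proof -
  obtain B where B: "E \<subseteq> B" "B \<subseteq> E \<union> Basis" "independent B" "E \<union> Basis \<subseteq> span B"
    using maximal_independent_subset_extend[of E "E \<union> Basis"] E(2) by blast
  have "span B = UNIV" using B(4) span_mono[of Basis "span B"] by (simp add: span_span top.extremum_uniqueI)
  then have "card B = CARD('n)"
    using dim_eq_card_independent[OF B(3)] dim_span[of B] by (simp add: dim_UNIV)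
  moreover have "B \<subseteq> int_vecs" using B(2) E(1) Basis_int_vecs by blast
  ultimately obtain d y where y: "d \<in> \<int>" "d \<noteq> 0" "\<And>b. b \<in> B \<Longrightarrow> y b \<in> int_vecs"
    "\<And>b c. b \<in> B \<Longrightarrow> c \<in> B \<Longrightarrow> y b \<bullet> c = (if b = c then d else 0)"
    using full_integral_dual_basis B(3) by metis
  define y' where "y' b = sgn d *\<^sub>R y b" for b
  define D where "D = nat \<lfloor>\<bar>d\<bar>\<rfloor>"
  have D: "real D = \<bar>d\<bar>" using y(1) by (auto simp: D_def elim: Ints_cases)
  have dual: "y' b \<bullet> c = (if b = c then real D else 0)" if "b \<in> E" "c \<in> E" for b c
  proof -
    have "b \<in> B" "c \<in> B" using that B(1) by auto
    then show ?thesis using y(4) by (simp add: y'_def D sgn_if)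
  qed
  show ?thesis
  proof
    show "D \<ge> 1" using D y(2) by linarith
    show "y' b \<in> int_vecs" if "b \<in> E" for b
      unfolding y'_def using y(3) that B(1) by (intro int_vecs_scale) (auto simp: sgn_if)
    show "y' b \<bullet> c = (if b = c then real D else 0)" if "b \<in> E" "c \<in> E" for b c
      using dual that by blast
    fix u assume "u \<in> span E"
    have fin: "finite E" using E(2) by (rule independent_imp_finite)
    obtain c where c: "u = (\<Sum>b\<in>E. c b *\<^sub>R b)"
      using \<open>u \<in> span E\<close> unfolding span_finite[OF fin] by blast
    have "y' b \<bullet> u = real D * c b" if "b \<in> E" for b
    proof -
      have "y' b \<bullet> u = (\<Sum>a\<in>E. c a * (if b = a then real D else 0))"
        unfolding c inner_sum_right by (intro sum.cong) (auto simp: dual that)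
      also have "\<dots> = c b * real D" using fin that by (simp add: if_distrib cong: if_cong)
      finally show ?thesis by simp
    qed
    then show "real D *\<^sub>R u = (\<Sum>b\<in>E. (y' b \<bullet> u) *\<^sub>R b)"
      unfolding c by (simp add: scaleR_sum_right)
  qed
qed


section \<open>Morphisms from lattices to the solenoid\<close>

lemma carrier_top_power: "carrier (top_power A m) = {..<m} \<rightarrow>\<^sub>E carrier A"
  and mult_top_power: "x \<otimes>\<^bsub>top_power A m\<^esub> y = (\<lambda>i\<in>{..<m}. x i \<otimes>\<^bsub>A\<^esub> y i)"
  and topo_top_power: "topo (top_power A m) = product_topology (\<lambda>_. topo A) {..<m}"
  by (simp_all add: top_power_def)

lemma mult_SS1_Q: "x \<otimes>\<^bsub>SS1_Q\<^esub> y = x \<otimes>\<^bsub>CC_Q\<^esub> y"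
  by (simp add: mult_powlim_mult_on)

lemma SS1_Q_subset: "carrier SS1_Q \<subseteq> carrier CC_Q"
proof
  fix x assume x: "x \<in> carrier SS1_Q"
  show "x \<in> carrier CC_Q"
    by (rule powlimI[OF powlim_extensional[OF x] _ powlim_root[OF x]]) auto
qed

lemma hom_SS1_Q_subset: "hom_sg_carrier S SS1_Q \<subseteq> hom_sg_carrier S CC_Q"
  using SS1_Q_subset by (auto simp: hom_sg_carrier_def mult_SS1_Q one_powlim_mult_on)

lemma SS1_Q_apply: "x \<in> carrier SS1_Q \<Longrightarrow> k \<ge> 1 \<Longrightarrow> x k \<noteq> 0 \<and> cmod (x k) = 1"
  using powlim_apply[of x "sphere 0 1" k] by auto

lemma hom_SS1_Q_character:
  assumes r: "r \<in> hom_sg_carrier M SS1_Q" and "0 \<in> M" "\<And>u v. u \<in> M \<Longrightarrow> v \<in> M \<Longrightarrow> u + v \<in> M"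
    "\<And>u. u \<in> M \<Longrightarrow> - u \<in> M" and k: "k \<ge> 1"
  shows "subgroup_character M (\<lambda>u. r u k)"
  unfolding subgroup_character_def
proof (intro conjI ballI)
  fix u v assume "u \<in> M" "v \<in> M"
  then show "r (u + v) k = r u k * r v k"
    using hom_sg_add[OF r] k by (simp add: mult_SS1_Q mult_CC_Q_apply)
next
  fix u assume "u \<in> M"
  then show "r u k \<noteq> 0" using SS1_Q_apply[OF hom_sg_closed[OF r] k] by blast
qed (use assms in auto)

lemma subgroup_character_sum:
  assumes \<xi>: "subgroup_character M \<xi>" and "finite I" "\<And>i. i \<in> I \<Longrightarrow> e i \<in> M"
  shows "(\<Sum>i\<in>I. of_int (c i) *\<^sub>R e i) \<in> M \<and> \<xi> (\<Sum>i\<in>I. of_int (c i) *\<^sub>R e i) = (\<Prod>i\<in>I. \<xi> (e i) powi c i)"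
  using assms(2,3)
proof (induction I rule: finite_induct)
  case empty
  have "\<xi> (0 + 0) = \<xi> 0 * \<xi> 0" "\<xi> 0 \<noteq> 0" "0 \<in> M"
    using \<xi> unfolding subgroup_character_def by blast+
  then show ?case by simp
next
  case (insert i I)
  then show ?case using subgroup_character_scale[OF \<xi>, of "e i" "c i"] \<xi>
    unfolding subgroup_character_def by simp
qed

text \<open>Linearly independent lattice vectors \<open>e\<close> with an integral dual system \<open>y\<close>, dual up to the factor \<open>D\<close>.
The vectors \<open>e\<close> need not generate the lattice points of their span, but \<open>D u\<close> is an integral
combination of them for each lattice point \<open>u\<close> of the span.\<close>

locale solenoid_coordinates =
  fixes m :: nat and e y :: "nat \<Rightarrow> real^'n" and D :: nat
  assumes D: "D \<ge> 1"
    and e_int: "i < m \<Longrightarrow> e i \<in> int_vecs"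
    and y_int: "i < m \<Longrightarrow> y i \<in> int_vecs"
    and dual: "i < m \<Longrightarrow> j < m \<Longrightarrow> y i \<bullet> e j = (if i = j then real D else 0)"
    and expand: "u \<in> span (e ` {..<m}) \<Longrightarrow> real D *\<^sub>R u = (\<Sum>i<m. (y i \<bullet> u) *\<^sub>R e i)"
begin

definition coord :: "nat \<Rightarrow> real^'n \<Rightarrow> int" where
  "coord i u = \<lfloor>y i \<bullet> u\<rfloor>"

lemma coord: "i < m \<Longrightarrow> u \<in> int_vecs \<Longrightarrow> of_int (coord i u) = y i \<bullet> u"
  using int_vecs_inner[OF y_int] by (auto simp: coord_def elim: Ints_cases)

lemma coord_add: "i < m \<Longrightarrow> u \<in> int_vecs \<Longrightarrow> v \<in> int_vecs \<Longrightarrow> coord i (u + v) = coord i u + coord i v"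
proof -
  assume *: "i < m" "u \<in> int_vecs" "v \<in> int_vecs"
  have "real_of_int (coord i (u + v)) = real_of_int (coord i u + coord i v)"
    using * coord[OF *(1) int_vecs_add[OF *(2,3)]] by (simp add: coord inner_add_right)
  then show ?thesis by linarith
qed

text \<open>The product of the powers \<open>s i\<close> to the rational exponents \<open>(y i \<bullet> u) / D\<close>. In the solenoid the \<open>D\<close>-th root of
\<open>s\<close> is the sequence \<open>k \<mapsto> s (D k)\<close>, which leaves integral exponents.\<close>

definition solenoid_hom :: "(nat \<Rightarrow> nat \<Rightarrow> complex) \<Rightarrow> real^'n \<Rightarrow> nat \<Rightarrow> complex" where
  "solenoid_hom s = (\<lambda>u\<in>int_vecs. \<lambda>k\<in>{1..}. \<Prod>i<m. s i (D * k) powi coord i u)"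

lemma Dk: "k \<ge> 1 \<Longrightarrow> D * k \<ge> 1"
  using D by (metis mult_le_mono nat_mult_1)

lemma solenoid_hom_apply:
  "u \<in> int_vecs \<Longrightarrow> k \<ge> 1 \<Longrightarrow> solenoid_hom s u k = (\<Prod>i<m. s i (D * k) powi coord i u)"
  by (simp add: solenoid_hom_def)

lemma top_power_apply: "s \<in> carrier (top_power SS1_Q m) \<Longrightarrow> i < m \<Longrightarrow> s i \<in> carrier SS1_Q"
  by (auto simp: carrier_top_power)

lemma solenoid_hom_closed:
  assumes s: "s \<in> carrier (top_power SS1_Q m)" and u: "u \<in> int_vecs"
  shows "solenoid_hom s u \<in> carrier SS1_Q"
proof (rule powlimI)
  show "solenoid_hom s u \<in> extensional {1..}" using u by (simp add: solenoid_hom_def)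
  show "solenoid_hom s u k \<in> sphere 0 1" if "k \<ge> 1" for k
    using SS1_Q_apply[OF top_power_apply[OF s] Dk[OF that]]
    by (simp add: solenoid_hom_apply[OF u that] norm_power_int flip: prod_norm)
  fix k j :: nat assume kj: "k \<ge> 1" "j \<ge> 1"
  then have kj': "k * j \<ge> 1" by (metis mult_le_mono nat_mult_1)
  have "s i (D * j) powi coord i u = (s i (D * (k * j)) powi coord i u) ^ k" if "i < m" for i
  proof -
    have "s i (D * j) = s i (D * (k * j)) ^ k"
      using powlim_root[OF top_power_apply[OF s that] kj(1) Dk[OF kj(2)]] by (simp add: mult_ac)
    then have "s i (D * j) powi coord i u = s i (D * (k * j)) powi (int k * coord i u)"
      by (simp only: power_int_power)
    then show ?thesis by (simp only: power_int_power' mult.commute)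
  qed
  then show "solenoid_hom s u j = solenoid_hom s u (k * j) ^ k"
    using u kj kj' by (simp add: solenoid_hom_apply prod_power_distrib)
qed

lemma solenoid_hom_hom:
  assumes s: "s \<in> carrier (top_power SS1_Q m)"
  shows "solenoid_hom s \<in> hom_sg_carrier int_vecs SS1_Q"
  unfolding hom_sg_carrier_def mem_Collect_eq
proof (intro conjI ballI)
  show "solenoid_hom s \<in> int_vecs \<rightarrow>\<^sub>E carrier SS1_Q"
    using solenoid_hom_closed[OF s] by (auto simp: solenoid_hom_def)
  have c0: "coord i 0 = 0" for i by (simp add: coord_def)
  show "solenoid_hom s 0 = \<one>\<^bsub>SS1_Q\<^esub>"
    unfolding solenoid_hom_def one_powlim_mult_on by (simp add: c0)
  fix u v :: "real^'n" assume uv: "u \<in> int_vecs" "v \<in> int_vecs"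
  have "solenoid_hom s (u + v) k = solenoid_hom s u k * solenoid_hom s v k" if k: "k \<ge> 1" for k
  proof -
    have "s i (D * k) powi coord i (u + v) = s i (D * k) powi coord i u * s i (D * k) powi coord i v"
      if "i < m" for i
      using SS1_Q_apply[OF top_power_apply[OF s that] Dk[OF k]] coord_add[OF that uv]
      by (simp add: power_int_add)
    then show ?thesis
      using uv k int_vecs_add[OF uv] by (simp add: solenoid_hom_apply prod.distrib)
  qed
  then show "solenoid_hom s (u + v) = solenoid_hom s u \<otimes>\<^bsub>SS1_Q\<^esub> solenoid_hom s v"
    unfolding mult_powlim_mult_on
    by (intro extensionalityI[OF powlim_extensional[OF solenoid_hom_closed[OF s int_vecs_add[OF uv]]]]) auto
qed

lemma solenoid_hom_basis:
  assumes s: "s \<in> carrier (top_power SS1_Q m)" and j: "j < m"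
  shows "solenoid_hom s (e j) = s j"
proof (rule powlim_eqI[OF solenoid_hom_closed[OF s e_int[OF j]] top_power_apply[OF s j]])
  fix k :: nat assume k: "k \<ge> 1"
  have c: "coord i (e j) = (if i = j then int D else 0)" if "i < m" for i
    using dual[OF that j] by (simp add: coord_def)
  have "solenoid_hom s (e j) k = (\<Prod>i<m. if i = j then s j (D * k) ^ D else 1)"
    unfolding solenoid_hom_apply[OF e_int[OF j] k] by (intro prod.cong) (auto simp: c)
  also have "\<dots> = s j k"
    using powlim_root[OF top_power_apply[OF s j] D k] j by simp
  finally show "solenoid_hom s (e j) k = s j k" .
qed

text \<open>Unique divisibility: \<open>r u\<close> is determined by its multiple \<open>D (r u) = r (D u)\<close>, hence by the values at
the vectors \<open>e\<close>.\<close>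

lemma solenoid_hom_unique:
  assumes M: "M = int_vecs \<inter> span (e ` {..<m})" and r: "r \<in> hom_sg_carrier M SS1_Q" and u: "u \<in> M"
  shows "solenoid_hom (\<lambda>i\<in>{..<m}. r (e i)) u = r u"
    and "(\<lambda>i\<in>{..<m}. r (e i)) \<in> carrier (top_power SS1_Q m)"
proof -
  have eM: "e i \<in> M" if "i < m" for i
    using e_int that unfolding M by (auto intro: span_base)
  show s: "(\<lambda>i\<in>{..<m}. r (e i)) \<in> carrier (top_power SS1_Q m)"
    using hom_sg_closed[OF r] eM by (auto simp: carrier_top_power)
  have ui: "u \<in> int_vecs" "u \<in> span (e ` {..<m})" using u M by auto
  show "solenoid_hom (\<lambda>i\<in>{..<m}. r (e i)) u = r u"
  proof (rule powlim_eqI[OF solenoid_hom_closed[OF s ui(1)] hom_sg_closed[OF r u]])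
    fix k :: nat assume k: "k \<ge> 1"
    have ch: "subgroup_character M (\<lambda>u. r u (D * k))"
      using M by (intro hom_SS1_Q_character[OF r _ _ _ Dk[OF k]])
        (auto simp: int_vecs_add int_vecs_uminus span_add span_neg span_zero)
    have "r u k = r u (D * k) ^ D" by (rule powlim_root[OF hom_sg_closed[OF r u] D k])
    also have "\<dots> = r (of_int (int D) *\<^sub>R u) (D * k)"
      using subgroup_character_scale[OF ch u, of "int D"] by simp
    also have "of_int (int D) *\<^sub>R u = (\<Sum>i<m. of_int (coord i u) *\<^sub>R e i)"
      using expand[OF ui(2)] by (simp add: coord ui(1))
    also have "r \<dots> (D * k) = (\<Prod>i<m. r (e i) (D * k) powi coord i u)"
      using subgroup_character_sum[OF ch, of "{..<m}" e "\<lambda>i. coord i u"] eM by simp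
    also have "\<dots> = solenoid_hom (\<lambda>i\<in>{..<m}. r (e i)) u k"
      by (simp add: solenoid_hom_apply[OF ui(1) k])
    finally show "solenoid_hom (\<lambda>i\<in>{..<m}. r (e i)) u k = r u k" by simp
  qed
qed

lemma solenoid_hom_mult:
  assumes "u \<in> int_vecs"
  shows "solenoid_hom (s \<otimes>\<^bsub>top_power SS1_Q m\<^esub> s') u = solenoid_hom s u \<otimes>\<^bsub>SS1_Q\<^esub> solenoid_hom s' u"
proof -
  have "(s \<otimes>\<^bsub>top_power SS1_Q m\<^esub> s') i (D * k) = s i (D * k) * s' i (D * k)" if "i < m" "k \<ge> 1" for i k
    using that Dk by (simp add: mult_top_power mult_powlim_mult_on)
  then show ?thesis
    unfolding mult_powlim_mult_on
    by (auto simp: assms solenoid_hom_def fun_eq_iff power_int_mult_distrib prod.distrib)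
qed

end

section \<open>Fibres of the moment map\<close>

lemma modulus_Q_nonneg: "modulus_Q x \<ge> 0"
  by (simp add: modulus_Q_def)

lemma proj1_mult: "proj1 (x \<otimes>\<^bsub>CC_Q\<^esub> y) = proj1 x * proj1 y"
  by (simp add: proj1_def mult_CC_Q_apply)

lemma proj1_one: "proj1 \<one>\<^bsub>CC_Q\<^esub> = 1"
  by (simp add: proj1_def one_powlim_mult_on)

lemma modulus_Q_mult: "modulus_Q (x \<otimes>\<^bsub>CC_Q\<^esub> y) = modulus_Q x * modulus_Q y"
  by (simp add: modulus_Q_def proj1_def mult_CC_Q_apply norm_mult)

lemma modulus_Q_one: "modulus_Q \<one>\<^bsub>CC_Q\<^esub> = 1"
  by (simp add: modulus_Q_def proj1_def one_powlim_mult_on)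

lemma proj1_zero_iff: "x \<in> carrier CC_Q \<Longrightarrow> proj1 x = 0 \<longleftrightarrow> x = zero_Q"
  using CC_Q_nonzero[of x 1] by (auto simp: proj1_def zero_Q_def)

lemma modulus_Q_zero_iff: "x \<in> carrier CC_Q \<Longrightarrow> modulus_Q x = 0 \<longleftrightarrow> x = zero_Q"
  by (simp add: modulus_Q_def proj1_zero_iff)

lemma modulus_SS1_Q: "x \<in> carrier SS1_Q \<Longrightarrow> modulus_Q x = 1"
  using SS1_Q_apply[of x 1] by (simp add: modulus_Q_def proj1_def)

text \<open>The section of the modulus by positive roots is a morphism, so it lifts a point of the Delzant space to a
point of the fibre over it.\<close>

definition positive_Q :: "real \<Rightarrow> nat \<Rightarrow> complex" where
  "positive_Q r = (\<lambda>k\<in>{1..}. of_real (root k r))"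

lemma positive_Q_closed:
  assumes "r \<ge> 0" shows "positive_Q r \<in> carrier CC_Q"
proof (rule powlimI)
  fix k m :: nat assume km: "k \<ge> 1" "m \<ge> 1"
  then have "k * m \<ge> 1" by (metis mult_le_mono nat_mult_1)
  moreover have "root m r = root (k * m) r ^ k"
    using km assms by (simp add: real_root_mult_exp)
  ultimately show "positive_Q r m = positive_Q r (k * m) ^ k"
    using km by (simp add: positive_Q_def)
qed (auto simp: positive_Q_def)

lemma modulus_positive_Q: "r \<ge> 0 \<Longrightarrow> modulus_Q (positive_Q r) = r"
  by (simp add: modulus_Q_def proj1_def positive_Q_def)

lemma positive_Q_mult: "positive_Q (r * r') = positive_Q r \<otimes>\<^bsub>CC_Q\<^esub> positive_Q r'"
  by (auto simp: positive_Q_def mult_powlim_mult_on real_root_mult)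

lemma positive_Q_one: "positive_Q 1 = \<one>\<^bsub>CC_Q\<^esub>"
  by (auto simp: positive_Q_def one_powlim_mult_on)

lemma positive_Q_zero_iff: "r \<ge> 0 \<Longrightarrow> positive_Q r = zero_Q \<longleftrightarrow> r = 0"
  by (metis modulus_Q_zero_iff modulus_positive_Q positive_Q_closed)

context exposed_fan begin

lemma toric_CC: "toric F CC 0"
  and toric_CC_Q: "toric F CC_Q zero_Q"
  and toric_RR: "toric F RR_nonneg 0"
  using exposed_fan_axioms group_with_zero_CC group_with_zero_CC_Q group_with_zero_RR_nonneg
  by (simp_all add: toric_def)

lemma moment_map_reduced:
  assumes "\<tau> \<in> F" "reduced CC_Q zero_Q \<tau> g"
  shows "reduced RR_nonneg 0 \<tau> (\<lambda>u\<in>dual_sg \<tau>. modulus_Q (g u))"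
    and "moment_map F (toric_class F CC_Q (\<tau>, g)) = toric_class F RR_nonneg (\<tau>, \<lambda>u\<in>dual_sg \<tau>. modulus_Q (g u))"
  unfolding moment_map_def
  by (rule toric_map_reduced[OF toric_CC_Q toric_RR assms];
      simp add: mult_mult_on one_mult_on modulus_Q_mult modulus_Q_one modulus_Q_zero_iff modulus_Q_nonneg)+

lemma toric_proj_reduced:
  assumes "\<tau> \<in> F" "reduced CC_Q zero_Q \<tau> g"
  shows "reduced CC 0 \<tau> (\<lambda>u\<in>dual_sg \<tau>. proj1 (g u))"
    and "toric_proj F (toric_class F CC_Q (\<tau>, g)) = toric_class F CC (\<tau>, \<lambda>u\<in>dual_sg \<tau>. proj1 (g u))"
  unfolding toric_proj_def
  by (rule toric_map_reduced[OF toric_CC_Q toric_CC assms];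
      simp add: mult_mult_on one_mult_on proj1_zero_iff proj1_mult proj1_one)+

lemma moment_fibre:
  assumes \<tau>: "\<tau> \<in> F" and p: "reduced RR_nonneg 0 \<tau> p"
  shows "{x \<in> topspace (toric_variety_Q F). moment_map F x = toric_class F RR_nonneg (\<tau>, p)} =
    {toric_class F CC_Q (\<tau>, g) | g. reduced CC_Q zero_Q \<tau> g \<and> (\<forall>u\<in>dual_sg \<tau>. modulus_Q (g u) = p u)}"
    (is "?L = ?R")
proof (intro equalityI subsetI)
  fix x assume "x \<in> ?L"
  then obtain \<tau>' g where x: "x = toric_class F CC_Q (\<tau>', g)" "\<tau>' \<in> F" "reduced CC_Q zero_Q \<tau>' g"
    and "moment_map F x = toric_class F RR_nonneg (\<tau>, p)"
    unfolding toric.topspace_toric_space[OF toric_CC_Q] by blast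
  then have "\<tau>' = \<tau> \<and> (\<lambda>u\<in>dual_sg \<tau>'. modulus_Q (g u)) = p"
    using moment_map_reduced[OF x(2,3)] toric.toric_class_inj[OF toric_RR x(2) _ \<tau> p] by simp
  then have "\<tau>' = \<tau>" "\<And>u. u \<in> dual_sg \<tau> \<Longrightarrow> modulus_Q (g u) = p u"
    by (auto dest: fun_cong)
  then show "x \<in> ?R" using x by blast
next
  fix x assume "x \<in> ?R"
  then obtain g where x: "x = toric_class F CC_Q (\<tau>, g)" "reduced CC_Q zero_Q \<tau> g"
    and g: "\<And>u. u \<in> dual_sg \<tau> \<Longrightarrow> modulus_Q (g u) = p u" by blast
  have "(\<lambda>u\<in>dual_sg \<tau>. modulus_Q (g u)) = restrict p (dual_sg \<tau>)" using g by auto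
  also have "\<dots> = p" using hom_sg_ext reduced_hom[OF p] by metis
  finally show "x \<in> ?L"
    using x \<tau> moment_map_reduced(2)[OF \<tau> x(2)] unfolding toric.topspace_toric_space[OF toric_CC_Q] by auto
qed

lemma positive_lift:
  assumes p: "reduced RR_nonneg 0 \<tau> p"
  shows "reduced CC_Q zero_Q \<tau> (\<lambda>u\<in>dual_sg \<tau>. positive_Q (p u))"
    and "u \<in> dual_sg \<tau> \<Longrightarrow> p u \<ge> 0"
proof -
  note hp = reduced_hom[OF p]
  show nn: "p u \<ge> 0" if "u \<in> dual_sg \<tau>" for u using hom_sg_closed[OF hp that] by simp
  have "(\<lambda>u\<in>dual_sg \<tau>. positive_Q (p u)) \<in> hom_sg_carrier (dual_sg \<tau>) CC_Q"
    using nn hom_sg_add[OF hp] hom_sg_0[OF hp]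
    by (simp add: hom_sg_carrier_def positive_Q_closed dual_sg_add positive_Q_mult positive_Q_one mult_mult_on one_mult_on)
  then show "reduced CC_Q zero_Q \<tau> (\<lambda>u\<in>dual_sg \<tau>. positive_Q (p u))"
    using reduced_nonzero_iff[OF p] nn by (simp add: reduced_def positive_Q_zero_iff)
qed

end

lemma continuous_map_hom_sg_CC_Q:
  "continuous_map X (topo (hom_sg S CC_Q)) G \<longleftrightarrow>
     G ` topspace X \<subseteq> hom_sg_carrier S CC_Q \<and> (\<forall>u\<in>S. continuous_map X (topo CC_Q) (\<lambda>x. G x u))"
  unfolding hom_sg_def
  by (auto simp: continuous_map_in_subtopology continuous_map_componentwise hom_sg_carrier_def
      PiE_def image_subset_iff Pi_iff)

context solenoid_coordinates begin

lemma continuous_solenoid_hom_coord: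
  assumes "u \<in> int_vecs" "k \<ge> 1"
  shows "continuous_map (topo (top_power SS1_Q m)) euclidean (\<lambda>s. solenoid_hom s u k)"
proof -
  let ?X = "topo (top_power SS1_Q m)"
  have X: "topspace ?X = carrier (top_power SS1_Q m)"
    by (simp add: topo_top_power carrier_top_power topspace_powlim)
  have c: "continuous_map ?X euclidean (\<lambda>s. s i (D * k))" if "i < m" for i
  proof -
    have "continuous_map ?X (topo SS1_Q) (\<lambda>s. s i)"
      unfolding topo_top_power using that by (intro continuous_map_product_projection) simp
    then show ?thesis using Dk[OF assms(2)] unfolding continuous_map_powlim by blast
  qed
  have nz: "s i (D * k) \<noteq> 0" if "s \<in> topspace ?X" "i < m" for s i
    using SS1_Q_apply[OF top_power_apply Dk[OF assms(2)]] that X by blast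
  show ?thesis
    using c nz unfolding solenoid_hom_apply[OF assms] continuous_map_atin
    by (auto intro!: tendsto_prod tendsto_power_int)
qed

end

text \<open>The positive lift \<open>g0\<close> of \<open>p\<close> trivialises the torsor: \<open>h s\<close> is \<open>g0\<close> multiplied by the morphism with
coordinates \<open>s\<close>. The inverse evaluates at the vectors \<open>e i\<close> and divides by \<open>g0\<close>; it is continuous since
the whole fibre lies in the chart of \<open>\<tau>\<close>. The torus acts on the fibre through the values \<open>\<phi> t\<close> of its
elements at the \<open>e i\<close>, and each tuple of values occurs because \<open>solenoid_hom\<close> is defined on all of \<open>\<int>\<^sup>n\<close>.\<close>

theorem moment_fibre_solenoidal_torus:
  fixes F :: "(real^'n) set set"
  assumes ef: "exposed_fan F" and \<tau>: "\<tau> \<in> F" and p: "reduced RR_nonneg 0 \<tau> p"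
    and E: "\<And>i. i < m \<Longrightarrow> e i \<in> int_vecs" "inj_on e {..<m}" "independent (e ` {..<m})"
      "perp \<tau> = span (e ` {..<m})"
  shows "\<exists>h \<phi>.
          homeomorphic_map (topo (top_power SS1_Q m))
            (subtopology (toric_variety_Q F)
              {x \<in> topspace (toric_variety_Q F). moment_map F x = toric_class F RR_nonneg (\<tau>, p)}) h \<and>
          \<phi> \<in> hom (hom_sg int_vecs SS1_Q) (top_power SS1_Q m) \<and>
          continuous_map (topo (hom_sg (int_vecs :: (real^'n) set) SS1_Q))
            (topo (top_power SS1_Q m)) \<phi> \<and>
          \<phi> ` carrier (hom_sg int_vecs SS1_Q) = carrier (top_power SS1_Q m) \<and>
          (\<forall>t \<in> carrier (hom_sg int_vecs SS1_Q). \<forall>s \<in> carrier (top_power SS1_Q m).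
             h (\<phi> t \<otimes>\<^bsub>top_power SS1_Q m\<^esub> s) = torus_action F CC_Q t (h s))"
proof -
  interpret exposed_fan F by fact
  interpret toric F CC_Q zero_Q by (rule toric_CC_Q)
  let ?T = "top_power SS1_Q m"
  obtain D :: nat and Y where "D \<ge> 1" "\<And>b. b \<in> e ` {..<m} \<Longrightarrow> Y b \<in> int_vecs"
    "\<And>b c. b \<in> e ` {..<m} \<Longrightarrow> c \<in> e ` {..<m} \<Longrightarrow> Y b \<bullet> c = (if b = c then real D else 0)"
    "\<And>u. u \<in> span (e ` {..<m}) \<Longrightarrow> real D *\<^sub>R u = (\<Sum>b\<in>e ` {..<m}. (Y b \<bullet> u) *\<^sub>R b)"
    using integral_dual_basis[of "e ` {..<m}"] E by blast
  then interpret solenoid_coordinates m e "\<lambda>i. Y (e i)" D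
    using E by unfold_locales (auto simp: sum.reindex inj_on_eq_iff)
  define M where "M = int_vecs \<inter> perp \<tau>"
  have M: "M = int_vecs \<inter> span (e ` {..<m})" using E(4) by (simp add: M_def)
  have M_dual: "u \<in> dual_sg \<tau>" if "u \<in> M" for u using that perp_dual_sg by (auto simp: M_def)
  have eM: "e i \<in> M" if "i < m" for i
    using E(1) that unfolding M by (auto intro: span_base)
  have M0: "0 \<in> M" and Madd: "\<And>u v. u \<in> M \<Longrightarrow> v \<in> M \<Longrightarrow> u + v \<in> M"
    using subspace_add[OF subspace_perp] by (auto simp: M_def int_vecs_add)
  define g0 where "g0 = (\<lambda>u\<in>dual_sg \<tau>. positive_Q (p u))"
  have g0: "reduced CC_Q zero_Q \<tau> g0" unfolding g0_def by (rule positive_lift(1)[OF p])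
  have pos: "p u \<ge> 0" if "u \<in> dual_sg \<tau>" for u by (rule positive_lift(2)[OF p that])
  have mod_g0: "modulus_Q (g0 u) = p u" if "u \<in> dual_sg \<tau>" for u
    using that pos by (simp add: g0_def modulus_positive_Q)
  have g0c: "g0 u \<in> carrier CC_Q" if "u \<in> dual_sg \<tau>" for u
    using hom_sg_closed[OF reduced_hom[OF g0] that] .
  have g0nz: "g0 u k \<noteq> 0" if "u \<in> M" "k \<ge> 1" for u k
    using CC_Q_nonzero[OF g0c[OF M_dual[OF that(1)]] _ that(2)]
      reduced_nonzero_iff[OF g0 M_dual[OF that(1)]] that(1) by (simp add: M_def)
  define G where "G s = (\<lambda>u\<in>dual_sg \<tau>. solenoid_hom s u \<otimes>\<^bsub>CC_Q\<^esub> g0 u)" for s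
  define h where "h s = toric_class F CC_Q (\<tau>, G s)" for s
  define \<phi> where "\<phi> t = (\<lambda>i\<in>{..<m}. t (e i))" for t :: "real^'n \<Rightarrow> nat \<Rightarrow> complex"
  define fib where "fib = {x \<in> topspace (toric_variety_Q F). moment_map F x = toric_class F RR_nonneg (\<tau>, p)}"
  have sg_int: "u \<in> int_vecs" if "u \<in> dual_sg \<tau>" for u using that by (simp add: dual_sg_def)
  have G: "reduced CC_Q zero_Q \<tau> (G s)" if "s \<in> carrier ?T" for s
    unfolding G_def using solenoid_hom_hom[OF that] hom_SS1_Q_subset by (intro reduced_mult[OF g0]) blast
  have Gmod: "modulus_Q (G s u) = p u" if "s \<in> carrier ?T" "u \<in> dual_sg \<tau>" for s u
    using that modulus_SS1_Q[OF solenoid_hom_closed[OF that(1) sg_int[OF that(2)]]]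
    by (simp add: G_def modulus_Q_mult mod_g0)
  have fib: "fib = {toric_class F CC_Q (\<tau>, g) | g. reduced CC_Q zero_Q \<tau> g \<and> (\<forall>u\<in>dual_sg \<tau>. modulus_Q (g u) = p u)}"
    unfolding fib_def by (rule moment_fibre[OF \<tau> p])
  have G_eqI: "g = G s" if g: "reduced CC_Q zero_Q \<tau> g" and s: "s \<in> carrier ?T"
    and eq: "\<And>u. u \<in> M \<Longrightarrow> g u = solenoid_hom s u \<otimes>\<^bsub>CC_Q\<^esub> g0 u" for g s
  proof
    fix u
    consider "u \<notin> dual_sg \<tau>" | "u \<in> dual_sg \<tau>" "u \<notin> perp \<tau>" | "u \<in> dual_sg \<tau>" "u \<in> M"
      using sg_int by (auto simp: M_def)
    then show "g u = G s u"
    proof cases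
      case 1
      then show ?thesis using fun_cong[OF hom_sg_ext[OF reduced_hom[OF g]], of u] by (simp add: G_def)
    next
      case 2
      then show ?thesis using reduced_nonzero_iff[OF g] reduced_nonzero_iff[OF G[OF s]] by metis
    next
      case 3
      then show ?thesis using eq by (simp add: G_def)
    qed
  qed
  have h_fib: "h s \<in> fib" if "s \<in> carrier ?T" for s
    unfolding fib h_def using G[OF that] Gmod[OF that] by blast
  have h_surj: "\<exists>s\<in>carrier ?T. x = h s" if x_fib: "x \<in> fib" for x
  proof -
    obtain g where x: "x = toric_class F CC_Q (\<tau>, g)" and g: "reduced CC_Q zero_Q \<tau> g"
      and gm: "\<And>u. u \<in> dual_sg \<tau> \<Longrightarrow> modulus_Q (g u) = p u" using x_fib unfolding fib by blast
    note hg = reduced_hom[OF g]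
    have ex: "\<exists>r\<in>carrier SS1_Q. g u = r \<otimes>\<^bsub>CC_Q\<^esub> g0 u" if "u \<in> M" for u
    proof -
      note u = M_dual[OF that]
      have "modulus_Q (g0 u) = modulus_Q (g u)" using mod_g0[OF u] gm[OF u] by simp
      then show ?thesis using modulus_Q_eq_iff[OF g0c[OF u] hom_sg_closed[OF hg u]] by blast
    qed
    \<comment> \<open>The quotient of \<open>g\<close> by \<open>g0\<close>, available on \<open>M\<close>, where \<open>g0\<close> is invertible.\<close>
    define r where "r = (\<lambda>u\<in>M. SOME r. r \<in> carrier SS1_Q \<and> g u = r \<otimes>\<^bsub>CC_Q\<^esub> g0 u)"
    have r: "r u \<in> carrier SS1_Q" "g u = r u \<otimes>\<^bsub>CC_Q\<^esub> g0 u" if "u \<in> M" for u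
      using someI_ex[of "\<lambda>r. r \<in> carrier SS1_Q \<and> g u = r \<otimes>\<^bsub>CC_Q\<^esub> g0 u"] ex[OF that] that
      by (auto simp: r_def)
    have r_eq: "r u k = g u k / g0 u k" if "u \<in> M" "k \<ge> 1" for u k
    proof -
      have "g u k = r u k * g0 u k"
        using arg_cong[OF r(2)[OF that(1)], of "\<lambda>x. x k"] that(2) by (simp only: mult_CC_Q_apply)
      then show ?thesis using g0nz[OF that] by simp
    qed
    have "r \<in> hom_sg_carrier M SS1_Q"
      unfolding hom_sg_carrier_def mem_Collect_eq
    proof (intro conjI ballI)
      show "r \<in> M \<rightarrow>\<^sub>E carrier SS1_Q" by (intro PiE_I r(1)) (assumption, simp add: r_def)
      show "r 0 = \<one>\<^bsub>SS1_Q\<^esub>"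
      proof (rule extensionalityI[OF powlim_extensional[OF r(1)[OF M0]]])
        show "\<one>\<^bsub>SS1_Q\<^esub> \<in> extensional {1..}" by (simp add: one_powlim_mult_on)
        fix k :: nat assume "k \<in> {1..}"
        then show "r 0 k = \<one>\<^bsub>SS1_Q\<^esub> k"
          using r_eq[OF M0] hom_sg_0[OF hg] hom_sg_0[OF reduced_hom[OF g0]]
          by (simp add: one_powlim_mult_on)
      qed
      fix u v assume u: "u \<in> M" and v: "v \<in> M"
      show "r (u + v) = r u \<otimes>\<^bsub>SS1_Q\<^esub> r v"
      proof (rule extensionalityI[OF powlim_extensional[OF r(1)[OF Madd[OF u v]]]])
        show "r u \<otimes>\<^bsub>SS1_Q\<^esub> r v \<in> extensional {1..}" by (simp add: mult_powlim_mult_on)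
        fix k :: nat assume k: "k \<in> {1..}"
        then have k': "k \<ge> 1" by simp
        have "g (u + v) k = g u k * g v k" "g0 (u + v) k = g0 u k * g0 v k"
          using hom_sg_add[OF hg M_dual[OF u] M_dual[OF v]]
            hom_sg_add[OF reduced_hom[OF g0] M_dual[OF u] M_dual[OF v]] k' by (simp_all add: mult_CC_Q_apply)
        then show "r (u + v) k = (r u \<otimes>\<^bsub>SS1_Q\<^esub> r v) k"
          using r_eq[OF Madd[OF u v] k'] r_eq[OF u k'] r_eq[OF v k'] k'
          by (simp add: mult_SS1_Q mult_CC_Q_apply)
      qed
    qed
    note u = solenoid_hom_unique[OF M this]
    define s where "s = (\<lambda>i\<in>{..<m}. r (e i))"
    have s: "s \<in> carrier ?T" unfolding s_def by (rule u(2)[OF M0])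
    have "g = G s" using r(2) u(1) by (intro G_eqI[OF g s]) (simp add: s_def)
    then show ?thesis using s x h_def by blast
  qed
  define \<psi> where "\<psi> c = (\<lambda>i\<in>{..<m}. \<lambda>k\<in>{1..}. chart_eval \<tau> (e i) c k / g0 (e i) k)"
    for c :: "('n, nat \<Rightarrow> complex) chart_point set"
  have \<psi>h: "\<psi> (h s) = s" if s: "s \<in> carrier ?T" for s
  proof -
    have "\<psi> (h s) i = s i" if i: "i < m" for i
    proof (rule extensionalityI[OF _ powlim_extensional[OF top_power_apply[OF s i]]])
      show "\<psi> (h s) i \<in> extensional {1..}" using i by (simp add: \<psi>_def)
      fix k :: nat assume "k \<in> {1..}"
      then have k: "k \<ge> 1" by simp
      have "chart_eval \<tau> (e i) (h s) = G s (e i)"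
        unfolding h_def using chart_eval_reduced[OF \<tau> G[OF s] \<tau>] M_dual[OF eM[OF i]] by blast
      also have "\<dots> = s i \<otimes>\<^bsub>CC_Q\<^esub> g0 (e i)"
        using M_dual[OF eM[OF i]] solenoid_hom_basis[OF s i] by (simp add: G_def)
      finally show "\<psi> (h s) i k = s i k"
        using i k g0nz[OF eM[OF i] k] by (simp add: \<psi>_def mult_CC_Q_apply)
    qed
    then show ?thesis
      using s by - (rule extensionalityI[of _ "{..<m}"], auto simp: \<psi>_def carrier_top_power PiE_def)
  qed
  have topT: "topspace (topo ?T) = carrier ?T"
    by (simp add: topo_top_power carrier_top_power topspace_powlim)
  have top_fib: "topspace (subtopology (toric_variety_Q F) fib) = fib" by (auto simp: fib_def)
  have cont_h: "continuous_map (topo ?T) (subtopology (toric_variety_Q F) fib) h"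
  proof -
    let ?H = "topo (hom_sg (dual_sg \<tau>) CC_Q)"
    have "continuous_map (topo ?T) (topo CC_Q) (\<lambda>s. G s u)" if u: "u \<in> dual_sg \<tau>" for u
      unfolding continuous_map_powlim
    proof (intro conjI allI impI)
      show "(\<lambda>s. G s u) ` topspace (topo ?T) \<subseteq> carrier CC_Q"
        using hom_sg_closed[OF reduced_hom[OF G] u] topT by blast
      fix k :: nat assume k: "1 \<le> k"
      have "G s u k = solenoid_hom s u k * g0 u k" for s
        using u k by (simp add: G_def mult_CC_Q_apply)
      then show "continuous_map (topo ?T) euclidean (\<lambda>s. G s u k)"
        using continuous_solenoid_hom_coord[OF sg_int[OF u] k]
        by (simp add: continuous_map_atin tendsto_mult_right)
    qed
    then have "continuous_map (topo ?T) ?H G"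
      unfolding continuous_map_hom_sg_CC_Q using reduced_hom[OF G] topT by blast
    then have "continuous_map (topo ?T) (toric_charts F CC_Q) (\<lambda>s. (\<tau>, G s))"
      unfolding toric_charts_def
      using continuous_map_compose[OF _ continuous_map_component_injection[OF \<tau>], of "topo ?T" "\<lambda>\<sigma>. topo (hom_sg (dual_sg \<sigma>) CC_Q)" G]
      by (simp add: comp_def)
    moreover have "continuous_map (toric_charts F CC_Q) (toric_variety_Q F) (toric_class F CC_Q)"
      unfolding toric_space_def using quotient_map_quotient_topology by (rule quotient_imp_continuous_map)
    ultimately have "continuous_map (topo ?T) (toric_variety_Q F) h"
      unfolding h_def using continuous_map_compose[of _ _ "\<lambda>s. (\<tau>, G s)" _ "toric_class F CC_Q"] by (simp add: comp_def)
    then show ?thesis using h_fib topT by (auto simp: continuous_map_in_subtopology)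
  qed
  have cont_\<psi>: "continuous_map (subtopology (toric_variety_Q F) fib) (topo ?T) \<psi>"
  proof -
    have \<psi>_in: "\<psi> x \<in> carrier ?T" if "x \<in> fib" for x using h_surj[OF that] \<psi>h by auto
    have sub: "fib \<subseteq> chart_nbhd F CC_Q zero_Q \<tau>" unfolding fib chart_nbhd_def using \<tau> by blast
    have "continuous_map (subtopology (toric_variety_Q F) fib) (topo SS1_Q) (\<lambda>x. \<psi> x i)" if i: "i < m" for i
      unfolding continuous_map_powlim
    proof (intro conjI allI impI)
      show "(\<lambda>x. \<psi> x i) ` topspace (subtopology (toric_variety_Q F) fib) \<subseteq> carrier SS1_Q"
        unfolding top_fib using top_power_apply[OF \<psi>_in i] by blast
      fix k :: nat assume k: "1 \<le> k"
      have "continuous_map (subtopology (toric_variety_Q F) fib) euclidean (\<lambda>c. chart_eval \<tau> (e i) c k)"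
        using continuous_map_chart_eval[OF ef \<tau> M_dual[OF eM[OF i]] k] sub
        by (rule continuous_map_from_subtopology_mono)
      then show "continuous_map (subtopology (toric_variety_Q F) fib) euclidean (\<lambda>x. \<psi> x i k)"
        using i k g0nz[OF eM[OF i] k] by (simp add: \<psi>_def continuous_map_atin tendsto_divide)
    qed
    then show ?thesis
      unfolding topo_top_power continuous_map_componentwise by (auto simp: \<psi>_def)
  qed
  have "homeomorphic_maps (topo ?T) (subtopology (toric_variety_Q F) fib) h \<psi>"
    unfolding homeomorphic_maps_def topT top_fib
    using cont_h cont_\<psi> \<psi>h h_surj by metis
  then have homeo: "homeomorphic_map (topo ?T) (subtopology (toric_variety_Q F) fib) h"
    unfolding homeomorphic_map_maps by blast
  let ?HT = "hom_sg (int_vecs :: (real^'n) set) SS1_Q"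
  have \<phi>_closed: "\<phi> t \<in> carrier ?T" if "t \<in> carrier ?HT" for t
    using that hom_sg_closed[OF _ E(1)] by (auto simp: \<phi>_def carrier_top_power carrier_hom_sg)
  have \<phi>_hom: "\<phi> \<in> hom ?HT ?T"
    using \<phi>_closed E(1) by (auto simp: hom_def mult_hom_sg mult_top_power \<phi>_def)
  have \<phi>_cont: "continuous_map (topo ?HT) (topo ?T) \<phi>"
    unfolding topo_top_power continuous_map_componentwise
    using E(1) by (auto simp: \<phi>_def intro!: continuous_hom_eval)
  have "\<phi> (solenoid_hom s) = s" if s: "s \<in> carrier ?T" for s
    using s solenoid_hom_basis[OF s]
    by - (rule extensionalityI[of _ "{..<m}"], auto simp: \<phi>_def carrier_top_power PiE_def e_int)
  then have "s \<in> \<phi> ` carrier ?HT" if "s \<in> carrier ?T" for s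
    using solenoid_hom_hom[OF that] that unfolding carrier_hom_sg by (metis imageI)
  then have \<phi>_surj: "\<phi> ` carrier ?HT = carrier ?T" using \<phi>_closed by blast
  have "h (\<phi> t \<otimes>\<^bsub>?T\<^esub> s) = torus_action F CC_Q t (h s)" if t: "t \<in> carrier ?HT" and s: "s \<in> carrier ?T" for t s
  proof -
    have t': "t \<in> hom_sg_carrier int_vecs SS1_Q" using t by (simp add: carrier_hom_sg)
    then have tC: "t \<in> hom_sg_carrier int_vecs CC_Q" using hom_SS1_Q_subset by blast
    interpret S: comm_monoid SS1_Q by (rule comm_monoid_powlim) (auto simp: norm_mult)
    have ts: "\<phi> t \<otimes>\<^bsub>?T\<^esub> s \<in> carrier ?T"
      using \<phi>_closed[OF t] s by (auto simp: carrier_top_power mult_top_power)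
    have tM: "restrict t M \<in> hom_sg_carrier M SS1_Q"
      by (rule hom_sg_restrict[OF t' _ M0 Madd]) (auto simp: M_def)
    have lift: "solenoid_hom (\<phi> t) u = t u" if "u \<in> M" for u
    proof -
      have "(\<lambda>i\<in>{..<m}. restrict t M (e i)) = \<phi> t" using eM by (auto simp: \<phi>_def)
      then show ?thesis using solenoid_hom_unique(1)[OF M tM that] that by simp
    qed
    have "(\<lambda>u\<in>dual_sg \<tau>. t u \<otimes>\<^bsub>CC_Q\<^esub> G s u) = G (\<phi> t \<otimes>\<^bsub>?T\<^esub> s)"
    proof (rule G_eqI[OF reduced_mult[OF G[OF s] tC] ts])
      fix u assume u: "u \<in> M"
      then have ui: "u \<in> int_vecs" by (simp add: M_def)
      have "t u \<in> carrier CC_Q" "solenoid_hom s u \<in> carrier CC_Q"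
        using hom_sg_closed[OF tC ui] solenoid_hom_closed[OF s ui] SS1_Q_subset by blast+
      then have "solenoid_hom (\<phi> t \<otimes>\<^bsub>?T\<^esub> s) u \<otimes>\<^bsub>CC_Q\<^esub> g0 u = t u \<otimes>\<^bsub>CC_Q\<^esub> (solenoid_hom s u \<otimes>\<^bsub>CC_Q\<^esub> g0 u)"
        using g0c[OF M_dual[OF u]] unfolding solenoid_hom_mult[OF ui] lift[OF u] mult_SS1_Q by (rule m_assoc)
      then show "(\<lambda>u\<in>dual_sg \<tau>. t u \<otimes>\<^bsub>CC_Q\<^esub> G s u) u = solenoid_hom (\<phi> t \<otimes>\<^bsub>?T\<^esub> s) u \<otimes>\<^bsub>CC_Q\<^esub> g0 u"
        using M_dual[OF u] by (simp add: G_def)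
    qed
    then show ?thesis unfolding h_def torus_action_reduced[OF \<tau> G[OF s] tC] by simp
  qed
  then show ?thesis
    using homeo \<phi>_hom \<phi>_cont \<phi>_surj unfolding fib_def by blast
qed

section \<open>Normal fans of lattice polytopes\<close>

lemma perp_span: "perp (span S) = perp S"
proof
  show "perp S \<subseteq> perp (span S)"
  proof
    fix u assume u: "u \<in> perp S"
    have "S \<subseteq> {v. u \<bullet> v = 0}" using u by (auto simp: perp_def)
    then have "span S \<subseteq> {v. u \<bullet> v = 0}" by (rule span_minimal) (rule subspace_hyperplane)
    then show "u \<in> perp (span S)" by (auto simp: perp_def)
  qed
qed (simp add: perp_antimono span_superset)

lemma perp_eq_orthogonal_comp: "perp S = orthogonal_comp S"
  by (auto simp: perp_def orthogonal_comp_def orthogonal_def inner_commute)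

lemma perp_perp: "perp (perp S) = span S"
  using orthogonal_comp_self[OF subspace_span[of S]] perp_span[of S] by (simp add: perp_eq_orthogonal_comp)

lemma dim_perp: "dim (perp S) + dim S = CARD('n)" for S :: "(real^'n) set"
proof -
  have "dim {y \<in> UNIV. \<forall>x\<in>span S. orthogonal x y} + dim (span S) = dim (UNIV :: (real^'n) set)"
    by (rule dim_subspace_orthogonal_to_vectors) auto
  moreover have "{y \<in> UNIV. \<forall>x\<in>span S. orthogonal x y} = perp S"
    unfolding perp_span[of S, symmetric] by (auto simp: perp_def orthogonal_def inner_commute)
  ultimately show ?thesis by simp
qed

lemma finite_bounded_int_vecs:
  assumes "bounded S" shows "finite (S \<inter> int_vecs)"
proof -
  obtain B where B: "\<And>x. x \<in> S \<Longrightarrow> norm x \<le> B" using assms by (auto simp: bounded_iff)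
  define A :: "real set" where "A = of_int ` {- \<lceil>B\<rceil>..\<lceil>B\<rceil>}"
  have "finite {f :: 'a \<Rightarrow> real. \<forall>i. f i \<in> A}"
    using finite_PiE[of "UNIV :: 'a set" "\<lambda>_. A"] by (simp add: A_def PiE_def Pi_def)
  moreover have "S \<inter> int_vecs \<subseteq> vec_lambda ` {f. \<forall>i. f i \<in> A}"
  proof
    fix x assume x: "x \<in> S \<inter> int_vecs"
    have "x $ i \<in> A" for i
    proof -
      obtain j where j: "x $ i = of_int j" using x by (auto simp: int_vecs_def elim: Ints_cases)
      have "\<bar>x $ i\<bar> \<le> B" using B component_le_norm_cart[of x i] x by (meson IntD1 order_trans)
      then have "j \<in> {- \<lceil>B\<rceil>..\<lceil>B\<rceil>}" using j by (auto simp: abs_le_iff) linarith+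
      then show ?thesis using j by (auto simp: A_def)
    qed
    then have "x = vec_lambda (vec_nth x) \<and> vec_nth x \<in> {f. \<forall>i. f i \<in> A}" by simp
    then show "x \<in> vec_lambda ` {f. \<forall>i. f i \<in> A}" by blast
  qed
  ultimately show ?thesis by (meson finite_imageI finite_subset)
qed

locale polytope_fan =
  fixes P V :: "(real^'n) set" and F
  assumes fan_F: "fan F" and finV: "finite V" and Vint: "V \<subseteq> int_vecs" and P: "P = convex hull V"
    and full_dim: "aff_dim P = int CARD('n)" and F: "F = normal_fan P"
begin

lemma face_eq_hull:
  assumes "Q face_of P"
  shows "Q = convex hull (V \<inter> Q)"
proof -
  obtain S where S: "S \<subseteq> V" "Q = convex hull S"
    using face_of_convex_hull_subset[of V Q] assms finV P by (auto simp: finite_imp_compact)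
  then have "S \<subseteq> V \<inter> Q" using hull_subset[of S convex] by auto
  then have "Q \<subseteq> convex hull (V \<inter> Q)" using S(2) hull_mono by metis
  moreover have "convex hull (V \<inter> Q) \<subseteq> Q"
    using face_of_imp_convex[OF assms] by (intro hull_minimal) auto
  ultimately show ?thesis by blast
qed

lemma face_vertex: "Q face_of P \<Longrightarrow> Q \<noteq> {} \<Longrightarrow> \<exists>a. a \<in> V \<inter> Q"
  using face_eq_hull by (metis convex_hull_empty ex_in_conv)

lemma hull_le:
  fixes x :: "real^'n"
  assumes "\<And>u. u \<in> V \<Longrightarrow> b \<le> u \<bullet> x" "u \<in> P"
  shows "b \<le> u \<bullet> x"
proof -
  have "convex hull V \<subseteq> {u. x \<bullet> u \<ge> b}"
    using assms(1) by (intro hull_minimal convex_halfspace_ge) (auto simp: inner_commute)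
  then show ?thesis using assms(2) P by (auto simp: inner_commute)
qed

lemma face_inner_const:
  assumes "Q face_of P" "\<And>w. w \<in> V \<inter> Q \<Longrightarrow> w \<bullet> x = b" "q \<in> Q"
  shows "q \<bullet> x = b"
proof -
  have "convex hull (V \<inter> Q) \<subseteq> {u. x \<bullet> u = b}"
    using assms(2) by (intro hull_minimal convex_hyperplane) (auto simp: inner_commute)
  then show ?thesis using assms(3) face_eq_hull[OF assms(1)] by (auto simp: inner_commute)
qed

lemma exposing_normal:
  assumes "Q face_of P" "Q \<noteq> {}"
  obtains v where "v \<in> normal_cone P Q" "\<And>u a. u \<in> P \<Longrightarrow> a \<in> Q \<Longrightarrow> u \<bullet> v \<le> a \<bullet> v \<Longrightarrow> u \<in> Q"
proof -
  have "polyhedron P" using finV P polytope_imp_polyhedron polytope_def by blast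
  then have "Q exposed_face_of P" using exposed_face_of_polyhedron assms by blast
  then obtain a b where ab: "P \<subseteq> {x. a \<bullet> x \<le> b}" "Q = P \<inter> {x. a \<bullet> x = b}"
    unfolding exposed_face_of_def by blast
  show ?thesis
    by (rule that[of "- a"]) (use ab in \<open>auto simp: normal_cone_def inner_commute\<close>)
qed

text \<open>Faces of a polytope are exposed, so a face is recovered from its normal cone. This makes \<open>normal_cone\<close> an
order-reversing embedding of the nonempty faces.\<close>

lemma face_eq_minimizers:
  assumes "Q face_of P" "Q \<noteq> {}"
  shows "Q = {x \<in> P. \<forall>v\<in>normal_cone P Q. \<forall>u\<in>P. x \<bullet> v \<le> u \<bullet> v}"
proof
  show "Q \<subseteq> {x \<in> P. \<forall>v\<in>normal_cone P Q. \<forall>u\<in>P. x \<bullet> v \<le> u \<bullet> v}"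
    using face_of_imp_subset[OF assms(1)] by (auto simp: normal_cone_def)
  obtain v where "v \<in> normal_cone P Q" "\<And>u a. u \<in> P \<Longrightarrow> a \<in> Q \<Longrightarrow> u \<bullet> v \<le> a \<bullet> v \<Longrightarrow> u \<in> Q"
    using exposing_normal[OF assms] by blast
  then show "{x \<in> P. \<forall>v\<in>normal_cone P Q. \<forall>u\<in>P. x \<bullet> v \<le> u \<bullet> v} \<subseteq> Q"
    using assms face_of_imp_subset[OF assms(1)] by blast
qed

lemma normal_cone_antimono_iff:
  assumes "Q face_of P" "Q \<noteq> {}" "Q' face_of P" "Q' \<noteq> {}"
  shows "normal_cone P Q' \<subseteq> normal_cone P Q \<longleftrightarrow> Q \<subseteq> Q'"
proof
  assume "normal_cone P Q' \<subseteq> normal_cone P Q"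
  then show "Q \<subseteq> Q'"
    using face_eq_minimizers[OF assms(1,2)] face_eq_minimizers[OF assms(3,4)] by blast
qed (auto simp: normal_cone_def)

lemma normal_cone_inj:
  assumes "Q face_of P" "Q \<noteq> {}" "Q' face_of P" "Q' \<noteq> {}" "normal_cone P Q = normal_cone P Q'"
  shows "Q = Q'"
  using normal_cone_antimono_iff[OF assms(1-4)] normal_cone_antimono_iff[OF assms(3,4,1,2)] assms(5) by blast

lemma normal_cone_in: "Q face_of P \<Longrightarrow> Q \<noteq> {} \<Longrightarrow> normal_cone P Q \<in> F"
  unfolding F normal_fan_def by blast

lemma fan_cone_cases:
  assumes "\<sigma> \<in> F"
  obtains Q where "Q face_of P" "Q \<noteq> {}" "\<sigma> = normal_cone P Q"
  using assms unfolding F normal_fan_def by blast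

text \<open>If \<open>\<sigma>\<close> belongs to \<open>Q\<close> and its face \<open>\<tau>\<close> to \<open>Q'\<close>, then \<open>Q \<subseteq> Q'\<close>. For a point \<open>a\<close> of \<open>V\<close> in \<open>Q\<close> the sum of \<open>w - a\<close>
over the points \<open>w\<close> of \<open>V\<close> in \<open>Q'\<close> exposes \<open>\<tau>\<close>: its summands are nonnegative on \<open>\<sigma>\<close>, and they all vanish at \<open>v\<close>
only if \<open>v\<close> is constant on \<open>Q'\<close>.\<close>

lemma exposed_fan: "exposed_fan F"
proof
  fix \<tau> \<sigma> assume "\<tau> \<in> F" "\<sigma> \<in> F" and sub: "\<tau> \<subseteq> \<sigma>"
  then obtain Q' Q where Q': "Q' face_of P" "Q' \<noteq> {}" "\<tau> = normal_cone P Q'"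
    and Q: "Q face_of P" "Q \<noteq> {}" "\<sigma> = normal_cone P Q"
    by (metis fan_cone_cases)
  have QQ: "Q \<subseteq> Q'" using normal_cone_antimono_iff Q Q' sub by blast
  obtain a where a: "a \<in> V" "a \<in> Q" using face_vertex[OF Q(1,2)] by blast
  have sP: "V \<inter> Q' \<subseteq> P" "a \<in> P" using hull_subset[of V convex] P a by auto
  define n where "n = (\<Sum>w\<in>V \<inter> Q'. w - a)"
  have nv: "n \<bullet> v = (\<Sum>w\<in>V \<inter> Q'. w \<bullet> v - a \<bullet> v)" for v
    by (simp add: n_def inner_sum_left inner_diff_left)
  have term_nonneg: "0 \<le> w \<bullet> v - a \<bullet> v" if "v \<in> \<sigma>" "w \<in> V \<inter> Q'" for v w
    using that a sP Q(3) by (auto simp: normal_cone_def)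
  have "n \<in> int_vecs" unfolding n_def using Vint a by (intro int_vecs_sum int_vecs_diff) auto
  then have nS: "n \<in> dual_sg \<sigma>"
    unfolding dual_sg_def using term_nonneg by (auto simp: nv intro!: sum_nonneg)
  have "\<tau> = {v \<in> \<sigma>. n \<bullet> v = 0}"
  proof (intro equalityI subsetI)
    fix v assume v: "v \<in> \<tau>"
    have "w \<bullet> v = a \<bullet> v" if "w \<in> V \<inter> Q'" for w
      using v that a QQ sP unfolding Q'(3) normal_cone_def by (intro antisym) auto
    then show "v \<in> {v \<in> \<sigma>. n \<bullet> v = 0}" using v sub by (auto simp: nv)
  next
    fix v assume "v \<in> {v \<in> \<sigma>. n \<bullet> v = 0}"
    then have v: "v \<in> \<sigma>" "n \<bullet> v = 0" by auto
    then have "\<forall>w\<in>V \<inter> Q'. w \<bullet> v - a \<bullet> v = 0"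
      using term_nonneg finV unfolding nv by (subst (asm) sum_nonneg_eq_0_iff) auto
    then have "q \<bullet> v = a \<bullet> v" if "q \<in> Q'" for q
      using face_inner_const[OF Q'(1) _ that] by simp
    then show "v \<in> \<tau>" using v(1) a unfolding Q'(3) Q(3) normal_cone_def by auto
  qed
  then show "\<exists>n. integrally_exposed \<tau> \<sigma> n" using nS unfolding integrally_exposed_def by blast
qed (rule fan_F)

text \<open>A vector orthogonal to the differences within \<open>Q\<close> lands in the normal cone once a large multiple of a
normal \<open>v\<close> exposing \<open>Q\<close> is added to it, so it is a difference of multiples of two normals.\<close>

lemma span_normal_cone:
  assumes Q: "Q face_of P" "Q \<noteq> {}" and a: "a \<in> V \<inter> Q"
  shows "span (normal_cone P Q) = perp ((\<lambda>w. w - a) ` (V \<inter> Q))"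
proof
  let ?D = "(\<lambda>w. w - a) ` (V \<inter> Q)"
  have VP: "V \<subseteq> P" using hull_subset[of V convex] P by auto
  have "normal_cone P Q \<subseteq> perp ?D"
  proof
    fix v assume v: "v \<in> normal_cone P Q"
    have "w \<bullet> v = a \<bullet> v" if "w \<in> V \<inter> Q" for w
      using v that a VP unfolding normal_cone_def by (intro antisym) auto
    then show "v \<in> perp ?D" by (auto simp: perp_def inner_diff_right inner_commute)
  qed
  then show "span (normal_cone P Q) \<subseteq> perp ?D" by (rule span_minimal) (rule subspace_perp)
  show "perp ?D \<subseteq> span (normal_cone P Q)"
  proof
    fix w assume w: "w \<in> perp ?D"
    obtain v where v: "v \<in> normal_cone P Q" "\<And>u a. u \<in> P \<Longrightarrow> a \<in> Q \<Longrightarrow> u \<bullet> v \<le> a \<bullet> v \<Longrightarrow> u \<in> Q"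
      using exposing_normal[OF Q] by blast
    have "\<exists>M::nat. \<forall>y\<in>(\<lambda>u. u - a) ` V. 0 \<le> (w + real M *\<^sub>R v) \<bullet> y"
    proof (rule nonneg_shift)
      fix y assume "y \<in> (\<lambda>u. u - a) ` V"
      then obtain u where u: "y = u - a" "u \<in> V" by blast
      show "0 \<le> v \<bullet> y" using v(1) a u VP by (auto simp: normal_cone_def inner_diff_right inner_commute)
      assume "v \<bullet> y = 0"
      then have "u \<in> Q" using v(2)[of u a] u a VP by (auto simp: inner_diff_right inner_commute)
      then show "0 \<le> w \<bullet> y" using w u by (auto simp: perp_def)
    qed (simp add: finV)
    then obtain M :: nat where M: "\<And>u. u \<in> V \<Longrightarrow> 0 \<le> (w + real M *\<^sub>R v) \<bullet> (u - a)" by blast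
    let ?x = "w + real M *\<^sub>R v"
    have xD: "?x \<in> perp ?D"
      using w subsetD[OF \<open>normal_cone P Q \<subseteq> perp ?D\<close> v(1)] subspace_perp
      by (intro subspace_add subspace_scale) auto
    have "q \<bullet> ?x = a \<bullet> ?x" if "q \<in> Q" for q
    proof (rule face_inner_const[OF Q(1) _ that])
      fix b assume b: "b \<in> V \<inter> Q"
      have "?x \<bullet> (b - a) = 0" using xD b unfolding perp_def by blast
      then show "b \<bullet> ?x = a \<bullet> ?x"
        unfolding inner_diff_right inner_commute[of b] inner_commute[of a] by linarith
    qed
    moreover have "a \<bullet> ?x \<le> u \<bullet> ?x" if "u \<in> P" for u
    proof (rule hull_le[OF _ that])
      fix b assume "b \<in> V"
      then have "0 \<le> ?x \<bullet> b - ?x \<bullet> a" using M by (simp only: inner_diff_right)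
      then show "a \<bullet> ?x \<le> b \<bullet> ?x"
        unfolding inner_commute[of b] inner_commute[of a] by linarith
    qed
    ultimately have "?x \<in> normal_cone P Q" by (simp add: normal_cone_def)
    then have "?x - real M *\<^sub>R v \<in> span (normal_cone P Q)"
      using v(1) by (intro span_diff span_scale span_base)
    then show "w \<in> span (normal_cone P Q)" by simp
  qed
qed

lemma perp_normal_cone:
  assumes "Q face_of P" "Q \<noteq> {}" "a \<in> V \<inter> Q"
  shows "perp (normal_cone P Q) = span ((\<lambda>w. w - a) ` (V \<inter> Q))"
  using span_normal_cone[OF assms] perp_span perp_perp by metis

lemma aff_dim_face:
  assumes "Q face_of P" "a \<in> V \<inter> Q"
  shows "aff_dim Q = int (dim ((\<lambda>w. w - a) ` (V \<inter> Q)))"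
proof -
  have "aff_dim Q = aff_dim (V \<inter> Q)"
    using face_eq_hull[OF assms(1)] aff_dim_convex_hull by metis
  also have "\<dots> = int (dim ((\<lambda>w. w - a) ` (V \<inter> Q)))"
    using assms(2) by (intro aff_dim_eq_dim_subtract hull_inc)
  finally show ?thesis .
qed

lemma dim_normal_cone:
  assumes "Q face_of P" "Q \<noteq> {}"
  shows "int (dim (normal_cone P Q)) + aff_dim Q = int CARD('n)"
proof -
  obtain a where a: "a \<in> V \<inter> Q" using face_vertex[OF assms] by blast
  have "dim (normal_cone P Q) = dim (perp ((\<lambda>w. w - a) ` (V \<inter> Q)))"
    using span_normal_cone[OF assms a] dim_span[of "normal_cone P Q"] by simp
  then show ?thesis
    using dim_perp[of "(\<lambda>w. w - a) ` (V \<inter> Q)"] aff_dim_face[OF assms(1) a] by linarith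
qed

text \<open>On each chart the weight of a lattice point \<open>u\<close> is \<open>g (u - a)\<close>, where \<open>a\<close> is a lattice point of \<open>Q\<close>. It is
nonzero exactly when \<open>u - a \<in> (normal_cone P Q)\<^sup>\<bottom>\<close>, that is, when \<open>u\<close> lies in \<open>Q\<close>. Another choice of \<open>a\<close>
multiplies all weights by one nonzero factor and leaves the barycentre unchanged. A barycentre of all
lattice points of \<open>Q\<close>, the vertices among them, with positive weights lies in the relative interior.\<close>

lemma Delzant_coord:
  assumes Q: "Q face_of P" "Q \<noteq> {}" and g: "reduced RR_nonneg 0 (normal_cone P Q) g"
  shows "Delzant_to_polytope P (toric_class F RR_nonneg (normal_cone P Q, g)) \<in> rel_interior Q"
proof -
  interpret exposed_fan F by (rule exposed_fan)
  interpret R: toric F RR_nonneg 0 by (rule toric_RR)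
  let ?\<tau> = "normal_cone P Q"
  let ?L = "P \<inter> int_vecs"
  have \<tau>: "?\<tau> \<in> F" using normal_cone_in Q by blast
  note hg = reduced_hom[OF g]
  have VP: "V \<subseteq> P" using hull_subset[of V convex] P by auto
  have QP: "Q \<subseteq> P" using Q(1) by (rule face_of_imp_subset)
  have finL: "finite ?L" using finV P by (intro finite_bounded_int_vecs) (simp add: finite_imp_bounded bounded_convex_hull)
  \<comment> \<open>The lattice points with nonzero weight.\<close>
  define S where "S = Q \<inter> int_vecs"
  have S: "finite S" "S \<subseteq> ?L" using finL QP finite_subset[of S ?L] by (auto simp: S_def)
  have dual: "u - a \<in> dual_sg ?\<tau>" if "u \<in> ?L" "a \<in> S" for u a
    using that by (auto simp: dual_sg_def S_def int_vecs_diff inner_diff_left normal_cone_def)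
  have perp_iff: "u - a \<in> perp ?\<tau> \<longleftrightarrow> u \<in> Q" if "u \<in> ?L" "a \<in> S" for u a
  proof
    assume "u - a \<in> perp ?\<tau>"
    then have "u \<bullet> v = a \<bullet> v" if "v \<in> ?\<tau>" for v using that by (auto simp: perp_def inner_diff_left)
    moreover have "a \<in> Q" using \<open>a \<in> S\<close> by (simp add: S_def)
    ultimately have "\<forall>v\<in>?\<tau>. \<forall>x\<in>P. u \<bullet> v \<le> x \<bullet> v" by (auto simp: normal_cone_def)
    then show "u \<in> Q" using face_eq_minimizers[OF Q] \<open>u \<in> ?L\<close> by blast
  next
    assume "u \<in> Q"
    then have "u \<bullet> v = a \<bullet> v" if "v \<in> ?\<tau>" for v
      using that \<open>a \<in> S\<close> QP by (intro antisym) (auto simp: normal_cone_def S_def)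
    then show "u - a \<in> perp ?\<tau>" by (simp add: perp_def inner_diff_left)
  qed
  have g_pos: "g (u - a) > 0" if "u \<in> S" "a \<in> S" for u a
  proof -
    have u: "u \<in> ?L" "u \<in> Q" using that S by (auto simp: S_def)
    have "g (u - a) \<noteq> 0" "g (u - a) \<ge> 0"
      using reduced_nonzero_iff[OF g dual[OF u(1) that(2)]] perp_iff[OF u(1) that(2)] u(2)
        hom_sg_closed[OF hg dual[OF u(1) that(2)]] by auto
    then show ?thesis by simp
  qed
  have g_zero: "g (u - a) = 0" if "u \<in> ?L - S" "a \<in> S" for u a
  proof -
    have "u \<in> ?L" "u \<notin> Q" using that by (auto simp: S_def)
    then show ?thesis using reduced_nonzero_iff[OF g dual[OF _ that(2)]] perp_iff[OF _ that(2)] by blast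
  qed
  define bary where "bary a = (\<Sum>u\<in>S. g (u - a) *\<^sub>R u) /\<^sub>R (\<Sum>u\<in>S. g (u - a))" for a
  have SL: "(\<Sum>u\<in>?L. g (u - a) *\<^sub>R u) = (\<Sum>u\<in>S. g (u - a) *\<^sub>R u)" "(\<Sum>u\<in>?L. g (u - a)) = (\<Sum>u\<in>S. g (u - a))"
    if "a \<in> S" for a
    using g_zero[OF _ that] S finL by (auto intro!: sum.mono_neutral_right)
  obtain a0 where a0: "a0 \<in> V \<inter> Q" using face_vertex[OF Q] by blast
  then have a0S: "a0 \<in> S" using Vint by (auto simp: S_def)
  have bary_indep: "bary a = bary a0" if a: "a \<in> S" for a
  proof -
    have aL: "a0 \<in> ?L" using a0S S by blast
    have eq: "g (u - a) = g (u - a0) * g (a0 - a)" if "u \<in> S" for u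
      using hom_sg_add[OF hg dual[OF _ a0S] dual[OF aL a], of u] that S by (auto simp: mult_mult_on)
    have c: "g (a0 - a) \<noteq> 0" using g_pos[OF a0S a] by simp
    have "(\<Sum>u\<in>S. g (u - a) *\<^sub>R u) = g (a0 - a) *\<^sub>R (\<Sum>u\<in>S. g (u - a0) *\<^sub>R u)"
      unfolding scaleR_sum_right by (intro sum.cong refl) (simp add: eq mult.commute)
    moreover have "(\<Sum>u\<in>S. g (u - a)) = g (a0 - a) * (\<Sum>u\<in>S. g (u - a0))"
      unfolding sum_distrib_left by (intro sum.cong refl) (simp add: eq mult.commute)
    ultimately show ?thesis using c by (simp add: bary_def)
  qed
  have coord: "polytope_coord P (\<sigma>, restrict g (dual_sg \<sigma>)) = bary a0" if \<sigma>: "\<sigma> \<in> F" "?\<tau> \<subseteq> \<sigma>" for \<sigma>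
  proof -
    obtain Q' where Q': "Q' face_of P" "Q' \<noteq> {}" "\<sigma> = normal_cone P Q'" using fan_cone_cases[OF \<sigma>(1)] by blast
    have "Q' \<subseteq> Q" using normal_cone_antimono_iff Q Q' \<sigma>(2) by blast
    define a where "a = (SOME a. a \<in> P \<inter> int_vecs \<and> (\<forall>v\<in>\<sigma>. \<forall>u\<in>P. a \<bullet> v \<le> u \<bullet> v))"
    obtain b where b: "b \<in> V \<inter> Q'" using face_vertex[OF Q'(1,2)] by blast
    have "b \<in> P \<inter> int_vecs \<and> (\<forall>v\<in>\<sigma>. \<forall>u\<in>P. b \<bullet> v \<le> u \<bullet> v)"
      using b VP Vint Q'(3) by (auto simp: normal_cone_def)
    then have a: "a \<in> P \<inter> int_vecs \<and> (\<forall>v\<in>\<sigma>. \<forall>u\<in>P. a \<bullet> v \<le> u \<bullet> v)"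
      unfolding a_def by (rule someI)
    then have "a \<in> Q'" using face_eq_minimizers[OF Q'(1,2)] Q'(3) by blast
    then have aS: "a \<in> S" using a \<open>Q' \<subseteq> Q\<close> by (auto simp: S_def)
    have "restrict g (dual_sg \<sigma>) (u - a) = g (u - a)" if "u \<in> ?L" for u
      using that a by (auto simp: dual_sg_def int_vecs_diff inner_diff_left)
    then have "(\<Sum>u\<in>?L. restrict g (dual_sg \<sigma>) (u - a) *\<^sub>R u) = (\<Sum>u\<in>?L. g (u - a) *\<^sub>R u)"
      "(\<Sum>u\<in>?L. restrict g (dual_sg \<sigma>) (u - a)) = (\<Sum>u\<in>?L. g (u - a))"
      by (auto intro!: sum.cong simp del: restrict_apply)
    then have "polytope_coord P (\<sigma>, restrict g (dual_sg \<sigma>)) =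
        (\<Sum>u\<in>?L. g (u - a) *\<^sub>R u) /\<^sub>R (\<Sum>u\<in>?L. g (u - a))"
      unfolding polytope_coord_def Let_def case_prod_conv a_def[symmetric] by (simp only:)
    also have "\<dots> = bary a" unfolding SL[OF aS] bary_def ..
    finally show ?thesis using bary_indep[OF aS] by simp
  qed
  have "polytope_coord P ` toric_class F RR_nonneg (?\<tau>, g) = {bary a0}"
  proof -
    have "c = bary a0" if "c \<in> polytope_coord P ` toric_class F RR_nonneg (?\<tau>, g)" for c
      using that coord unfolding R.toric_class_reduced[OF \<tau> g] by auto
    then have "polytope_coord P ` toric_class F RR_nonneg (?\<tau>, g) \<subseteq> {bary a0}"
      by (intro subsetI) (simp only: singleton_iff)
    moreover have "polytope_coord P ` toric_class F RR_nonneg (?\<tau>, g) \<noteq> {}"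
      using R.toric_class_self by (metis empty_iff image_is_empty)
    ultimately show ?thesis by (metis subset_singletonD)
  qed
  then have val: "Delzant_to_polytope P (toric_class F RR_nonneg (?\<tau>, g)) = bary a0"
    by (simp add: Delzant_to_polytope_def)
  have hullS: "convex hull S = Q"
  proof
    show "convex hull S \<subseteq> Q"
      using face_of_imp_convex[OF Q(1)] by (intro hull_minimal) (auto simp: S_def)
    have "V \<inter> Q \<subseteq> S" using Vint by (auto simp: S_def)
    then show "Q \<subseteq> convex hull S" using face_eq_hull[OF Q(1)] hull_mono by metis
  qed
  define W where "W = (\<Sum>u\<in>S. g (u - a0))"
  have W: "W > 0" unfolding W_def using S a0S g_pos by (intro sum_pos) auto
  have "bary a0 \<in> {y. \<exists>c. (\<forall>x\<in>S. 0 < c x) \<and> sum c S = 1 \<and> (\<Sum>x\<in>S. c x *\<^sub>R x) = y}"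
  proof -
    define c where "c x = g (x - a0) / W" for x
    have "\<forall>x\<in>S. 0 < c x" using g_pos a0S W by (simp add: c_def)
    moreover have "sum c S = 1" using W by (simp add: c_def W_def flip: sum_divide_distrib)
    moreover have "(\<Sum>x\<in>S. c x *\<^sub>R x) = bary a0"
      by (simp add: bary_def scaleR_sum_right c_def W_def[symmetric] divide_inverse mult.commute)
    ultimately show ?thesis by blast
  qed
  then show ?thesis
    using explicit_subset_rel_interior_convex_hull_minimal[OF S(1)] unfolding hullS val by blast
qed

section \<open>Divisors and cusps\<close>

text \<open>Both sets consist of the orbits of the faces contained in \<open>Q\<close>: the first because a face that meets the relative interior
of \<open>Q'\<close> contains \<open>Q'\<close>, the second because the closure of an orbit is the union of the orbits of the
larger cones.\<close>

lemma singular_divisor_eq: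
  assumes Q: "Q face_of P" "Q \<noteq> {}"
  shows "{x \<in> topspace (toric_variety_Q F). Delzant_to_polytope P (moment_map F x) \<in> Q} =
    {toric_class F CC_Q (normal_cone P Q', g) | Q' g.
       Q' face_of P \<and> Q' \<noteq> {} \<and> Q' \<subseteq> Q \<and> reduced CC_Q zero_Q (normal_cone P Q') g}" (is "?S = ?R")
    and "{x \<in> topspace (toric_variety_Q F). toric_proj F x \<in> invariant_divisor F (normal_cone P Q)} =
    {toric_class F CC_Q (normal_cone P Q', g) | Q' g.
       Q' face_of P \<and> Q' \<noteq> {} \<and> Q' \<subseteq> Q \<and> reduced CC_Q zero_Q (normal_cone P Q') g}" (is "?D = _")
proof -
  interpret exposed_fan F by (rule exposed_fan)
  have top: "topspace (toric_variety_Q F) = {toric_class F CC_Q (normal_cone P Q', g) | Q' g.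
       Q' face_of P \<and> Q' \<noteq> {} \<and> reduced CC_Q zero_Q (normal_cone P Q') g}"
    unfolding toric.topspace_toric_space[OF toric_CC_Q] using normal_cone_in by (metis (lifting) fan_cone_cases)
  have S: "Delzant_to_polytope P (moment_map F (toric_class F CC_Q (normal_cone P Q', g))) \<in> Q \<longleftrightarrow> Q' \<subseteq> Q"
    if Q': "Q' face_of P" "Q' \<noteq> {}" and g: "reduced CC_Q zero_Q (normal_cone P Q') g" for Q' g
  proof -
    have ri: "Delzant_to_polytope P (moment_map F (toric_class F CC_Q (normal_cone P Q', g))) \<in> rel_interior Q'"
      unfolding moment_map_reduced(2)[OF normal_cone_in[OF Q'] g]
      by (rule Delzant_coord[OF Q' moment_map_reduced(1)[OF normal_cone_in[OF Q'] g]])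
    then show ?thesis
      using subset_of_face_of[OF Q(1) face_of_imp_subset[OF Q'(1)]] rel_interior_subset[of Q'] by blast
  qed
  have D: "toric_proj F (toric_class F CC_Q (normal_cone P Q', g)) \<in> invariant_divisor F (normal_cone P Q) \<longleftrightarrow> Q' \<subseteq> Q"
    if Q': "Q' face_of P" "Q' \<noteq> {}" and g: "reduced CC_Q zero_Q (normal_cone P Q') g" for Q' g
  proof -
    note r = toric_proj_reduced[OF normal_cone_in[OF Q'] g]
    show ?thesis
      unfolding r(2) invariant_divisor_eq[OF exposed_fan normal_cone_in[OF Q]] normal_cone_antimono_iff[OF Q' Q, symmetric]
      using normal_cone_in[OF Q'] r(1) toric.toric_class_inj[OF toric_CC normal_cone_in[OF Q'] r(1)] by blast
  qed
  show "?S = ?R" unfolding top using S by blast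
  show "?D = ?R" unfolding top using D by blast
qed

lemma facet_iff_ray:
  assumes "Q face_of P" "Q \<noteq> {}"
  shows "Q facet_of P \<longleftrightarrow> normal_cone P Q \<in> rays F"
  using dim_normal_cone[OF assms] normal_cone_in[OF assms] assms full_dim
  by (auto simp: facet_of_def rays_def)

text \<open>A facet is recovered from its divisor, since the special point of its ray lies on no divisor of another facet.\<close>

lemma facets_singular_divisors:
  "bij_betw (\<lambda>Q. {x \<in> topspace (toric_variety_Q F). Delzant_to_polytope P (moment_map F x) \<in> Q})
     {Q. Q facet_of P} (singular_divisors F)" (is "bij_betw ?S _ _")
proof -
  interpret exposed_fan F by (rule exposed_fan)
  interpret toric F CC_Q zero_Q by (rule toric_CC_Q)
  have facet: "Q face_of P \<and> Q \<noteq> {}" if "Q facet_of P" for Q using that by (auto simp: facet_of_def)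
  have SD: "?S Q = {x \<in> topspace (toric_variety_Q F). toric_proj F x \<in> invariant_divisor F (normal_cone P Q)}"
    if "Q facet_of P" for Q
    using singular_divisor_eq[of Q] facet[OF that] by simp
  have sub: "Q1 \<subseteq> Q2" if "Q1 facet_of P" "Q2 facet_of P" "?S Q1 = ?S Q2" for Q1 Q2
  proof -
    have Q: "Q1 face_of P" "Q1 \<noteq> {}" "Q2 face_of P" "Q2 \<noteq> {}" using that facet by auto
    let ?x = "toric_class F CC_Q (normal_cone P Q1, indicator_hom (normal_cone P Q1))"
    have "?x \<in> ?S Q1" unfolding singular_divisor_eq(1)[OF Q(1,2)] using Q reduced_indicator_hom by blast
    then have "?x \<in> ?S Q2" using that(3) by simp
    then obtain Q' g where Q': "Q' face_of P" "Q' \<noteq> {}" "Q' \<subseteq> Q2" "reduced CC_Q zero_Q (normal_cone P Q') g"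
      "?x = toric_class F CC_Q (normal_cone P Q', g)"
      unfolding singular_divisor_eq(1)[OF Q(3,4)] by blast
    have "normal_cone P Q1 = normal_cone P Q'"
      using toric_class_inj[OF normal_cone_in[OF Q(1,2)] reduced_indicator_hom normal_cone_in[OF Q'(1,2)] Q'(4,5)] by blast
    then have "Q1 = Q'" using normal_cone_inj Q Q' by blast
    then show ?thesis using Q'(3) by simp
  qed
  have "inj_on ?S {Q. Q facet_of P}"
    by (rule inj_onI) (use sub in \<open>blast intro: subset_antisym\<close>)
  moreover have "?S ` {Q. Q facet_of P} = singular_divisors F"
  proof -
    have "rays F = normal_cone P ` {Q. Q facet_of P}"
    proof (intro equalityI subsetI)
      fix \<rho> assume \<rho>: "\<rho> \<in> rays F"
      then have "\<rho> \<in> F" by (simp add: rays_def)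
      then obtain Q where Q: "Q face_of P" "Q \<noteq> {}" "\<rho> = normal_cone P Q" using fan_cone_cases by blast
      then have "Q facet_of P" using facet_iff_ray[OF Q(1,2)] \<rho> by simp
      then show "\<rho> \<in> normal_cone P ` {Q. Q facet_of P}" using Q(3) by blast
    qed (use facet facet_iff_ray in blast)
    then show ?thesis
      unfolding singular_divisors_def by (simp only: image_image) (rule image_cong[OF refl], rule SD, simp)
  qed
  ultimately show ?thesis by (simp add: bij_betw_def)
qed

lemma perp_vertex_cone:
  assumes "v extreme_point_of P"
  shows "perp (normal_cone P {v}) = {0}"
proof -
  have f: "{v} face_of P" using assms face_of_singleton by blast
  have "v \<in> V" using assms extreme_point_of_convex_hull P by blast
  then show ?thesis using perp_normal_cone[OF f, of v] by simp
qed

text \<open>Over the special point of a full-dimensional cone lies a single point, because a reduced morphism there is nonzero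
only at \<open>0\<close>.\<close>

lemma cusps_eq:
  "cusps F = (\<lambda>v. toric_class F CC_Q (normal_cone P {v}, toric.indicator_hom CC_Q zero_Q (normal_cone P {v}))) ` {v. v extreme_point_of P}"
    (is "_ = ?c ` _")
proof (intro equalityI subsetI)
  interpret exposed_fan F by (rule exposed_fan)
  interpret Q: toric F CC_Q zero_Q by (rule toric_CC_Q)
  interpret C: toric F CC 0 by (rule toric_CC)
  {
    fix x assume "x \<in> cusps F"
    then obtain \<sigma> where x: "x \<in> topspace (toric_variety_Q F)" and \<sigma>: "\<sigma> \<in> F" "dim \<sigma> = CARD('n)"
      "toric_proj F x = special_point F \<sigma>" unfolding cusps_def by blast
    obtain Q where Q: "Q face_of P" "Q \<noteq> {}" "\<sigma> = normal_cone P Q" using fan_cone_cases[OF \<sigma>(1)] by blast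
    have "aff_dim Q = 0" using dim_normal_cone[OF Q(1,2)] \<sigma>(2) Q(3) by simp
    then obtain v where v: "Q = {v}" using aff_dim_eq_0 by blast
    then have ve: "v extreme_point_of P" using Q(1) face_of_singleton by blast
    obtain \<tau> g where g: "x = toric_class F CC_Q (\<tau>, g)" "\<tau> \<in> F" "reduced CC_Q zero_Q \<tau> g"
      using x unfolding Q.topspace_toric_space by blast
    note r = toric_proj_reduced[OF g(2,3)]
    have "\<tau> = \<sigma>"
      using \<sigma>(3) C.toric_class_inj[OF g(2) r(1) \<sigma>(1) C.reduced_indicator_hom]
      unfolding g(1) r(2) torus_orbit_eq(2)[OF exposed_fan \<sigma>(1)] by blast
    then have \<tau>: "\<tau> = normal_cone P {v}" using Q(3) v by simp
    have "g u = Q.indicator_hom \<tau> u" for u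
    proof (cases "u \<in> dual_sg \<tau>")
      case True
      show ?thesis
      proof (cases "u = 0")
        case True
        then show ?thesis using hom_sg_0[OF reduced_hom[OF g(3)]] by (simp add: Q.indicator_hom_def)
      next
        case False
        then have "u \<notin> perp \<tau>" using perp_vertex_cone[OF ve] \<tau> by simp
        then show ?thesis using True reduced_nonzero_iff[OF g(3) True] by (simp add: Q.indicator_hom_def)
      qed
    next
      case False
      then show ?thesis using fun_cong[OF hom_sg_ext[OF reduced_hom[OF g(3)]], of u] by (simp add: Q.indicator_hom_def)
    qed
    then have "g = Q.indicator_hom \<tau>" ..
    then show "x \<in> ?c ` {v. v extreme_point_of P}" using g(1) \<tau> ve by blast
  next
    fix x assume "x \<in> ?c ` {v. v extreme_point_of P}"
    then obtain v where v: "v extreme_point_of P" and x: "x = ?c v" by blast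
    have f: "{v} face_of P" using v face_of_singleton by blast
    let ?\<sigma> = "normal_cone P {v}"
    have \<sigma>: "?\<sigma> \<in> F" using normal_cone_in f by blast
    have dim: "dim ?\<sigma> = CARD('n)" using dim_normal_cone[OF f] by simp
    have "(\<lambda>u\<in>dual_sg ?\<sigma>. proj1 (Q.indicator_hom ?\<sigma> u)) = C.indicator_hom ?\<sigma>"
      by (auto simp: Q.indicator_hom_def C.indicator_hom_def proj1_one one_mult_on fun_eq_iff proj1_zero_iff Q.zero_closed)
    then have "toric_proj F x = special_point F ?\<sigma>"
      unfolding x toric_proj_reduced(2)[OF \<sigma> Q.reduced_indicator_hom] torus_orbit_eq(2)[OF exposed_fan \<sigma>] by simp
    moreover have "x \<in> topspace (toric_variety_Q F)"
      unfolding x Q.topspace_toric_space using \<sigma> Q.reduced_indicator_hom by blast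
    ultimately show "x \<in> cusps F" unfolding cusps_def using \<sigma> dim by blast
  }
qed

lemma card_cusps: "finite (cusps F)" "card (cusps F) = card {v. v extreme_point_of P}"
proof -
  interpret exposed_fan F by (rule exposed_fan)
  interpret Q: toric F CC_Q zero_Q by (rule toric_CC_Q)
  let ?c = "\<lambda>v. toric_class F CC_Q (normal_cone P {v}, Q.indicator_hom (normal_cone P {v}))"
  have "{v. v extreme_point_of P} \<subseteq> V" using extreme_point_of_convex_hull P by blast
  then have fin: "finite {v. v extreme_point_of P}" using finV finite_subset by blast
  show "finite (cusps F)" unfolding cusps_eq using fin by simp
  have "inj_on ?c {v. v extreme_point_of P}"
  proof (rule inj_onI)
    fix v w assume v: "v \<in> {v. v extreme_point_of P}" and w: "w \<in> {v. v extreme_point_of P}" and eq: "?c v = ?c w"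
    have f: "{v} face_of P" "{w} face_of P" using v w face_of_singleton by auto
    have "normal_cone P {v} = normal_cone P {w}"
      using Q.toric_class_inj[OF normal_cone_in[OF f(1)] Q.reduced_indicator_hom normal_cone_in[OF f(2)] Q.reduced_indicator_hom eq] by simp
    then show "v = w" using normal_cone_inj[OF f(1) _ f(2)] by blast
  qed
  then show "card (cusps F) = card {v. v extreme_point_of P}"
    unfolding cusps_eq by (rule card_image)
qed

text \<open>Differences of points of \<open>V\<close> in \<open>Q\<close> are lattice vectors and span the annihilator of the normal cone.\<close>

lemma face_lattice_basis:
  assumes Q: "Q face_of P" "Q \<noteq> {}" and m: "aff_dim Q = int m"
  obtains e where "\<And>i. i < m \<Longrightarrow> e i \<in> int_vecs" "inj_on e {..<m}" "independent (e ` {..<m})"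
    "perp (normal_cone P Q) = span (e ` {..<m})"
proof -
  obtain a where a: "a \<in> V \<inter> Q" using face_vertex[OF Q] by blast
  let ?D = "(\<lambda>w. w - a) ` (V \<inter> Q)"
  obtain E where E: "E \<subseteq> ?D" "independent E" "?D \<subseteq> span E" "card E = dim ?D"
    using basis_exists[of ?D] by blast
  have "card E = m" using E(4) m aff_dim_face[OF Q(1) a] by simp
  moreover have finE: "finite E" using E(2) by (rule independent_imp_finite)
  ultimately obtain e where e: "bij_betw e {..<m} E"
    using bij_betw_from_nat_into_finite[of E] by auto
  have "E \<subseteq> int_vecs" using E(1) Vint a by (auto intro!: int_vecs_diff)
  moreover have "span ?D = span E" using E(1,3) by (metis span_eq span_superset subset_trans)
  ultimately show ?thesis
    using that[of e] e E(2) perp_normal_cone[OF Q a] unfolding bij_betw_def by blast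
qed

end

theorem proposition3:
  fixes F :: "(real^'n) set set" and P :: "(real^'n) set"
  assumes "fan F"
    and "lattice_polytope P" and "aff_dim P = int CARD('n)" and "F = normal_fan P"
  shows
    "(\<forall>m Q p. Q face_of P \<and> aff_dim Q = int m \<and> p \<in> topspace (Delzant F)
          \<and> Delzant_to_polytope P p \<in> rel_interior Q \<longrightarrow>
        (\<exists>h \<phi>.
          homeomorphic_map (topo (top_power SS1_Q m))
            (subtopology (toric_variety_Q F)
              {x \<in> topspace (toric_variety_Q F). moment_map F x = p}) h \<and>
          \<phi> \<in> hom (hom_sg int_vecs SS1_Q) (top_power SS1_Q m) \<and>
          continuous_map (topo (hom_sg (int_vecs :: (real^'n) set) SS1_Q))
            (topo (top_power SS1_Q m)) \<phi> \<and>
          \<phi> ` carrier (hom_sg int_vecs SS1_Q) = carrier (top_power SS1_Q m) \<and>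
          (\<forall>t \<in> carrier (hom_sg int_vecs SS1_Q). \<forall>s \<in> carrier (top_power SS1_Q m).
             h (\<phi> t \<otimes>\<^bsub>top_power SS1_Q m\<^esub> s) = torus_action F CC_Q t (h s))))
     \<and> bij_betw
         (\<lambda>Q. {x \<in> topspace (toric_variety_Q F). Delzant_to_polytope P (moment_map F x) \<in> Q})
         {Q. Q facet_of P} (singular_divisors F)
     \<and> finite (cusps F) \<and> card (cusps F) = card {v. v extreme_point_of P}"
proof -
  obtain V where "finite V" "V \<subseteq> int_vecs" "P = convex hull V"
    using assms(2) unfolding lattice_polytope_def by blast
  then interpret polytope_fan P V F
    using assms by unfold_locales
  interpret exposed_fan F by (rule exposed_fan)
  show ?thesis
  proof (intro conjI facets_singular_divisors card_cusps allI impI)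
    fix m Q p
    assume *: "Q face_of P \<and> aff_dim Q = int m \<and> p \<in> topspace (Delzant F)
        \<and> Delzant_to_polytope P p \<in> rel_interior Q"
    then have Q: "Q face_of P" "Q \<noteq> {}" by auto
    obtain \<tau> g where "p = toric_class F RR_nonneg (\<tau>, g)" "\<tau> \<in> F" "reduced RR_nonneg 0 \<tau> g"
      using * unfolding toric.topspace_toric_space[OF toric_RR] by blast
    moreover obtain Q' where Q': "Q' face_of P" "Q' \<noteq> {}" "\<tau> = normal_cone P Q'"
      using fan_cone_cases[OF calculation(2)] by blast
    ultimately have g: "p = toric_class F RR_nonneg (normal_cone P Q', g)"
      "normal_cone P Q' \<in> F" "reduced RR_nonneg 0 (normal_cone P Q') g" by auto
    have "Delzant_to_polytope P p \<in> rel_interior Q'"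
      unfolding g(1) by (rule Delzant_coord[OF Q'(1,2) g(3)])
    then have QQ: "Q' = Q" using face_of_eq[OF Q'(1) Q(1)] * by blast
    obtain e where e: "\<And>i. i < m \<Longrightarrow> e i \<in> int_vecs" "inj_on e {..<m}" "independent (e ` {..<m})"
      "perp (normal_cone P Q) = span (e ` {..<m})"
      using face_lattice_basis[OF Q] * by metis
    show "\<exists>h \<phi>.
          homeomorphic_map (topo (top_power SS1_Q m))
            (subtopology (toric_variety_Q F)
              {x \<in> topspace (toric_variety_Q F). moment_map F x = p}) h \<and>
          \<phi> \<in> hom (hom_sg int_vecs SS1_Q) (top_power SS1_Q m) \<and>
          continuous_map (topo (hom_sg (int_vecs :: (real^'n) set) SS1_Q))
            (topo (top_power SS1_Q m)) \<phi> \<and>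
          \<phi> ` carrier (hom_sg int_vecs SS1_Q) = carrier (top_power SS1_Q m) \<and>
          (\<forall>t \<in> carrier (hom_sg int_vecs SS1_Q). \<forall>s \<in> carrier (top_power SS1_Q m).
             h (\<phi> t \<otimes>\<^bsub>top_power SS1_Q m\<^esub> s) = torus_action F CC_Q t (h s))"
      unfolding g(1) QQ
      by (rule moment_fibre_solenoidal_torus[OF exposed_fan g(2)[unfolded QQ] g(3)[unfolded QQ] e])
  qed
qed

end
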